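(* There exists a critical speed $c_0\in(0,c_s)$ such that for every $c\in(c_0,c_s)$ there exists a non-constant smooth solution $Q_c=(\eta_c,v_c)\in\mathcal{NX}^2$ of $(TW_{c,hy})$, unique up to translations. Normalizing $\eta_c,v_c$ to be even, the map $c\mapsto Q_c$ belongs to $\mathcal C^2\big((c_0,c_s),\mathcal{NX}^2\big)$, and for every $c\in(c_0,c_s)$, $$\frac{d}{dc}\big(p(Q_c)\big)<0.$$ Moreover there exist constants $a_d,K_d>0$, independent of $c\in(c_0,c_s)$ and of $x\in\mathbb R$, such that for all $c\in(c_0,c_s)$ and $x\in\mathbb R$, $$\sum_{\substack{0\le k_1\le 3\\0\le k_2\le 2\\0\le j\le 2}}(c_s^2-c^2)^{j-1}\Big(|\partial_c^j\partial_x^{k_1}\eta_c(x)|+c^{1+2j+2k_2}|\partial_c^j\partial_x^{k_2}v_c(x)|\Big)\le K_d\,e^{-a_d\sqrt{c_s^2-c^2}\,|x|}.$$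
   Context: Standing assumptions: $f\in\mathcal C^3(\mathbb R_+)$ with $f(1)=0$ and $f'(1)<0$; $c_s:=\sqrt{-2f'(1)}$; $F(r):=\int_r^1 f(\rho)\,d\rho$. Assume (H1) $\frac{c_s^2}{4}(1-\rho)^2\le F(\rho)$ for all $\rho$; (H2) there exist $M\ge 0$, $q\in[2,\infty)$ with $F(\rho)\le M|1-\rho|^q$ for all $\rho\ge 2$; (H3) $f''(1)+3f'(1)\neq 0$. For $k\ge 0$, $\mathcal X^k:=H^{k+1}(\mathbb R)\times H^k(\mathbb R)$ with norm $\|(\eta,v)\|_{\mathcal X^k}^2=\|\eta\|_{H^{k+1}}^2+\|v\|_{H^k}^2$, and $\mathcal{NX}^k:=\{(\eta,v)\in\mathcal X^k:\ \sup_{\mathbb R}\eta<1\}$; $\mathcal X:=\mathcal X^0$, $\mathcal{NX}:=\mathcal{NX}^0$. Energy $E(\eta,v)=\frac18\int\frac{(\partial_x\eta)^2}{1-\eta}+\frac12\int(1-\eta)v^2+\frac12\int F(1-\eta)$ and momentum $p(\eta,v)=\frac12\int_{\mathbb R}\eta v$. The hydrodynamical travelling wave equation of speed $c$, $(TW_{c,hy})$, for $(\eta,v)$ is: $\frac c2\eta=v(1-\eta)$ and $cv=f(1-\eta)-v^2-\frac{\eta''}{2(1-\eta)}-\frac{(\eta')^2}{4(1-\eta)^2}$.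
   Formalization: Since f is only C^3, a C^∞ solution need not exist; "smooth" is read as: η_c and v_c solve the equation classically, lie in NX^2, and have all the classical derivatives in c and x that appear in the decay estimate. *)

theory Defs
  imports "HOL-Analysis.Analysis"
begin

definition L2fun :: "(real \<Rightarrow> real) \<Rightarrow> bool" where
  "L2fun u \<longleftrightarrow> u \<in> borel_measurable lborel \<and> integrable lborel (\<lambda>x. (u x)^2)"

definition test_fun :: "(real \<Rightarrow> real) \<Rightarrow> bool" where
  "test_fun \<phi> \<longleftrightarrow>
     (\<forall>n x. ((deriv ^^ n) \<phi> has_real_derivative (deriv ^^ Suc n) \<phi> x) (at x)) \<and>
     (\<exists>R. \<forall>x. R < \<bar>x\<bar> \<longrightarrow> \<phi> x = 0)"

definition is_weak_deriv :: "nat \<Rightarrow> (real \<Rightarrow> real) \<Rightarrow> (real \<Rightarrow> real) \<Rightarrow> bool" where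
  "is_weak_deriv n u g \<longleftrightarrow>
     (\<forall>\<phi>. test_fun \<phi> \<longrightarrow>
        integrable lborel (\<lambda>x. u x * (deriv ^^ n) \<phi> x) \<and>
        integrable lborel (\<lambda>x. g x * \<phi> x) \<and>
        (LINT x|lborel. u x * (deriv ^^ n) \<phi> x) = (-1)^n * (LINT x|lborel. g x * \<phi> x))"

text \<open>Membership in H^k(R), k \<ge> 1, identifying an element with its continuous representative.\<close>
definition in_H :: "nat \<Rightarrow> (real \<Rightarrow> real) \<Rightarrow> bool" where
  "in_H k u \<longleftrightarrow> continuous_on UNIV u \<and> (\<forall>i\<le>k. \<exists>g. L2fun g \<and> is_weak_deriv i u g)"

definition weak_deriv :: "nat \<Rightarrow> (real \<Rightarrow> real) \<Rightarrow> (real \<Rightarrow> real)" where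
  "weak_deriv i u = (SOME g. L2fun g \<and> is_weak_deriv i u g)"

definition H_norm_sq :: "nat \<Rightarrow> (real \<Rightarrow> real) \<Rightarrow> real" where
  "H_norm_sq k u = (\<Sum>i\<le>k. LINT x|lborel. (weak_deriv i u x)^2)"

definition in_X :: "nat \<Rightarrow> (real \<Rightarrow> real) \<Rightarrow> (real \<Rightarrow> real) \<Rightarrow> bool" where
  "in_X k \<eta> v \<longleftrightarrow> in_H (k+1) \<eta> \<and> in_H k v"

definition X_norm :: "nat \<Rightarrow> (real \<Rightarrow> real) \<Rightarrow> (real \<Rightarrow> real) \<Rightarrow> real" where
  "X_norm k \<eta> v = sqrt (H_norm_sq (k+1) \<eta> + H_norm_sq k v)"

definition in_NX :: "nat \<Rightarrow> (real \<Rightarrow> real) \<Rightarrow> (real \<Rightarrow> real) \<Rightarrow> bool" where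
  "in_NX k \<eta> v \<longleftrightarrow> in_X k \<eta> v \<and> Sup (range \<eta>) < 1"

definition has_X_deriv ::
  "nat \<Rightarrow> (real \<Rightarrow> real \<Rightarrow> real) \<Rightarrow> (real \<Rightarrow> real \<Rightarrow> real) \<Rightarrow>
   (real \<Rightarrow> real \<Rightarrow> real) \<Rightarrow> (real \<Rightarrow> real \<Rightarrow> real) \<Rightarrow> real \<Rightarrow> bool" where
  "has_X_deriv k E V E' V' c \<longleftrightarrow>
     ((\<lambda>h. X_norm k (\<lambda>x. E (c+h) x - E c x - h * E' c x)
                    (\<lambda>x. V (c+h) x - V c x - h * V' c x) / \<bar>h\<bar>) \<longlongrightarrow> 0) (at 0)"

definition X_continuous_at ::
  "nat \<Rightarrow> (real \<Rightarrow> real \<Rightarrow> real) \<Rightarrow> (real \<Rightarrow> real \<Rightarrow> real) \<Rightarrow> real \<Rightarrow> bool" where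
  "X_continuous_at k E V c \<longleftrightarrow>
     ((\<lambda>c'. X_norm k (\<lambda>x. E c' x - E c x) (\<lambda>x. V c' x - V c x)) \<longlongrightarrow> 0) (at c)"

text \<open>c \<mapsto> (E c, V c) belongs to C^2(I, NX^k) (I open).\<close>
definition C2_NX :: "nat \<Rightarrow> real set \<Rightarrow> (real \<Rightarrow> real \<Rightarrow> real) \<Rightarrow> (real \<Rightarrow> real \<Rightarrow> real) \<Rightarrow> bool" where
  "C2_NX k I E V \<longleftrightarrow>
     (\<exists>E1 V1 E2 V2. \<forall>c\<in>I.
        in_NX k (E c) (V c) \<and> in_X k (E1 c) (V1 c) \<and> in_X k (E2 c) (V2 c) \<and>
        has_X_deriv k E V E1 V1 c \<and> has_X_deriv k E1 V1 E2 V2 c \<and>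
        X_continuous_at k E2 V2 c)"

definition pd :: "(real \<Rightarrow> real \<Rightarrow> real) \<Rightarrow> nat \<Rightarrow> nat \<Rightarrow> real \<Rightarrow> real \<Rightarrow> real" where
  "pd U j k c x = (deriv ^^ j) (\<lambda>c'. (deriv ^^ k) (U c') x) c"

definition has_pds :: "(real \<Rightarrow> real \<Rightarrow> real) \<Rightarrow> real set \<Rightarrow> nat \<Rightarrow> nat \<Rightarrow> bool" where
  "has_pds U I jm km \<longleftrightarrow>
     (\<forall>c\<in>I. \<forall>x.
        (\<forall>k<km. ((deriv ^^ k) (U c) has_real_derivative (deriv ^^ Suc k) (U c) x) (at x)) \<and>
        (\<forall>k\<le>km. \<forall>j<jm. ((\<lambda>c'. pd U j k c' x) has_real_derivative pd U (Suc j) k c x) (at c)))"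

definition Fpot :: "(real \<Rightarrow> real) \<Rightarrow> real \<Rightarrow> real" where
  "Fpot f r = (LBINT \<rho>=r..1. f \<rho>)"

definition momentum :: "(real \<Rightarrow> real) \<Rightarrow> (real \<Rightarrow> real) \<Rightarrow> real" where
  "momentum \<eta> v = (1/2) * (LINT x|lborel. \<eta> x * v x)"

definition TW_hy :: "(real \<Rightarrow> real) \<Rightarrow> real \<Rightarrow> (real \<Rightarrow> real) \<Rightarrow> (real \<Rightarrow> real) \<Rightarrow> bool" where
  "TW_hy f c \<eta> v \<longleftrightarrow>
     (\<forall>x. (\<eta> has_real_derivative deriv \<eta> x) (at x) \<and>
          (deriv \<eta> has_real_derivative deriv (deriv \<eta>) x) (at x) \<and>
          c / 2 * \<eta> x = v x * (1 - \<eta> x) \<and>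
          c * v x = f (1 - \<eta> x) - (v x)^2 - deriv (deriv \<eta>) x / (2 * (1 - \<eta> x))
                    - (deriv \<eta> x)^2 / (4 * (1 - \<eta> x)^2))"

end

theory Submission
  imports Defs "HOL-Real_Asymp.Real_Asymp"
begin

text \<open>Let \<open>\<mu> = cs\<^sup>2 - c\<^sup>2\<close> and \<open>N(e) = cs\<^sup>2 e\<^sup>2 - 4 (1 - e) F(1 - e)\<close>. Eliminating \<open>v\<close> and integrating once, a wave
  that vanishes at infinity satisfies \<open>\<eta>'\<^sup>2 = \<mu> \<eta>\<^sup>2 - N(\<eta>)\<close>, and (H1) forces \<open>N(e) \<sim> cs\<^sup>2 e\<^sup>3\<close> at \<open>0\<close>.
  Let \<open>h\<close> be the inverse of \<open>e \<mapsto> N(e) / e\<^sup>2\<close> near \<open>0\<close> and put \<open>\<eta> = h(\<mu> sech\<^sup>2 s)\<close>. The equation becomes the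
  regular quadrature that \<open>\<surd>\<mu> x / 2\<close> is the integral of \<open>q(\<mu> sech\<^sup>2)\<close> from \<open>0\<close> to \<open>s\<close>, where
  \<open>q(y) = y h'(y) / h(y)\<close> tends to \<open>1\<close> at \<open>0\<close>.

  The functions \<open>h\<close> and \<open>q\<close> have limited smoothness at \<open>0\<close>, but \<open>y d/dy\<close> can be applied to them without
  changing their size. As a consequence \<open>\<mu> d/dc\<close> preserves the size of \<open>\<eta>\<close>, \<open>v\<close> and their derivatives in \<open>x\<close> up to
  powers of \<open>1 + \<surd>\<mu> |x|\<close>, which the exponential decay absorbs: these are the stated estimates. They
  dominate the difference quotients in \<open>c\<close>, which gives the regularity in the Sobolev norms.

  After the same substitution the momentum is \<open>c / (2 \<surd>\<mu>)\<close> times the integral of a function of \<open>\<mu> sech\<^sup>2\<close>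
  that vanishes quadratically at \<open>0\<close>. It behaves like \<open>\<mu>\<close> to the power \<open>3/2\<close>, and decreases with \<open>c\<close>.

  For uniqueness, the first integral of any solution is \<open>0\<close>, (H1) excludes negative values of \<open>\<eta>\<close>, the
  maximum of \<open>\<eta>\<close> is the first positive zero \<open>h(\<mu>)\<close> of \<open>\<mu> e\<^sup>2 - N(e)\<close>, and the Cauchy problem at the
  crest has one solution.\<close>

section \<open>Test functions and weak derivatives\<close>

definition flat_exp :: "nat \<Rightarrow> real \<Rightarrow> real" where
  "flat_exp p t = (if 0 < t then exp (- inverse t) * inverse t ^ p else 0)"

lemma flat_exp_tendsto_0: "(flat_exp p \<longlongrightarrow> 0) (at 0)"
proof -
  have "(flat_exp p \<longlongrightarrow> 0) (at_right 0)"
  proof (rule Lim_transform_eventually)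
    show "((\<lambda>t::real. exp (- inverse t) * inverse t ^ p) \<longlongrightarrow> 0) (at_right 0)"
      by real_asymp
    show "\<forall>\<^sub>F t in at_right 0. exp (- inverse t) * inverse t ^ p = flat_exp p t"
      by (auto simp: flat_exp_def eventually_at_filter)
  qed
  moreover have "(flat_exp p \<longlongrightarrow> 0) (at_left 0)"
    by (rule tendsto_eventually) (auto simp: flat_exp_def eventually_at_filter)
  ultimately show ?thesis
    by (simp add: filterlim_at_split)
qed

lemma flat_exp_has_derivative:
  "(flat_exp p has_real_derivative flat_exp (Suc (Suc p)) t - real p * flat_exp (Suc p) t) (at t)"
proof -
  consider "0 < t" | "t < 0" | "t = 0" by linarith
  then show ?thesis
  proof cases
    assume t_pos: "0 < t"
    have "((\<lambda>t. exp (- inverse t) * inverse t ^ p) has_real_derivative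
        flat_exp (Suc (Suc p)) t - real p * flat_exp (Suc p) t) (at t)"
    proof (cases p)
      case (Suc k)
      have "((\<lambda>t. exp (- inverse t)) has_real_derivative exp (- inverse t) * inverse t ^ 2) (at t)"
        using t_pos by (auto intro!: derivative_eq_intros simp: power2_eq_square)
      from DERIV_mult[OF this DERIV_power_Suc[OF DERIV_inverse, of t k]]
      show ?thesis
        unfolding Suc by (rule DERIV_cong) (use t_pos in \<open>auto simp: flat_exp_def algebra_simps power2_eq_square\<close>)
    qed (use t_pos in \<open>auto intro!: derivative_eq_intros simp: flat_exp_def power2_eq_square\<close>)
    then show ?thesis
      by (rule has_field_derivative_transform_within_open[of _ _ _ "{0<..}"])
        (use t_pos in \<open>auto simp: flat_exp_def\<close>)
  next
    assume t_neg: "t < 0"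
    then have "((\<lambda>t. 0) has_real_derivative flat_exp (Suc (Suc p)) t - real p * flat_exp (Suc p) t) (at t)"
      by (simp add: flat_exp_def)
    then show ?thesis
      by (rule has_field_derivative_transform_within_open[of _ _ _ "{..<0}"])
        (use t_neg in \<open>auto simp: flat_exp_def\<close>)
  next
    assume t_zero: "t = 0"
    have "(\<lambda>h. flat_exp p h / h) = flat_exp (Suc p)"
      by (auto simp: fun_eq_iff flat_exp_def divide_inverse)
    then show ?thesis
      using t_zero flat_exp_tendsto_0[of "Suc p"] by (simp add: has_field_derivative_iff flat_exp_def)
  qed
qed

inductive_set flat_exp_algebra :: "(real \<Rightarrow> real) set" where
  const: "(\<lambda>x. k) \<in> flat_exp_algebra"
| flat_exp: "(\<lambda>x. flat_exp p (a * x + b)) \<in> flat_exp_algebra"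
| add: "u \<in> flat_exp_algebra \<Longrightarrow> v \<in> flat_exp_algebra \<Longrightarrow> (\<lambda>x. u x + v x) \<in> flat_exp_algebra"
| mult: "u \<in> flat_exp_algebra \<Longrightarrow> v \<in> flat_exp_algebra \<Longrightarrow> (\<lambda>x. u x * v x) \<in> flat_exp_algebra"

lemma flat_exp_algebra_derivative:
  assumes "u \<in> flat_exp_algebra"
  shows "\<exists>u'\<in>flat_exp_algebra. \<forall>x. (u has_real_derivative u' x) (at x)"
  using assms
proof induction
  case (const k)
  show ?case by (rule bexI[of _ "\<lambda>x. 0"]) (auto intro: flat_exp_algebra.const)
next
  case (flat_exp p a b)
  let ?u' = "\<lambda>x. a * (flat_exp (Suc (Suc p)) (a * x + b) + (- real p) * flat_exp (Suc p) (a * x + b))"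
  have "((\<lambda>x. flat_exp p (a * x + b)) has_real_derivative ?u' x) (at x)" for x
    by (rule DERIV_cong[OF DERIV_chain2[OF flat_exp_has_derivative]])
      (auto intro!: derivative_eq_intros)
  moreover have "?u' \<in> flat_exp_algebra"
    by (intro flat_exp_algebra.intros)
  ultimately show ?case by (intro bexI[of _ ?u'] allI)
next
  case (add u v)
  then obtain u' v' where "u' \<in> flat_exp_algebra" "v' \<in> flat_exp_algebra"
    "\<forall>x. (u has_real_derivative u' x) (at x)" "\<forall>x. (v has_real_derivative v' x) (at x)"
    by blast
  then show ?case
    by (intro bexI[of _ "\<lambda>x. u' x + v' x"]) (auto intro: flat_exp_algebra.intros derivative_intros)
next
  case (mult u v)
  then obtain u' v' where "u' \<in> flat_exp_algebra" "v' \<in> flat_exp_algebra"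
    "\<forall>x. (u has_real_derivative u' x) (at x)" "\<forall>x. (v has_real_derivative v' x) (at x)"
    by blast
  then show ?case using mult.hyps
    by (intro bexI[of _ "\<lambda>x. u' x * v x + v' x * u x"])
      (auto intro!: flat_exp_algebra.intros DERIV_mult)
qed

lemma flat_exp_algebra_higher_derivative:
  assumes "u \<in> flat_exp_algebra"
  shows "((deriv ^^ n) u has_real_derivative (deriv ^^ Suc n) u x) (at x)"
proof -
  have deriv_u: "deriv u \<in> flat_exp_algebra" "\<forall>x. (u has_real_derivative deriv u x) (at x)"
    if u_mem: "u \<in> flat_exp_algebra" for u
  proof -
    obtain u' where "u' \<in> flat_exp_algebra" "\<And>x. (u has_real_derivative u' x) (at x)"
      using flat_exp_algebra_derivative[OF u_mem] by blast
    moreover from this(2) have "deriv u = u'" by (auto simp: DERIV_imp_deriv)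
    ultimately show "deriv u \<in> flat_exp_algebra" "\<forall>x. (u has_real_derivative deriv u x) (at x)"
      by auto
  qed
  have "(deriv ^^ n) u \<in> flat_exp_algebra"
    by (induction n) (use assms deriv_u in auto)
  with deriv_u show ?thesis by simp
qed

lemma test_fun_has_derivative: "test_fun \<phi> \<Longrightarrow> (\<phi> has_real_derivative deriv \<phi> x) (at x)"
  unfolding test_fun_def by (drule conjunct1, drule spec[of _ 0]) simp

lemma test_fun_continuous: "test_fun \<phi> \<Longrightarrow> continuous_on UNIV \<phi>"
  using test_fun_has_derivative DERIV_isCont by (blast intro: continuous_at_imp_continuous_on)

definition bump :: "nat \<Rightarrow> real \<Rightarrow> real \<Rightarrow> real \<Rightarrow> real" where
  "bump n a b x = flat_exp 0 (real n * x + - real n * a) * flat_exp 0 (- real n * x + real n * b)"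

lemma bump_eq_0: "x \<notin> {a<..<b} \<Longrightarrow> bump n a b x = 0"
proof -
  assume "x \<notin> {a<..<b}"
  then have "real n * x \<le> real n * a \<or> real n * b \<le> real n * x"
    by (auto simp: not_less intro: mult_left_mono)
  then show ?thesis by (auto simp: bump_def flat_exp_def)
qed

lemma bump_test_fun: "test_fun (bump n a b)"
proof -
  have "bump n a b \<in> flat_exp_algebra"
    unfolding bump_def by (intro flat_exp_algebra.intros)
  moreover have "bump n a b x = 0" if "\<bar>a\<bar> + \<bar>b\<bar> < \<bar>x\<bar>" for x
    using that by (intro bump_eq_0) auto
  ultimately show ?thesis
    unfolding test_fun_def using flat_exp_algebra_higher_derivative by blast
qed

lemma abs_bump_le_indicator: "\<bar>bump n a b x\<bar> \<le> indicator {a<..<b} x"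
proof (cases "x \<in> {a<..<b}")
  case True
  have "0 \<le> flat_exp 0 t \<and> flat_exp 0 t \<le> 1" for t
    by (auto simp: flat_exp_def)
  then show ?thesis using True
    by (auto simp: bump_def abs_mult intro!: mult_le_one)
qed (simp add: bump_eq_0)

lemma bump_tendsto_indicator: "(\<lambda>n. bump n a b x) \<longlonglongrightarrow> indicator {a<..<b} x"
proof (cases "x \<in> {a<..<b}")
  case True
  have flat_exp_lim: "(\<lambda>n. flat_exp 0 (real n * d)) \<longlonglongrightarrow> 1" if "0 < d" for d
  proof (rule Lim_transform_eventually)
    show "(\<lambda>n. exp (- inverse (real n * d))) \<longlonglongrightarrow> 1" using that by real_asymp
    show "\<forall>\<^sub>F n in sequentially. exp (- inverse (real n * d)) = flat_exp 0 (real n * d)"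
      using eventually_gt_at_top[of 0]
      by eventually_elim (use that in \<open>auto simp: flat_exp_def\<close>)
  qed
  have "bump n a b x = flat_exp 0 (real n * (x - a)) * flat_exp 0 (real n * (b - x))" for n
    by (simp add: bump_def algebra_simps)
  then show ?thesis
    using tendsto_mult[OF flat_exp_lim[of "x - a"] flat_exp_lim[of "b - x"]] True by simp
qed (simp add: bump_eq_0)

definition locally_integrable :: "(real \<Rightarrow> real) \<Rightarrow> bool" where
  "locally_integrable u \<longleftrightarrow> u \<in> borel_measurable borel \<and>
     (\<forall>a b. integrable lborel (\<lambda>x. indicator {a<..<b} x * u x))"

lemma locally_integrable_diff:
  assumes "locally_integrable u" "locally_integrable v"
  shows "locally_integrable (\<lambda>x. u x - v x)"
  using assms by (auto simp: locally_integrable_def right_diff_distrib)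

lemma AE_zero_if_integral_greaterThan_zero:
  fixes d :: "real \<Rightarrow> real"
  assumes d_integrable: "integrable lborel d"
    and zero: "\<And>a. (LINT x|lborel. indicator {a<..} x * d x) = 0"
  shows "AE x in lborel. d x = 0"
proof -
  have [measurable]: "d \<in> borel_measurable borel" using d_integrable by auto
  have pos_neg_parts: "(\<integral>\<^sup>+x. ennreal (d x) * indicator {a<..} x \<partial>lborel)
         = (\<integral>\<^sup>+x. ennreal (- d x) * indicator {a<..} x \<partial>lborel)"
    "(\<integral>\<^sup>+x. ennreal (d x) * indicator {a<..} x \<partial>lborel) < \<infinity>" for a
  proof -
    let ?e = "\<lambda>x. indicator {a<..} x * d x"
    have int_e: "integrable lborel ?e"
      using integrable_mult_indicator[OF _ d_integrable, of "{a<..}"] by simp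
    have restrict: "ennreal (d x) * indicator {a<..} x = ennreal (?e x)"
        "ennreal (- d x) * indicator {a<..} x = ennreal (- ?e x)" for x
      by (auto simp: indicator_def)
    have finite_parts: "(\<integral>\<^sup>+x. ennreal (?e x) \<partial>lborel) < \<infinity>" "(\<integral>\<^sup>+x. ennreal (- ?e x) \<partial>lborel) < \<infinity>"
      using int_e unfolding real_integrable_def by (auto simp: less_top)
    have "enn2real (\<integral>\<^sup>+x. ennreal (?e x) \<partial>lborel) = enn2real (\<integral>\<^sup>+x. ennreal (- ?e x) \<partial>lborel)"
      using zero[of a] real_lebesgue_integral_def[OF int_e] by simp
    then show "(\<integral>\<^sup>+x. ennreal (d x) * indicator {a<..} x \<partial>lborel)
         = (\<integral>\<^sup>+x. ennreal (- d x) * indicator {a<..} x \<partial>lborel)"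
      unfolding restrict using finite_parts by (metis ennreal_enn2real infinity_ennreal_def)
    show "(\<integral>\<^sup>+x. ennreal (d x) * indicator {a<..} x \<partial>lborel) < \<infinity>"
      unfolding restrict by (rule finite_parts)
  qed
  have "density lborel (\<lambda>x. ennreal (d x)) = density lborel (\<lambda>x. ennreal (- d x))"
    by (rule measure_eqI_lessThan) (use pos_neg_parts in \<open>auto simp: emeasure_density\<close>)
  then have "AE x in lborel. ennreal (d x) = ennreal (- d x)"
    by (intro sigma_finite_measure.density_unique[OF sigma_finite_lborel]) auto
  then show ?thesis
  proof eventually_elim
    case (elim x)
    then show ?case
      by (cases "d x \<ge> 0"; cases "d x = 0") (auto simp: ennreal_eq_0_iff ennreal_neg dest: sym)
  qed
qed

lemma integral_interval_zero_if_orthogonal_to_test_funs: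
  assumes d_loc: "locally_integrable d"
    and zero: "\<And>\<phi>. test_fun \<phi> \<Longrightarrow> (LINT x|lborel. d x * \<phi> x) = 0"
  shows "(LINT x|lborel. indicator {a<..<b} x * d x) = 0"
proof -
  have [measurable]: "d \<in> borel_measurable borel" "bump n a b \<in> borel_measurable borel" for n
    using d_loc test_fun_continuous[OF bump_test_fun]
    by (auto simp: locally_integrable_def intro: borel_measurable_continuous_onI)
  have "(\<lambda>n. LINT x|lborel. d x * bump n a b x) \<longlonglongrightarrow> (LINT x|lborel. indicator {a<..<b} x * d x)"
  proof (rule integral_dominated_convergence[where w = "\<lambda>x. \<bar>indicator {a<..<b} x * d x\<bar>"])
    show "AE x in lborel. (\<lambda>n. d x * bump n a b x) \<longlonglongrightarrow> indicator {a<..<b} x * d x"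
      using tendsto_mult[OF tendsto_const bump_tendsto_indicator] by (auto simp: mult.commute)
    show "AE x in lborel. norm (d x * bump n a b x) \<le> \<bar>indicator {a<..<b} x * d x\<bar>" for n
      using mult_left_mono[OF abs_bump_le_indicator[of n a b]] by (auto simp: abs_mult mult.commute)
  qed (use d_loc in \<open>auto simp: locally_integrable_def\<close>)
  moreover have "(LINT x|lborel. d x * bump n a b x) = 0" for n
    using zero bump_test_fun by blast
  ultimately show ?thesis by (simp add: LIMSEQ_const_iff)
qed

lemma du_Bois_Reymond:
  assumes d_loc: "locally_integrable d"
    and "\<And>\<phi>. test_fun \<phi> \<Longrightarrow> (LINT x|lborel. d x * \<phi> x) = 0"
  shows "AE x in lborel. d x = 0"
proof -
  have "AE x in lborel. indicator {-real n<..<real n} x * d x = 0" for n :: nat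
  proof (rule AE_zero_if_integral_greaterThan_zero)
    fix a
    have "(\<lambda>x. indicator {a<..} x * (indicator {-real n<..<real n} x * d x))
        = (\<lambda>x. indicator {max a (-real n)<..<real n} x * d x)"
      by (auto simp: indicator_def)
    then show "(LINT x|lborel. indicator {a<..} x * (indicator {-real n<..<real n} x * d x)) = 0"
      using integral_interval_zero_if_orthogonal_to_test_funs[OF assms] by simp
  qed (use d_loc in \<open>auto simp: locally_integrable_def\<close>)
  then have "AE x in lborel. \<forall>n::nat. indicator {-real n<..<real n} x * d x = 0"
    by (rule AE_all_countable[THEN iffD2, rule_format])
  then show ?thesis
  proof eventually_elim
    case (elim x)
    obtain n :: nat where "\<bar>x\<bar> < real n" using reals_Archimedean2 by blast
    then show ?case using elim[rule_format, of n] by (auto simp: indicator_def split: if_splits)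
  qed
qed

lemma L2fun_imp_locally_integrable:
  assumes "L2fun u"
  shows "locally_integrable u"
  unfolding locally_integrable_def
proof (intro conjI allI)
  show [measurable]: "u \<in> borel_measurable borel" using assms by (simp add: L2fun_def)
  fix a b
  show "integrable lborel (\<lambda>x. indicator {a<..<b} x * u x)"
  proof (rule Bochner_Integration.integrable_bound)
    have "integrable lborel (\<lambda>x. indicator {a<..<b} x :: real)" by (cases "a \<le> b") auto
    then show "integrable lborel (\<lambda>x. indicator {a<..<b} x + (u x)^2)"
      using assms by (auto simp: L2fun_def)
    have "\<bar>y\<bar> \<le> 1 + y^2" for y :: real
      using zero_le_power2[of "\<bar>y\<bar> - 1"] zero_le_power2[of y]
      by (simp add: power2_eq_square algebra_simps)
    then show "AE x in lborel. norm (indicator {a<..<b} x * u x) \<le> norm (indicator {a<..<b} x + (u x)^2)"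
      by (auto simp: indicator_def)
  qed measurable
qed

lemma continuous_imp_locally_integrable:
  assumes "continuous_on UNIV u"
  shows "locally_integrable u"
  unfolding locally_integrable_def
proof (intro conjI allI)
  show [measurable]: "u \<in> borel_measurable borel" by (rule borel_measurable_continuous_onI[OF assms])
  fix a b
  show "integrable lborel (\<lambda>x. indicator {a<..<b} x * u x)"
  proof (rule Bochner_Integration.integrable_bound)
    show "integrable lborel (\<lambda>x. indicator {a..b} x *\<^sub>R u x)"
      using continuous_on_subset[OF assms] by (intro borel_integrable_compact) auto
  qed (auto simp: indicator_def)
qed

lemma L2fun_lincomb:
  assumes "L2fun u" "L2fun v"
  shows "L2fun (\<lambda>x. u x + k * v x)"
proof -
  have [measurable]: "u \<in> borel_measurable borel" "v \<in> borel_measurable borel"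
    using assms by (auto simp: L2fun_def)
  have "integrable lborel (\<lambda>x. (u x + k * v x)^2)"
  proof (rule Bochner_Integration.integrable_bound)
    show "integrable lborel (\<lambda>x. 2 * ((u x)^2 + k^2 * (v x)^2))"
      using assms by (auto simp: L2fun_def)
    have "(a + k * b)^2 \<le> 2 * (a^2 + k^2 * b^2)" for a b :: real
      using zero_le_power2[of "a - k * b"] by (simp add: power2_eq_square algebra_simps)
    then show "AE x in lborel. norm ((u x + k * v x)^2) \<le> norm (2 * ((u x)^2 + k^2 * (v x)^2))"
      by auto
  qed auto
  then show ?thesis by (simp add: L2fun_def)
qed

lemma is_weak_deriv_unique:
  assumes "is_weak_deriv i u g" "is_weak_deriv i u g'"
    and "locally_integrable g" "locally_integrable g'"
  shows "AE x in lborel. g x = g' x"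
proof -
  have "AE x in lborel. g x - g' x = 0"
  proof (rule du_Bois_Reymond[OF locally_integrable_diff[OF assms(3,4)]])
    fix \<phi> assume \<phi>_test: "test_fun \<phi>"
    have "integrable lborel (\<lambda>x. g x * \<phi> x)" "integrable lborel (\<lambda>x. g' x * \<phi> x)"
      and "(LINT x|lborel. u x * (deriv ^^ i) \<phi> x) = (-1)^i * (LINT x|lborel. g x * \<phi> x)"
      and "(LINT x|lborel. u x * (deriv ^^ i) \<phi> x) = (-1)^i * (LINT x|lborel. g' x * \<phi> x)"
      using assms(1,2) \<phi>_test unfolding is_weak_deriv_def by blast+
    then show "(LINT x|lborel. (g x - g' x) * \<phi> x) = 0"
      by (simp add: left_diff_distrib)
  qed
  then show ?thesis by simp
qed

definition L2_weak_deriv :: "nat \<Rightarrow> (real \<Rightarrow> real) \<Rightarrow> (real \<Rightarrow> real) \<Rightarrow> bool" where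
  "L2_weak_deriv i u g \<longleftrightarrow> L2fun g \<and> is_weak_deriv i u g"

lemma integral_weak_deriv_sq:
  assumes "L2_weak_deriv i u g"
  shows "(LINT x|lborel. (weak_deriv i u x)^2) = (LINT x|lborel. (g x)^2)"
proof -
  have wd: "L2_weak_deriv i u (weak_deriv i u)"
    using assms unfolding weak_deriv_def L2_weak_deriv_def
    by (rule someI[of "\<lambda>g. L2fun g \<and> is_weak_deriv i u g"])
  have [measurable]: "g \<in> borel_measurable borel" "weak_deriv i u \<in> borel_measurable borel"
    using assms wd by (auto simp: L2_weak_deriv_def L2fun_def)
  have "AE x in lborel. weak_deriv i u x = g x"
    by (rule is_weak_deriv_unique[of i u])
      (use wd assms L2fun_imp_locally_integrable in \<open>auto simp: L2_weak_deriv_def\<close>)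
  then show ?thesis
    by (intro integral_cong_AE) auto
qed

lemma H_norm_sq_eq:
  assumes "\<And>i. i \<le> n \<Longrightarrow> L2_weak_deriv i u (g i)"
  shows "H_norm_sq n u = (\<Sum>i\<le>n. LINT x|lborel. (g i x)^2)"
  unfolding H_norm_sq_def by (intro sum.cong integral_weak_deriv_sq) (use assms in auto)

lemma in_H_continuous_deriv_L2fun:
  assumes "in_H k u" "i \<le> k" "is_weak_deriv i u u'" "continuous_on UNIV u'"
  shows "L2fun u'"
proof -
  obtain g where g_weak_deriv: "L2fun g" "is_weak_deriv i u g"
    using assms(1,2) unfolding in_H_def by blast
  have [measurable]: "u' \<in> borel_measurable borel" "g \<in> borel_measurable borel"
    using assms(4) g_weak_deriv(1) by (auto simp: L2fun_def intro: borel_measurable_continuous_onI)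
  have "AE x in lborel. g x = u' x"
    by (rule is_weak_deriv_unique[OF g_weak_deriv(2) assms(3) L2fun_imp_locally_integrable[OF g_weak_deriv(1)]
          continuous_imp_locally_integrable[OF assms(4)]])
  then have "integrable lborel (\<lambda>x. (g x)^2) \<longleftrightarrow> integrable lborel (\<lambda>x. (u' x)^2)"
    by (intro integrable_cong_AE) auto
  then show ?thesis using g_weak_deriv(1) by (simp add: L2fun_def)
qed

lemma test_fun_deriv:
  assumes "test_fun \<phi>"
  shows "test_fun (deriv \<phi>)"
proof -
  from assms obtain R where \<phi>_vanishes: "\<And>x. R < \<bar>x\<bar> \<Longrightarrow> \<phi> x = 0"
    and deriv_\<phi>: "\<And>n x. ((deriv ^^ n) \<phi> has_real_derivative (deriv ^^ Suc n) \<phi> x) (at x)"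
    unfolding test_fun_def by blast
  have "((deriv ^^ n) (deriv \<phi>) has_real_derivative (deriv ^^ Suc n) (deriv \<phi>) x) (at x)" for n x
    using deriv_\<phi>[of "Suc n" x] by (simp add: funpow_swap1)
  moreover have "deriv \<phi> x = 0" if "R < \<bar>x\<bar>" for x
  proof -
    have "open {x. R < \<bar>x\<bar>}" by (intro open_Collect_less continuous_intros)
    then have "(\<phi> has_real_derivative 0) (at x)"
      by (rule has_field_derivative_transform_within_open[OF DERIV_const]) (use that \<phi>_vanishes in simp_all)
    then show ?thesis by (rule DERIV_imp_deriv)
  qed
  ultimately show ?thesis unfolding test_fun_def by blast
qed

lemma test_fun_higher_deriv: "test_fun \<phi> \<Longrightarrow> test_fun ((deriv ^^ n) \<phi>)"
  by (induction n) (auto intro: test_fun_deriv)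

lemma test_fun_bounded:
  assumes "test_fun \<phi>"
  obtains M where "\<And>x. \<bar>\<phi> x\<bar> \<le> M"
proof -
  from assms obtain R where \<phi>_vanishes: "\<And>x. R < \<bar>x\<bar> \<Longrightarrow> \<phi> x = 0"
    unfolding test_fun_def by blast
  have "compact (\<phi> ` {-\<bar>R\<bar>..\<bar>R\<bar>})"
    using continuous_on_subset[OF test_fun_continuous[OF assms]]
    by (intro compact_continuous_image) auto
  then obtain M where \<phi>_le: "\<And>x. x \<in> {-\<bar>R\<bar>..\<bar>R\<bar>} \<Longrightarrow> \<bar>\<phi> x\<bar> \<le> M"
    by (metis compact_imp_bounded bounded_iff imageI real_norm_def)
  have "\<bar>\<phi> x\<bar> \<le> \<bar>M\<bar>" for x
  proof (cases "R < \<bar>x\<bar>")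
    case False
    then have "x \<in> {-\<bar>R\<bar>..\<bar>R\<bar>}" by auto
    then show ?thesis using \<phi>_le by fastforce
  qed (simp add: \<phi>_vanishes)
  then show ?thesis by (rule that)
qed

lemma test_fun_mult_integrable:
  assumes "test_fun \<phi>" "continuous_on UNIV u"
  shows "integrable lborel (\<lambda>x. u x * \<phi> x)"
proof -
  from assms obtain R where \<phi>_vanishes: "\<And>x. R < \<bar>x\<bar> \<Longrightarrow> \<phi> x = 0"
    unfolding test_fun_def by blast
  have "integrable lborel (\<lambda>x. indicator {-\<bar>R\<bar>..\<bar>R\<bar>} x *\<^sub>R (u x * \<phi> x))"
    using continuous_on_subset[OF test_fun_continuous[OF assms(1)]] continuous_on_subset[OF assms(2)]
    by (intro borel_integrable_compact continuous_intros) auto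
  moreover have "(\<lambda>x. indicator {-\<bar>R\<bar>..\<bar>R\<bar>} x *\<^sub>R (u x * \<phi> x)) = (\<lambda>x. u x * \<phi> x)"
  proof
    show "indicator {-\<bar>R\<bar>..\<bar>R\<bar>} x *\<^sub>R (u x * \<phi> x) = u x * \<phi> x" for x
      by (cases "R < \<bar>x\<bar>") (use \<phi>_vanishes[of x] in \<open>auto simp: indicator_def\<close>)
  qed
  ultimately show ?thesis by simp
qed

lemma integral_by_parts_test_fun:
  assumes \<phi>_test: "test_fun \<phi>" and u_C1: "\<And>x. (u has_real_derivative u' x) (at x)" "continuous_on UNIV u'"
  shows "(LINT x|lborel. u x * deriv \<phi> x) = - (LINT x|lborel. u' x * \<phi> x)"
proof -
  from \<phi>_test obtain R where \<phi>_vanishes: "\<And>x. R < \<bar>x\<bar> \<Longrightarrow> \<phi> x = 0"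
    unfolding test_fun_def by blast
  from test_fun_deriv[OF \<phi>_test] obtain R' where deriv_\<phi>_vanishes: "\<And>x. R' < \<bar>x\<bar> \<Longrightarrow> deriv \<phi> x = 0"
    unfolding test_fun_def by blast
  define r where "r = \<bar>R\<bar> + \<bar>R'\<bar> + 1"
  have u_cont: "continuous_on UNIV u"
    using u_C1(1) DERIV_isCont by (blast intro: continuous_at_imp_continuous_on)
  let ?g = "\<lambda>x. u x * deriv \<phi> x + u' x * \<phi> x"
  have g_cont: "continuous_on UNIV ?g"
    by (intro continuous_intros u_cont u_C1(2) test_fun_continuous \<phi>_test test_fun_deriv)
  have "(LINT x|lborel. ?g x * indicator {-r..r} x) = u r * \<phi> r - u (-r) * \<phi> (-r)"
  proof (rule integral_FTC_Icc_real)
    show "((\<lambda>x. u x * \<phi> x) has_real_derivative ?g x) (at x)" for x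
      using DERIV_mult[OF u_C1(1) test_fun_has_derivative[OF \<phi>_test], of x] by (simp add: algebra_simps)
    show "isCont ?g x" for x using g_cont by (simp add: continuous_on_eq_continuous_at)
  qed (simp add: r_def)
  also have "(\<lambda>x. ?g x * indicator {-r..r} x) = ?g"
  proof
    show "?g x * indicator {-r..r} x = ?g x" for x
      using \<phi>_vanishes[of x] deriv_\<phi>_vanishes[of x] by (cases "x \<in> {-r..r}") (auto simp: r_def)
  qed
  finally have "(LINT x|lborel. ?g x) = 0"
    using \<phi>_vanishes by (simp add: r_def)
  moreover have "(LINT x|lborel. ?g x) = (LINT x|lborel. u x * deriv \<phi> x) + (LINT x|lborel. u' x * \<phi> x)"
    by (intro Bochner_Integration.integral_add test_fun_mult_integrable test_fun_deriv \<phi>_test u_cont u_C1(2))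
  ultimately show ?thesis by simp
qed

lemma is_weak_deriv_0: "continuous_on UNIV u \<Longrightarrow> is_weak_deriv 0 u u"
  unfolding is_weak_deriv_def by (auto intro: test_fun_mult_integrable)

lemma is_weak_deriv_Suc:
  assumes "is_weak_deriv n u g" "\<And>x. (g has_real_derivative g' x) (at x)" "continuous_on UNIV g'"
  shows "is_weak_deriv (Suc n) u g'"
  unfolding is_weak_deriv_def
proof (intro allI impI)
  fix \<phi> assume \<phi>_test: "test_fun \<phi>"
  have "integrable lborel (\<lambda>x. u x * (deriv ^^ n) (deriv \<phi>) x)"
    "(LINT x|lborel. u x * (deriv ^^ n) (deriv \<phi>) x) = (-1)^n * (LINT x|lborel. g x * deriv \<phi> x)"
    using assms(1) test_fun_deriv[OF \<phi>_test] unfolding is_weak_deriv_def by blast+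
  moreover have "(deriv ^^ n) (deriv \<phi>) = (deriv ^^ Suc n) \<phi>" by (simp add: funpow_swap1)
  ultimately show "integrable lborel (\<lambda>x. u x * (deriv ^^ Suc n) \<phi> x) \<and>
      integrable lborel (\<lambda>x. g' x * \<phi> x) \<and>
      (LINT x|lborel. u x * (deriv ^^ Suc n) \<phi> x) = (-1) ^ Suc n * (LINT x|lborel. g' x * \<phi> x)"
    using integral_by_parts_test_fun[OF \<phi>_test assms(2,3)] test_fun_mult_integrable[OF \<phi>_test assms(3)]
    by simp
qed

lemma is_weak_deriv_lincomb:
  assumes "is_weak_deriv n u g" "is_weak_deriv n v h"
  shows "is_weak_deriv n (\<lambda>x. u x + k * v x) (\<lambda>x. g x + k * h x)"
  using assms unfolding is_weak_deriv_def
  by (auto simp: distrib_right mult.assoc distrib_left)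

lemma L2_weak_deriv_lincomb:
  assumes "L2_weak_deriv n u g" "L2_weak_deriv n v h"
  shows "L2_weak_deriv n (\<lambda>x. u x + k * v x) (\<lambda>x. g x + k * h x)"
  using assms by (simp add: L2_weak_deriv_def L2fun_lincomb is_weak_deriv_lincomb)

section \<open>Families of exponentially decaying functions\<close>

lemma integrable_exp_minus_abs:
  assumes "0 < a"
  shows "integrable lborel (\<lambda>x::real. exp (- a * \<bar>x\<bar>))"
proof -
  have "set_integrable lebesgue {0..} (\<lambda>x::real. exp (- a * x))"
    using nonnegative_absolutely_integrable_1[OF integrable_on_exp_minus_to_infinity[OF assms, of 0]]
    by simp
  then have right: "integrable lborel (\<lambda>x. indicator {0..} x * exp (- a * x))"
    unfolding set_integrable_def by (simp add: integrable_completion)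
  have "integrable lborel (\<lambda>x. indicator {0..} (0 + (-1) * x) * exp (- a * (0 + (-1) * x)))"
    by (rule lborel_integrable_real_affine[OF right]) simp
  then have "integrable lborel
      (\<lambda>x. indicator {0..} x * exp (- a * x) + indicator {0..} (- x) * exp (- a * (- x)))"
    using right by (intro Bochner_Integration.integrable_add) auto
  then show ?thesis
    by (rule Bochner_Integration.integrable_bound) (auto simp: indicator_def abs_if)
qed

lemma integrable_exp_dominated:
  fixes u :: "real \<Rightarrow> real"
  assumes u_measurable: "u \<in> borel_measurable borel" and a_pos: "0 < a"
    and bound: "\<And>x. \<bar>u x\<bar> \<le> K * exp (- a * \<bar>x\<bar>)"
  shows "integrable lborel u"
proof (rule Bochner_Integration.integrable_bound)
  show "integrable lborel (\<lambda>x. K * exp (- a * \<bar>x\<bar>))"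
    using integrable_exp_minus_abs[OF a_pos] by simp
  have "\<bar>u x\<bar> \<le> \<bar>K * exp (- a * \<bar>x\<bar>)\<bar>" for x
    using bound[of x] by linarith
  then show "AE x in lborel. norm (u x) \<le> norm (K * exp (- a * \<bar>x\<bar>))" by simp
qed (use u_measurable in simp)

lemma power2_le_exp:
  fixes y :: real
  assumes "\<bar>y\<bar> \<le> K * exp (- a * z)"
  shows "y^2 \<le> K^2 * exp (- (2 * a) * z)"
  using power_mono[OF assms, of 2]
  by (simp add: power_mult_distrib exp_double[symmetric] mult.assoc)

lemma dominated_convergence_at:
  fixes F :: "'a::first_countable_topology \<Rightarrow> 'b \<Rightarrow> real"
  assumes pointwise: "\<And>x. ((\<lambda>h. F h x) \<longlongrightarrow> G x) (at c)"
    and dominated: "\<forall>\<^sub>F h in at c. F h \<in> borel_measurable M \<and> (\<forall>x. \<bar>F h x\<bar> \<le> W x)"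
    and W_integrable: "integrable M W" and G_measurable: "G \<in> borel_measurable M"
  shows "((\<lambda>h. LINT x|M. F h x) \<longlongrightarrow> (LINT x|M. G x)) (at c)"
  unfolding tendsto_at_iff_sequentially
proof (intro allI impI)
  fix X :: "nat \<Rightarrow> 'a" assume "\<forall>i. X i \<in> UNIV - {c}" "X \<longlonglongrightarrow> c"
  then have X_at: "filterlim X (at c) sequentially" by (auto simp: filterlim_at)
  obtain N where dominated_tail: "\<And>i. i \<ge> N \<Longrightarrow> F (X i) \<in> borel_measurable M \<and> (\<forall>x. \<bar>F (X i) x\<bar> \<le> W x)"
    using filterlim_iff[THEN iffD1, OF X_at, rule_format, OF dominated] by (auto simp: eventually_sequentially)
  have "(\<lambda>i. LINT x|M. F (X (i + N)) x) \<longlonglongrightarrow> (LINT x|M. G x)"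
  proof (rule integral_dominated_convergence[OF _ _ W_integrable])
    show "AE x in M. (\<lambda>i. F (X (i + N)) x) \<longlonglongrightarrow> G x"
      by (intro AE_I2 LIMSEQ_ignore_initial_segment[of "\<lambda>i. F (X i) _"] filterlim_compose[OF pointwise X_at])
  qed (use dominated_tail G_measurable in auto)
  then show "((\<lambda>h. LINT x|M. F h x) \<circ> X) \<longlonglongrightarrow> (LINT x|M. G x)"
    unfolding comp_def by (rule LIMSEQ_offset)
qed

lemma integral_sq_tendsto_0:
  fixes F :: "'a::first_countable_topology \<Rightarrow> real \<Rightarrow> real"
  assumes a_pos: "0 < a" and pointwise: "\<And>x. ((\<lambda>h. F h x) \<longlongrightarrow> 0) (at c)"
    and dominated: "\<forall>\<^sub>F h in at c. F h \<in> borel_measurable borel \<and> (\<forall>x. \<bar>F h x\<bar> \<le> K * exp (- a * \<bar>x\<bar>))"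
  shows "((\<lambda>h. LINT x|lborel. (F h x)^2) \<longlongrightarrow> 0) (at c)"
proof -
  have "((\<lambda>h. LINT x|lborel. (F h x)^2) \<longlongrightarrow> (LINT x::real|lborel. 0)) (at c)"
  proof (rule dominated_convergence_at)
    show "((\<lambda>h. (F h x)^2) \<longlongrightarrow> 0) (at c)" for x
      using tendsto_power[OF pointwise[of x], of 2] by simp
    show "integrable lborel (\<lambda>x. K^2 * exp (- (2 * a) * \<bar>x\<bar>))"
      using integrable_exp_minus_abs[of "2 * a"] a_pos by simp
    show "\<forall>\<^sub>F h in at c. (\<lambda>x. (F h x)^2) \<in> borel_measurable lborel \<and>
        (\<forall>x. \<bar>(F h x)^2\<bar> \<le> K^2 * exp (- (2 * a) * \<bar>x\<bar>))"
      using dominated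
    proof eventually_elim
      case (elim h)
      have [measurable]: "F h \<in> borel_measurable borel" using elim by blast
      have "(\<lambda>x. (F h x)^2) \<in> borel_measurable lborel" by measurable
      then show ?case using elim power2_le_exp[of "F h _" K a] by simp
    qed
  qed simp
  then show ?thesis by simp
qed

definition exp_decaying :: "real set \<Rightarrow> (real \<Rightarrow> real \<Rightarrow> real) \<Rightarrow> bool" where
  "exp_decaying I u \<longleftrightarrow> open I \<and> (\<forall>c\<in>I. continuous_on UNIV (u c)) \<and>
     (\<forall>c\<in>I. \<exists>a>0. \<exists>K. \<forall>\<^sub>F c' in nhds c. \<forall>x. \<bar>u c' x\<bar> \<le> K * exp (- a * \<bar>x\<bar>))"

lemma exp_decaying_continuous: "exp_decaying I u \<Longrightarrow> c \<in> I \<Longrightarrow> continuous_on UNIV (u c)"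
  by (simp add: exp_decaying_def)

lemma exp_decaying_measurable: "exp_decaying I u \<Longrightarrow> c \<in> I \<Longrightarrow> u c \<in> borel_measurable borel"
  by (intro borel_measurable_continuous_onI exp_decaying_continuous)

lemma exp_decayingE:
  assumes "exp_decaying I u" "c \<in> I"
  obtains a K where "0 < a" "\<forall>\<^sub>F c' in nhds c. c' \<in> I \<and> (\<forall>x. \<bar>u c' x\<bar> \<le> K * exp (- a * \<bar>x\<bar>))"
    "\<And>x. \<bar>u c x\<bar> \<le> K * exp (- a * \<bar>x\<bar>)"
proof -
  have "open I" using assms(1) by (simp add: exp_decaying_def)
  then have "\<forall>\<^sub>F c' in nhds c. c' \<in> I"
    using assms(2) by (rule eventually_nhds_in_open)
  moreover obtain a K where "0 < a" "\<forall>\<^sub>F c' in nhds c. \<forall>x. \<bar>u c' x\<bar> \<le> K * exp (- a * \<bar>x\<bar>)"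
    using assms by (auto simp: exp_decaying_def)
  ultimately show ?thesis
    by (intro that[of a K] eventually_conj)
      (auto dest: eventually_nhds_x_imp_x simp del: mult_minus_left)
qed

lemma exp_decaying_integrable:
  assumes "exp_decaying I u" "c \<in> I"
  shows "integrable lborel (u c)"
proof -
  obtain a K where "0 < a" "\<And>x. \<bar>u c x\<bar> \<le> K * exp (- a * \<bar>x\<bar>)"
    using exp_decayingE[OF assms] by blast
  with exp_decaying_measurable[OF assms] show ?thesis by (rule integrable_exp_dominated)
qed

lemma exp_decaying_L2fun:
  assumes "exp_decaying I u" "c \<in> I"
  shows "L2fun (u c)"
proof -
  have [measurable]: "u c \<in> borel_measurable borel" by (rule exp_decaying_measurable[OF assms])
  obtain a K where a_pos: "0 < a" and "\<And>x. \<bar>u c x\<bar> \<le> K * exp (- a * \<bar>x\<bar>)"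
    using exp_decayingE[OF assms] by blast
  from power2_le_exp[OF this(2)] have "\<bar>(u c x)^2\<bar> \<le> K^2 * exp (- (2 * a) * \<bar>x\<bar>)" for x by simp
  then have "integrable lborel (\<lambda>x. (u c x)^2)"
    by (intro integrable_exp_dominated[of _ "2 * a" "K^2"]) (use a_pos in simp_all)
  then show ?thesis by (simp add: L2fun_def)
qed

definition C1_exp_decaying :: "real set \<Rightarrow> (real \<Rightarrow> real \<Rightarrow> real) \<Rightarrow> (real \<Rightarrow> real \<Rightarrow> real) \<Rightarrow> bool" where
  "C1_exp_decaying I u u' \<longleftrightarrow> exp_decaying I u \<and> exp_decaying I u' \<and>
     (\<forall>c\<in>I. \<forall>x. ((\<lambda>c. u c x) has_real_derivative u' c x) (at c))"

lemma C1_exp_decaying_has_derivative: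
  "C1_exp_decaying I u u' \<Longrightarrow> c \<in> I \<Longrightarrow> ((\<lambda>c. u c x) has_real_derivative u' c x) (at c)"
  by (simp add: C1_exp_decaying_def)

lemma eventually_nhds_imp_at_0:
  fixes c :: real
  assumes "\<forall>\<^sub>F c' in nhds c. P c'"
  shows "\<forall>\<^sub>F h in at 0. P (c + h)"
proof -
  have "((\<lambda>h. c + h) \<longlongrightarrow> c) (at 0)" by (auto intro!: tendsto_eq_intros)
  then show ?thesis by (rule eventually_compose_filterlim[OF assms])
qed

lemma C1_exp_decaying_difference_quotient:
  assumes u_C1: "C1_exp_decaying I u u'" and c_mem: "c \<in> I"
  obtains a K where "0 < a" "\<And>x. \<bar>u' c x\<bar> \<le> K * exp (- a * \<bar>x\<bar>)"
    "\<forall>\<^sub>F h in at 0. c + h \<in> I \<and> (\<forall>x. \<bar>(u (c + h) x - u c x) / h\<bar> \<le> K * exp (- a * \<bar>x\<bar>))"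
proof -
  have dec: "exp_decaying I u'" using u_C1 by (simp add: C1_exp_decaying_def)
  obtain a K where a_pos: "0 < a"
    and "\<forall>\<^sub>F c' in nhds c. c' \<in> I \<and> (\<forall>x. \<bar>u' c' x\<bar> \<le> K * exp (- a * \<bar>x\<bar>))"
    using exp_decayingE[OF dec c_mem] by blast
  then obtain r where near_c: "0 < r" "\<And>c'. dist c' c < r \<Longrightarrow> c' \<in> I"
    "\<And>c' x. dist c' c < r \<Longrightarrow> \<bar>u' c' x\<bar> \<le> K * exp (- a * \<bar>x\<bar>)"
    unfolding eventually_nhds_metric by blast
  have quotient: "\<bar>(u (c + h) x - u c x) / h\<bar> \<le> K * exp (- a * \<bar>x\<bar>)" if h_small: "h \<noteq> 0" "\<bar>h\<bar> < r" for h x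
  proof -
    have "norm (u (c + h) x - u c x) \<le> K * exp (- a * \<bar>x\<bar>) * norm (c + h - c)"
    proof (rule field_differentiable_bound)
      show "convex (ball c r)" by simp
      fix z assume "z \<in> ball c r"
      then have z_near_c: "dist z c < r" by (simp add: dist_commute)
      show "((\<lambda>c. u c x) has_real_derivative u' z x) (at z within ball c r)"
        using C1_exp_decaying_has_derivative[OF u_C1 near_c(2)[OF z_near_c]]
        by (rule has_field_derivative_at_within)
      show "norm (u' z x) \<le> K * exp (- a * \<bar>x\<bar>)" using near_c(3)[OF z_near_c] by simp
    qed (use h_small near_c in \<open>auto simp: dist_real_def\<close>)
    then show ?thesis using h_small by (simp add: abs_divide divide_le_eq)
  qed
  have "\<forall>\<^sub>F h in at 0. h \<noteq> 0 \<and> \<bar>h\<bar> < r"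
    using near_c(1) unfolding eventually_at by (auto simp: dist_real_def)
  then have "\<forall>\<^sub>F h in at 0. c + h \<in> I \<and> (\<forall>x. \<bar>(u (c + h) x - u c x) / h\<bar> \<le> K * exp (- a * \<bar>x\<bar>))"
  proof eventually_elim
    case (elim h)
    then show ?case
      using quotient[of h] near_c(2)[of "c + h"] by (simp add: dist_real_def)
  qed
  with a_pos near_c(1) near_c(3)[of c] show ?thesis by (intro that[of a K]) simp_all
qed

lemma C1_exp_decaying_difference_quotient_tendsto:
  assumes "C1_exp_decaying I u u'" "c \<in> I"
  shows "((\<lambda>h. (u (c + h) x - u c x) / h) \<longlongrightarrow> u' c x) (at 0)"
  using C1_exp_decaying_has_derivative[OF assms] unfolding DERIV_def by blast

lemma exp_decaying_mult_bounded_integrable: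
  assumes "exp_decaying I u" "c \<in> I" and [measurable]: "\<psi> \<in> borel_measurable borel" and \<psi>_le: "\<And>x. \<bar>\<psi> x\<bar> \<le> M"
  shows "integrable lborel (\<lambda>x. u c x * \<psi> x)"
proof (rule Bochner_Integration.integrable_bound)
  have [measurable]: "u c \<in> borel_measurable borel" by (rule exp_decaying_measurable[OF assms(1,2)])
  show "(\<lambda>x. u c x * \<psi> x) \<in> borel_measurable lborel" by measurable
  show "integrable lborel (\<lambda>x. u c x * M)" using exp_decaying_integrable[OF assms(1,2)] by simp
  show "AE x in lborel. norm (u c x * \<psi> x) \<le> norm (u c x * M)"
    using \<psi>_le by (auto simp: abs_mult intro!: mult_left_mono order_trans[OF \<psi>_le abs_ge_self])
qed

lemma C1_exp_decaying_integral_difference_quotient_tendsto: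
  assumes u_C1: "C1_exp_decaying I u u'" and c_mem: "c \<in> I"
    and [measurable]: "\<psi> \<in> borel_measurable borel" and \<psi>_le: "\<And>x. \<bar>\<psi> x\<bar> \<le> M"
  shows "((\<lambda>h. LINT x|lborel. (u (c + h) x - u c x) / h * \<psi> x) \<longlongrightarrow> (LINT x|lborel. u' c x * \<psi> x)) (at 0)"
proof -
  have dec: "exp_decaying I u" "exp_decaying I u'"
    using u_C1 by (auto simp: C1_exp_decaying_def)
  have [measurable]: "u' c \<in> borel_measurable borel" "u c \<in> borel_measurable borel"
    using dec c_mem by (auto intro: exp_decaying_measurable)
  obtain a K where a_pos: "0 < a" and
    quotient: "\<forall>\<^sub>F h in at 0. c + h \<in> I \<and> (\<forall>x. \<bar>(u (c + h) x - u c x) / h\<bar> \<le> K * exp (- a * \<bar>x\<bar>))"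
    using C1_exp_decaying_difference_quotient[OF u_C1 c_mem] by blast
  show ?thesis
  proof (rule dominated_convergence_at)
    show "((\<lambda>h. (u (c + h) x - u c x) / h * \<psi> x) \<longlongrightarrow> u' c x * \<psi> x) (at 0)" for x
      by (intro tendsto_intros C1_exp_decaying_difference_quotient_tendsto[OF u_C1 c_mem])
    show "integrable lborel (\<lambda>x. K * exp (- a * \<bar>x\<bar>) * M)"
      using integrable_exp_minus_abs[OF a_pos] by simp
    show "\<forall>\<^sub>F h in at 0. (\<lambda>x. (u (c + h) x - u c x) / h * \<psi> x) \<in> borel_measurable lborel \<and>
        (\<forall>x. \<bar>(u (c + h) x - u c x) / h * \<psi> x\<bar> \<le> K * exp (- a * \<bar>x\<bar>) * M)"
      using quotient
    proof eventually_elim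
      case (elim h)
      have [measurable]: "u (c + h) \<in> borel_measurable borel"
        using elim exp_decaying_measurable[OF dec(1)] by blast
      have "(\<lambda>x. (u (c + h) x - u c x) / h * \<psi> x) \<in> borel_measurable lborel" by measurable
      moreover have "\<bar>(u (c + h) x - u c x) / h * \<psi> x\<bar> \<le> K * exp (- a * \<bar>x\<bar>) * M" for x
      proof -
        have "\<bar>(u (c + h) x - u c x) / h\<bar> \<le> K * exp (- a * \<bar>x\<bar>)" using elim by blast
        from this order_trans[OF abs_ge_zero this] show ?thesis
          unfolding abs_mult by (intro mult_mono \<psi>_le) auto
      qed
      ultimately show ?case by blast
    qed
  qed measurable
qed

lemma C1_exp_decaying_integral_has_derivative:
  assumes u_C1: "C1_exp_decaying I u u'" and c_mem: "c \<in> I"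
    and \<psi>_bounded: "\<psi> \<in> borel_measurable borel" "\<And>x. \<bar>\<psi> x\<bar> \<le> M"
  shows "((\<lambda>c. LINT x|lborel. u c x * \<psi> x) has_real_derivative (LINT x|lborel. u' c x * \<psi> x)) (at c)"
proof -
  have dec: "exp_decaying I u" "open I"
    using u_C1 by (auto simp: C1_exp_decaying_def exp_decaying_def)
  have "\<forall>\<^sub>F h in at 0. c + h \<in> I"
    by (rule eventually_nhds_imp_at_0[OF eventually_nhds_in_open[OF dec(2) c_mem]])
  then have "\<forall>\<^sub>F h in at 0. (LINT x|lborel. (u (c + h) x - u c x) / h * \<psi> x)
      = ((LINT x|lborel. u (c + h) x * \<psi> x) - (LINT x|lborel. u c x * \<psi> x)) / h"
  proof eventually_elim
    case (elim h)
    have "integrable lborel (\<lambda>x. u (c + h) x * \<psi> x)" "integrable lborel (\<lambda>x. u c x * \<psi> x)"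
      using elim c_mem by (auto intro: exp_decaying_mult_bounded_integrable[OF dec(1) _ \<psi>_bounded])
    then show ?case by (simp add: left_diff_distrib diff_divide_distrib)
  qed
  with C1_exp_decaying_integral_difference_quotient_tendsto[OF assms] show ?thesis
    unfolding DERIV_def by (rule Lim_transform_eventually)
qed

lemma is_weak_deriv_parameter_derivative:
  assumes u_C1: "C1_exp_decaying I u u'" and g_C1: "C1_exp_decaying I g g'"
    and wd: "\<And>c. c \<in> I \<Longrightarrow> is_weak_deriv n (u c) (g c)" and c_mem: "c \<in> I"
  shows "is_weak_deriv n (u' c) (g' c)"
  unfolding is_weak_deriv_def
proof (intro allI impI)
  fix \<phi> assume \<phi>_test: "test_fun \<phi>"
  let ?\<phi>n = "(deriv ^^ n) \<phi>"
  have \<phi>n: "test_fun ?\<phi>n" by (rule test_fun_higher_deriv[OF \<phi>_test])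
  have "open I" using u_C1 by (simp add: C1_exp_decaying_def exp_decaying_def)
  have pairing: "((\<lambda>c. LINT x|lborel. w c x * \<psi> x) has_real_derivative (LINT x|lborel. w' c x * \<psi> x)) (at c)"
    if w_C1: "C1_exp_decaying I w w'" and \<psi>_test: "test_fun \<psi>" for w w' \<psi>
  proof -
    obtain M where "\<And>x. \<bar>\<psi> x\<bar> \<le> M" using test_fun_bounded[OF \<psi>_test] by blast
    then show ?thesis
      by (intro C1_exp_decaying_integral_has_derivative[OF w_C1 c_mem]
          borel_measurable_continuous_onI[OF test_fun_continuous[OF \<psi>_test]])
  qed
  have "((\<lambda>c. LINT x|lborel. u c x * ?\<phi>n x) has_real_derivative (-1)^n * (LINT x|lborel. g' c x * \<phi> x)) (at c)"
    by (rule has_field_derivative_transform_within_open[OF DERIV_cmult[OF pairing[OF g_C1 \<phi>_test]] \<open>open I\<close> c_mem])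
      (use wd \<phi>_test in \<open>simp add: is_weak_deriv_def\<close>)
  then have "(LINT x|lborel. u' c x * ?\<phi>n x) = (-1)^n * (LINT x|lborel. g' c x * \<phi> x)"
    by (rule DERIV_unique[OF pairing[OF u_C1 \<phi>n]])
  moreover have "continuous_on UNIV (u' c)" "continuous_on UNIV (g' c)"
    using u_C1 g_C1 c_mem by (auto simp: C1_exp_decaying_def exp_decaying_def)
  ultimately show "integrable lborel (\<lambda>x. u' c x * ?\<phi>n x) \<and> integrable lborel (\<lambda>x. g' c x * \<phi> x) \<and>
      (LINT x|lborel. u' c x * ?\<phi>n x) = (-1)^n * (LINT x|lborel. g' c x * \<phi> x)"
    using test_fun_mult_integrable \<phi>_test \<phi>n by blast
qed

lemma integral_remainder_sq_tendsto_0: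
  assumes u_C1: "C1_exp_decaying I u u'" and c_mem: "c \<in> I"
  shows "((\<lambda>h. LINT x|lborel. ((u (c + h) x - u c x - h * u' c x) / h)^2) \<longlongrightarrow> 0) (at 0)"
proof -
  have dec: "exp_decaying I u" "exp_decaying I u'"
    using u_C1 by (auto simp: C1_exp_decaying_def)
  obtain a K where a_pos: "0 < a" and u'_bound: "\<And>x. \<bar>u' c x\<bar> \<le> K * exp (- a * \<bar>x\<bar>)" and
    quotient: "\<forall>\<^sub>F h in at 0. c + h \<in> I \<and> (\<forall>x. \<bar>(u (c + h) x - u c x) / h\<bar> \<le> K * exp (- a * \<bar>x\<bar>))"
    using C1_exp_decaying_difference_quotient[OF u_C1 c_mem] by blast
  have nonzero: "\<forall>\<^sub>F h in at (0::real). h \<noteq> 0" by (simp add: eventually_at_filter)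
  have rewrite: "(u (c + h) x - u c x - h * u' c x) / h = (u (c + h) x - u c x) / h - u' c x"
    if "h \<noteq> 0" for h x
    using that by (simp add: diff_divide_distrib)
  show ?thesis
  proof (rule integral_sq_tendsto_0[OF a_pos])
    fix x
    have "((\<lambda>h. (u (c + h) x - u c x) / h - u' c x) \<longlongrightarrow> u' c x - u' c x) (at 0)"
      by (intro tendsto_intros C1_exp_decaying_difference_quotient_tendsto[OF u_C1 c_mem])
    then have "((\<lambda>h. (u (c + h) x - u c x) / h - u' c x) \<longlongrightarrow> 0) (at 0)" by simp
    then show "((\<lambda>h. (u (c + h) x - u c x - h * u' c x) / h) \<longlongrightarrow> 0) (at 0)"
      by (rule Lim_transform_eventually) (use nonzero in \<open>auto elim: eventually_mono simp: rewrite\<close>)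
  next
    show "\<forall>\<^sub>F h in at 0. (\<lambda>x. (u (c + h) x - u c x - h * u' c x) / h) \<in> borel_measurable borel \<and>
        (\<forall>x. \<bar>(u (c + h) x - u c x - h * u' c x) / h\<bar> \<le> 2 * K * exp (- a * \<bar>x\<bar>))"
      using quotient nonzero
    proof eventually_elim
      case (elim h)
      have [measurable]: "u (c + h) \<in> borel_measurable borel" "u c \<in> borel_measurable borel"
        "u' c \<in> borel_measurable borel"
        using elim c_mem dec by (auto intro: exp_decaying_measurable)
      have "(\<lambda>x. (u (c + h) x - u c x - h * u' c x) / h) \<in> borel_measurable borel" by measurable
      moreover have "\<bar>(u (c + h) x - u c x) / h - u' c x\<bar> \<le> 2 * K * exp (- a * \<bar>x\<bar>)" for x
        using abs_triangle_ineq4[of "(u (c + h) x - u c x) / h" "u' c x"]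
          elim(1)[THEN conjunct2, rule_format, of x] u'_bound[of x] by linarith
      ultimately show ?case using elim(2) by (simp add: rewrite)
    qed
  qed
qed

lemma integral_difference_sq_tendsto_0:
  assumes u_decaying: "exp_decaying I u" and c_mem: "c \<in> I" and cont: "\<And>x. isCont (\<lambda>c. u c x) c"
  shows "((\<lambda>c'. LINT x|lborel. (u c' x - u c x)^2) \<longlongrightarrow> 0) (at c)"
proof -
  obtain a K where a_pos: "0 < a" and
    bound: "\<forall>\<^sub>F c' in nhds c. c' \<in> I \<and> (\<forall>x. \<bar>u c' x\<bar> \<le> K * exp (- a * \<bar>x\<bar>))"
    and bound_c: "\<And>x. \<bar>u c x\<bar> \<le> K * exp (- a * \<bar>x\<bar>)"
    using exp_decayingE[OF u_decaying c_mem] by blast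
  show ?thesis
  proof (rule integral_sq_tendsto_0[OF a_pos])
    show "((\<lambda>c'. u c' x - u c x) \<longlongrightarrow> 0) (at c)" for x
      using cont[of x] unfolding isCont_def by (rule LIM_zero)
    have "\<forall>\<^sub>F c' in at c. c' \<in> I \<and> (\<forall>x. \<bar>u c' x\<bar> \<le> K * exp (- a * \<bar>x\<bar>))"
      using bound by (auto simp: eventually_at_filter elim: eventually_mono)
    then show "\<forall>\<^sub>F c' in at c. (\<lambda>x. u c' x - u c x) \<in> borel_measurable borel \<and>
        (\<forall>x. \<bar>u c' x - u c x\<bar> \<le> 2 * K * exp (- a * \<bar>x\<bar>))"
    proof eventually_elim
      case (elim c')
      have [measurable]: "u c' \<in> borel_measurable borel" "u c \<in> borel_measurable borel"
        using elim c_mem u_decaying by (auto intro: exp_decaying_measurable)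
      have "(\<lambda>x. u c' x - u c x) \<in> borel_measurable borel" by measurable
      moreover have "\<bar>u c' x - u c x\<bar> \<le> 2 * K * exp (- a * \<bar>x\<bar>)" for x
        using abs_triangle_ineq4[of "u c' x" "u c x"] elim[THEN conjunct2, rule_format, of x]
          bound_c[of x] by linarith
      ultimately show ?case by blast
    qed
  qed
qed

text \<open>Only \<open>D 0 0\<close> is assumed to be classically differentiable in \<open>x\<close>: its derivatives in the
  parameter inherit their weak derivatives by differentiation under the integral against test functions.\<close>

locale Cp_exp_decaying_family =
  fixes I :: "real set" and p n :: nat and D :: "nat \<Rightarrow> nat \<Rightarrow> real \<Rightarrow> real \<Rightarrow> real"
  assumes decaying: "k \<le> n \<Longrightarrow> j \<le> p \<Longrightarrow> exp_decaying I (D k j)"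
    and deriv_c: "k \<le> n \<Longrightarrow> j < p \<Longrightarrow> c \<in> I \<Longrightarrow> ((\<lambda>c. D k j c x) has_real_derivative D k (Suc j) c x) (at c)"
    and deriv_x: "k < n \<Longrightarrow> c \<in> I \<Longrightarrow> (D k 0 c has_real_derivative D (Suc k) 0 c x) (at x)"
    and isCont_top: "k \<le> n \<Longrightarrow> c \<in> I \<Longrightarrow> isCont (\<lambda>c. D k p c x) c"
begin

lemma open_I: "open I"
  using decaying[of 0 0] by (simp add: exp_decaying_def)

lemma C1_exp_decaying: "k \<le> n \<Longrightarrow> j < p \<Longrightarrow> C1_exp_decaying I (D k j) (D k (Suc j))"
  by (auto simp: C1_exp_decaying_def decaying deriv_c)

lemma D_continuous: "k \<le> n \<Longrightarrow> j \<le> p \<Longrightarrow> c \<in> I \<Longrightarrow> continuous_on UNIV (D k j c)"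
  by (rule exp_decaying_continuous[OF decaying])

lemma L2_weak_deriv_D:
  assumes "k \<le> n" "j \<le> p" "c \<in> I"
  shows "L2_weak_deriv k (D 0 j c) (D k j c)"
proof -
  have "is_weak_deriv k (D 0 j c) (D k j c)"
    using assms(2,3)
  proof (induction j arbitrary: c)
    case 0
    then show ?case using assms(1)
    proof (induction k)
      case (Suc k)
      then show ?case
        by (intro is_weak_deriv_Suc[of k _ "D k 0 c"] D_continuous deriv_x) auto
    qed (simp add: is_weak_deriv_0 D_continuous)
  next
    case (Suc j)
    then show ?case
      using assms(1) by (intro is_weak_deriv_parameter_derivative[OF C1_exp_decaying C1_exp_decaying]) auto
  qed
  then show ?thesis
    using exp_decaying_L2fun[OF decaying] assms by (simp add: L2_weak_deriv_def)
qed

lemma in_H_D: "j \<le> p \<Longrightarrow> c \<in> I \<Longrightarrow> in_H n (D 0 j c)"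
  using D_continuous[of 0 j c] L2_weak_deriv_D[of _ j c] unfolding in_H_def L2_weak_deriv_def by blast

lemma H_norm_sq_remainder_tendsto_0:
  assumes j_less: "j < p" and c_mem: "c \<in> I"
  shows "((\<lambda>h. H_norm_sq n (\<lambda>x. D 0 j (c + h) x - D 0 j c x - h * D 0 (Suc j) c x) / h^2) \<longlongrightarrow> 0) (at 0)"
proof -
  let ?r = "\<lambda>k h x. D k j (c + h) x - D k j c x - h * D k (Suc j) c x"
  have "((\<lambda>h. \<Sum>k\<le>n. LINT x|lborel. (?r k h x / h)^2) \<longlongrightarrow> (\<Sum>k\<le>n. 0)) (at 0)"
    using j_less by (intro tendsto_sum integral_remainder_sq_tendsto_0[OF C1_exp_decaying c_mem]) auto
  moreover have "\<forall>\<^sub>F h in at 0. (\<Sum>k\<le>n. LINT x|lborel. (?r k h x / h)^2) = H_norm_sq n (?r 0 h) / h^2"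
    using eventually_nhds_imp_at_0[OF eventually_nhds_in_open[OF open_I c_mem]]
  proof eventually_elim
    case (elim h)
    have "L2_weak_deriv k (?r 0 h) (?r k h)" if "k \<le> n" for k
    proof -
      have "L2_weak_deriv k (\<lambda>x. (D 0 j (c + h) x + (-1) * D 0 j c x) + (-h) * D 0 (Suc j) c x)
          (\<lambda>x. (D k j (c + h) x + (-1) * D k j c x) + (-h) * D k (Suc j) c x)"
        using elim c_mem j_less that by (intro L2_weak_deriv_lincomb L2_weak_deriv_D) auto
      then show ?thesis by simp
    qed
    from H_norm_sq_eq[OF this] show ?case
      by (simp add: power_divide sum_divide_distrib)
  qed
  ultimately show ?thesis using Lim_transform_eventually by fastforce
qed

lemma H_norm_sq_difference_tendsto_0:
  assumes c_mem: "c \<in> I"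
  shows "((\<lambda>c'. H_norm_sq n (\<lambda>x. D 0 p c' x - D 0 p c x)) \<longlongrightarrow> 0) (at c)"
proof -
  have "((\<lambda>c'. \<Sum>k\<le>n. LINT x|lborel. (D k p c' x - D k p c x)^2) \<longlongrightarrow> (\<Sum>k\<le>n. 0)) (at c)"
    by (intro tendsto_sum integral_difference_sq_tendsto_0[OF decaying c_mem] isCont_top c_mem) auto
  moreover have "\<forall>\<^sub>F c' in at c. c' \<in> I"
    using open_I c_mem by (rule eventually_at_in_open')
  then have "\<forall>\<^sub>F c' in at c. (\<Sum>k\<le>n. LINT x|lborel. (D k p c' x - D k p c x)^2)
      = H_norm_sq n (\<lambda>x. D 0 p c' x - D 0 p c x)"
  proof eventually_elim
    case (elim c')
    have "L2_weak_deriv k (\<lambda>x. D 0 p c' x - D 0 p c x) (\<lambda>x. D k p c' x - D k p c x)" if "k \<le> n" for k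
      using L2_weak_deriv_lincomb[OF L2_weak_deriv_D[OF that _ elim] L2_weak_deriv_D[OF that _ c_mem], of p p "-1"]
      by simp
    from H_norm_sq_eq[OF this] show ?case by simp
  qed
  ultimately show ?thesis using Lim_transform_eventually by fastforce
qed

lemma higher_deriv_x: "k \<le> n \<Longrightarrow> c \<in> I \<Longrightarrow> (deriv ^^ k) (D 0 0 c) = D k 0 c"
proof (induction k)
  case (Suc k)
  then have "(deriv ^^ k) (D 0 0 c) = D k 0 c" by simp
  moreover have "deriv (D k 0 c) = D (Suc k) 0 c"
    using DERIV_imp_deriv[OF deriv_x[of k c]] Suc.prems by (simp add: fun_eq_iff)
  ultimately show ?case by simp
qed simp

lemma pd_D:
  assumes "k \<le> n" "j \<le> p" "c \<in> I"
  shows "pd (D 0 0) j k c x = D k j c x"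
  using assms(2,3)
proof (induction j arbitrary: c)
  case 0
  then show ?case using higher_deriv_x[OF assms(1)] by (simp add: pd_def)
next
  case (Suc j)
  have "\<forall>\<^sub>F c' in nhds c. pd (D 0 0) j k c' x = D k j c' x"
    using eventually_nhds_in_open[OF open_I Suc.prems(2)]
    by eventually_elim (use Suc in simp)
  then have "deriv (\<lambda>c'. pd (D 0 0) j k c' x) c = deriv (\<lambda>c'. D k j c' x) c"
    by (rule deriv_cong_ev) simp
  also have "\<dots> = D k (Suc j) c x"
    using Suc.prems assms(1) by (intro DERIV_imp_deriv deriv_c) auto
  finally show ?case by (simp add: pd_def)
qed

lemma has_pds_D: "has_pds (D 0 0) I p n"
  unfolding has_pds_def
proof (intro ballI allI conjI impI)
  fix c x assume c_mem: "c \<in> I"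
  show "((deriv ^^ k) (D 0 0 c) has_real_derivative (deriv ^^ Suc k) (D 0 0 c) x) (at x)" if "k < n" for k
    using deriv_x[OF that c_mem] higher_deriv_x[of k c] higher_deriv_x[of "Suc k" c] that c_mem
    by (simp del: funpow.simps)
  fix k j assume k_j: "k \<le> n" "j < p"
  have "((\<lambda>c'. pd (D 0 0) j k c' x) has_real_derivative D k (Suc j) c x) (at c)"
    by (rule has_field_derivative_transform_within_open[OF deriv_c[OF k_j c_mem] open_I c_mem])
      (use pd_D k_j in simp)
  then show "((\<lambda>c'. pd (D 0 0) j k c' x) has_real_derivative pd (D 0 0) (Suc j) k c x) (at c)"
    using pd_D[of k "Suc j" c x] k_j c_mem by simp
qed

end

lemma has_X_derivI:
  assumes "((\<lambda>h. H_norm_sq (k + 1) (\<lambda>x. E (c + h) x - E c x - h * E' c x) / h^2) \<longlongrightarrow> 0) (at 0)"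
    and "((\<lambda>h. H_norm_sq k (\<lambda>x. V (c + h) x - V c x - h * V' c x) / h^2) \<longlongrightarrow> 0) (at 0)"
  shows "has_X_deriv k E V E' V' c"
proof -
  have "((\<lambda>h. sqrt (H_norm_sq (k + 1) (\<lambda>x. E (c + h) x - E c x - h * E' c x) / h^2
      + H_norm_sq k (\<lambda>x. V (c + h) x - V c x - h * V' c x) / h^2)) \<longlongrightarrow> sqrt (0 + 0)) (at 0)"
    by (intro tendsto_intros assms)
  then show ?thesis
    unfolding has_X_deriv_def X_norm_def
    by (simp add: add_divide_distrib[symmetric] real_sqrt_divide)
qed

lemma X_continuous_atI:
  assumes "((\<lambda>c'. H_norm_sq (k + 1) (\<lambda>x. E c' x - E c x)) \<longlongrightarrow> 0) (at c)"
    and "((\<lambda>c'. H_norm_sq k (\<lambda>x. V c' x - V c x)) \<longlongrightarrow> 0) (at c)"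
  shows "X_continuous_at k E V c"
proof -
  have "((\<lambda>c'. sqrt (H_norm_sq (k + 1) (\<lambda>x. E c' x - E c x) + H_norm_sq k (\<lambda>x. V c' x - V c x)))
      \<longlongrightarrow> sqrt (0 + 0)) (at c)"
    by (intro tendsto_intros assms)
  then show ?thesis unfolding X_continuous_at_def X_norm_def by simp
qed

lemma C2_NX_if_C2_exp_decaying:
  assumes "Cp_exp_decaying_family I 2 (k + 1) E" "Cp_exp_decaying_family I 2 k V"
    and sup: "\<And>c. c \<in> I \<Longrightarrow> Sup (range (E 0 0 c)) < 1"
  shows "C2_NX k I (E 0 0) (V 0 0)"
proof -
  interpret E: Cp_exp_decaying_family I 2 "k + 1" E by (rule assms(1))
  interpret V: Cp_exp_decaying_family I 2 k V by (rule assms(2))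
  have "in_NX k (E 0 0 c) (V 0 0 c) \<and> in_X k (E 0 1 c) (V 0 1 c) \<and> in_X k (E 0 2 c) (V 0 2 c)"
    if "c \<in> I" for c
    using E.in_H_D V.in_H_D sup that by (simp add: in_NX_def in_X_def)
  moreover have "has_X_deriv k (E 0 j) (V 0 j) (E 0 (Suc j)) (V 0 (Suc j)) c" if "j < 2" "c \<in> I" for j c
    using that by (intro has_X_derivI E.H_norm_sq_remainder_tendsto_0 V.H_norm_sq_remainder_tendsto_0)
  from this[of 0] this[of 1]
  have "has_X_deriv k (E 0 0) (V 0 0) (E 0 1) (V 0 1) c" "has_X_deriv k (E 0 1) (V 0 1) (E 0 2) (V 0 2) c"
    if "c \<in> I" for c
    using that by (auto simp: numeral_2_eq_2)
  moreover have "X_continuous_at k (E 0 2) (V 0 2) c" if "c \<in> I" for c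
    using that by (intro X_continuous_atI E.H_norm_sq_difference_tendsto_0 V.H_norm_sq_difference_tendsto_0)
  ultimately show ?thesis
    unfolding C2_NX_def
    by (intro exI[of _ "E 0 1"] exI[of _ "V 0 1"] exI[of _ "E 0 2"] exI[of _ "V 0 2"] ballI) simp
qed

section \<open>Symbol classes\<close>

text \<open>\<open>B\<close> is the size of \<open>u\<close>, and every application of the derivation \<open>\<mu>(c) d/dc\<close> must preserve
  this size up to powers of \<open>L\<close>. The variable \<open>x\<close> is a parameter.\<close>

definition symbol_bound ::
  "real set \<Rightarrow> (real \<Rightarrow> real \<Rightarrow> real) \<Rightarrow> (real \<Rightarrow> real \<Rightarrow> real) \<Rightarrow> (real \<Rightarrow> real \<Rightarrow> real) \<Rightarrow> bool" where
  "symbol_bound I L B u \<longleftrightarrow>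
     (\<exists>N K. \<forall>c\<in>I. \<forall>x. \<bar>u c x\<bar> \<le> K * L c x ^ N * B c x) \<and> (\<forall>c\<in>I. \<forall>x. 0 \<le> B c x) \<and>
     (\<forall>x. continuous_on I (\<lambda>c. u c x)) \<and> (\<forall>c\<in>I. continuous_on UNIV (u c))"

primrec symbol ::
  "real set \<Rightarrow> (real \<Rightarrow> real) \<Rightarrow> (real \<Rightarrow> real \<Rightarrow> real) \<Rightarrow> nat \<Rightarrow>
   (real \<Rightarrow> real \<Rightarrow> real) \<Rightarrow> (real \<Rightarrow> real \<Rightarrow> real) \<Rightarrow> bool" where
  "symbol I \<mu> L 0 B u \<longleftrightarrow> symbol_bound I L B u"
| "symbol I \<mu> L (Suc n) B u \<longleftrightarrow> symbol_bound I L B u \<and>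
     (\<exists>u'. (\<forall>c\<in>I. \<forall>x. ((\<lambda>c. u c x) has_real_derivative u' c x) (at c)) \<and>
        symbol I \<mu> L n B (\<lambda>c x. \<mu> c * u' c x))"

abbreviation param_deriv :: "nat \<Rightarrow> (real \<Rightarrow> real \<Rightarrow> real) \<Rightarrow> real \<Rightarrow> real \<Rightarrow> real" where
  "param_deriv j u c x \<equiv> (deriv ^^ j) (\<lambda>c. u c x) c"

locale symbol_calculus =
  fixes I :: "real set" and \<mu> :: "real \<Rightarrow> real" and L :: "real \<Rightarrow> real \<Rightarrow> real"
  assumes open_I: "open I" and L_ge_1: "c \<in> I \<Longrightarrow> 1 \<le> L c x"
begin

abbreviation S :: "nat \<Rightarrow> (real \<Rightarrow> real \<Rightarrow> real) \<Rightarrow> (real \<Rightarrow> real \<Rightarrow> real) \<Rightarrow> bool" where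
  "S \<equiv> symbol I \<mu> L"

lemma S_0I:
  assumes "\<And>c x. c \<in> I \<Longrightarrow> \<bar>u c x\<bar> \<le> K * L c x ^ N * B c x" "\<And>c x. c \<in> I \<Longrightarrow> 0 \<le> B c x"
    and "\<And>x. continuous_on I (\<lambda>c. u c x)" "\<And>c. c \<in> I \<Longrightarrow> continuous_on UNIV (u c)"
  shows "S 0 B u"
  using assms unfolding symbol.simps symbol_bound_def by blast

lemma S_0I_no_growth:
  assumes "\<And>c x. c \<in> I \<Longrightarrow> \<bar>u c x\<bar> \<le> K * B c x" "\<And>c x. c \<in> I \<Longrightarrow> 0 \<le> B c x"
    and "\<And>x. continuous_on I (\<lambda>c. u c x)" "\<And>c. c \<in> I \<Longrightarrow> continuous_on UNIV (u c)"
  shows "S 0 B u"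
  using S_0I[of u K 0 B] assms by simp

lemma S_imp_S_0: "S n B u \<Longrightarrow> S 0 B u"
  by (cases n) auto

lemma S_size_nonneg: "S n B u \<Longrightarrow> c \<in> I \<Longrightarrow> 0 \<le> B c x"
  using S_imp_S_0 by (auto simp: symbol_bound_def)

lemma S_continuous:
  assumes "S n B u"
  shows "continuous_on I (\<lambda>c. u c x)" "c \<in> I \<Longrightarrow> continuous_on UNIV (u c)"
  using S_imp_S_0[OF assms] by (auto simp: symbol_bound_def)

lemma S_boundE:
  assumes "S n B u"
  obtains N K where "0 \<le> K" "\<And>c x. c \<in> I \<Longrightarrow> \<bar>u c x\<bar> \<le> K * L c x ^ N * B c x"
proof -
  obtain N K where u_bound: "\<And>c x. c \<in> I \<Longrightarrow> \<bar>u c x\<bar> \<le> K * L c x ^ N * B c x"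
    using S_imp_S_0[OF assms] by (auto simp: symbol_bound_def)
  have "K * L c x ^ N * B c x \<le> \<bar>K\<bar> * L c x ^ N * B c x" if "c \<in> I" for c x
    using S_size_nonneg[OF assms that, of x] L_ge_1[OF that, of x] by (intro mult_right_mono) auto
  from order_trans[OF u_bound this] show ?thesis by (intro that[of "\<bar>K\<bar>" N]) simp_all
qed

lemma S_SucI:
  assumes "S 0 B u" "\<And>c x. c \<in> I \<Longrightarrow> ((\<lambda>c. u c x) has_real_derivative u' c x) (at c)"
    and "S n B (\<lambda>c x. \<mu> c * u' c x)"
  shows "S (Suc n) B u"
  using assms by auto

lemma S_SucE:
  assumes "S (Suc n) B u"
  obtains u' where "\<And>c x. c \<in> I \<Longrightarrow> ((\<lambda>c. u c x) has_real_derivative u' c x) (at c)"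
    and "S n B (\<lambda>c x. \<mu> c * u' c x)"
  using assms by auto

lemma S_Suc_imp_S: "S (Suc n) B u \<Longrightarrow> S n B u"
  by (induction n arbitrary: u) auto

lemma S_antimono: "S n B u \<Longrightarrow> k \<le> n \<Longrightarrow> S k B u"
  by (induction n) (auto simp: le_Suc_eq simp del: symbol.simps intro: S_Suc_imp_S)

lemma S_cong:
  assumes "S n B u" "\<And>c x. c \<in> I \<Longrightarrow> u c x = v c x"
  shows "S n B v"
proof -
  have S_0: "S 0 B v"
    using S_imp_S_0[OF assms(1)] assms(2) by (auto simp: symbol_bound_def cong: continuous_on_cong)
  show ?thesis
  proof (cases n)
    case (Suc k)
    obtain u' where u_deriv: "\<And>c x. c \<in> I \<Longrightarrow> ((\<lambda>c. u c x) has_real_derivative u' c x) (at c)"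
      "S k B (\<lambda>c x. \<mu> c * u' c x)"
      by (rule S_SucE[OF assms(1)[unfolded Suc]]) (rule that)
    have "((\<lambda>c. v c x) has_real_derivative u' c x) (at c)" if "c \<in> I" for c x
      by (rule has_field_derivative_transform_within_open[OF u_deriv(1)[OF that, of x] open_I that])
        (use assms(2) in simp)
    then show ?thesis
      unfolding Suc by (rule S_SucI[OF S_0 _ u_deriv(2)])
  qed (use S_0 in simp)
qed

lemma S_weaken:
  assumes "S n A u" "\<And>c x. c \<in> I \<Longrightarrow> A c x \<le> K * B c x" "\<And>c x. c \<in> I \<Longrightarrow> 0 \<le> B c x"
  shows "S n B u"
  using assms(1)
proof (induction n arbitrary: u)
  have S_0: "S 0 B u" if u_symbol: "S n A u" for n u
  proof -
    obtain N K' where u_bound: "0 \<le> K'" "\<And>c x. c \<in> I \<Longrightarrow> \<bar>u c x\<bar> \<le> K' * L c x ^ N * A c x"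
      by (rule S_boundE[OF u_symbol]) (rule that)
    have "\<bar>u c x\<bar> \<le> (K' * K) * L c x ^ N * B c x" if c_mem: "c \<in> I" for c x
    proof -
      have "0 \<le> K' * L c x ^ N" using u_bound L_ge_1[OF c_mem, of x] by simp
      then have "K' * L c x ^ N * A c x \<le> K' * L c x ^ N * (K * B c x)"
        using assms(2)[OF c_mem] by (intro mult_left_mono) auto
      then show ?thesis using u_bound(2)[OF c_mem, of x] by (simp add: algebra_simps)
    qed
    then show ?thesis by (rule S_0I) (use assms(3) S_continuous[OF u_symbol] in auto)
  qed
  {
    case 0
    then show ?case by (rule S_0)
  next
    case (Suc n)
    then show ?case by (elim S_SucE) (rule S_SucI[OF S_0[OF Suc.prems]])
  }
qed

lemma S_add:
  assumes "S n B u" "S n B v"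
  shows "S n B (\<lambda>c x. u c x + v c x)"
  using assms
proof (induction n arbitrary: u v)
  have S_0: "S 0 B (\<lambda>c x. u c x + v c x)" if u_symbol: "S n B u" and v_symbol: "S n B v" for n u v
  proof -
    obtain N K where u_bound: "0 \<le> K" "\<And>c x. c \<in> I \<Longrightarrow> \<bar>u c x\<bar> \<le> K * L c x ^ N * B c x"
      by (rule S_boundE[OF u_symbol]) (rule that)
    obtain N' K' where v_bound: "0 \<le> K'" "\<And>c x. c \<in> I \<Longrightarrow> \<bar>v c x\<bar> \<le> K' * L c x ^ N' * B c x"
      by (rule S_boundE[OF v_symbol]) (rule that)
    show ?thesis
    proof (rule S_0I[where K = "K + K'" and N = "N + N'"])
      fix c x assume c_mem: "c \<in> I"
      show B_nonneg: "0 \<le> B c x" by (rule S_size_nonneg[OF u_symbol c_mem])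
      have "K * L c x ^ N * B c x \<le> K * L c x ^ (N + N') * B c x"
        "K' * L c x ^ N' * B c x \<le> K' * L c x ^ (N + N') * B c x"
        using L_ge_1[OF c_mem, of x] u_bound v_bound B_nonneg
        by (auto intro!: mult_right_mono mult_left_mono power_increasing)
      then show "\<bar>u c x + v c x\<bar> \<le> (K + K') * L c x ^ (N + N') * B c x"
        using u_bound(2)[OF c_mem, of x] v_bound(2)[OF c_mem, of x] by (simp add: algebra_simps)
    qed (intro continuous_intros S_continuous[OF u_symbol] S_continuous[OF v_symbol]; assumption)+
  qed
  {
    case 0
    then show ?case by (rule S_0)
  next
    case (Suc n)
    obtain u' where u_deriv: "\<And>c x. c \<in> I \<Longrightarrow> ((\<lambda>c. u c x) has_real_derivative u' c x) (at c)"
      "S n B (\<lambda>c x. \<mu> c * u' c x)"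
      by (rule S_SucE[OF Suc.prems(1)]) (rule that)
    obtain v' where v_deriv: "\<And>c x. c \<in> I \<Longrightarrow> ((\<lambda>c. v c x) has_real_derivative v' c x) (at c)"
      "S n B (\<lambda>c x. \<mu> c * v' c x)"
      by (rule S_SucE[OF Suc.prems(2)]) (rule that)
    have "S n B (\<lambda>c x. \<mu> c * (u' c x + v' c x))"
      using Suc.IH[OF u_deriv(2) v_deriv(2)] by (simp add: distrib_left)
    then show ?case
      by (rule S_SucI[OF S_0[OF Suc.prems], rotated]) (intro DERIV_add u_deriv v_deriv)
  }
qed

lemma S_mult:
  assumes "S n A u" "S n B v"
  shows "S n (\<lambda>c x. A c x * B c x) (\<lambda>c x. u c x * v c x)"
  using assms
proof (induction n arbitrary: u v)
  have S_0: "S 0 (\<lambda>c x. A c x * B c x) (\<lambda>c x. u c x * v c x)"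
    if u_symbol: "S n A u" and v_symbol: "S n B v" for n u v
  proof -
    obtain N K where u_bound: "0 \<le> K" "\<And>c x. c \<in> I \<Longrightarrow> \<bar>u c x\<bar> \<le> K * L c x ^ N * A c x"
      by (rule S_boundE[OF u_symbol]) (rule that)
    obtain N' K' where v_bound: "0 \<le> K'" "\<And>c x. c \<in> I \<Longrightarrow> \<bar>v c x\<bar> \<le> K' * L c x ^ N' * B c x"
      by (rule S_boundE[OF v_symbol]) (rule that)
    show ?thesis
    proof (rule S_0I[where K = "K * K'" and N = "N + N'"])
      fix c x assume c_mem: "c \<in> I"
      show "0 \<le> A c x * B c x" using S_size_nonneg[OF u_symbol c_mem] S_size_nonneg[OF v_symbol c_mem] by simp
      have "\<bar>u c x * v c x\<bar> \<le> (K * L c x ^ N * A c x) * (K' * L c x ^ N' * B c x)"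
        unfolding abs_mult using u_bound(2)[OF c_mem, of x] v_bound(2)[OF c_mem, of x] by (intro mult_mono) auto
      then show "\<bar>u c x * v c x\<bar> \<le> K * K' * L c x ^ (N + N') * (A c x * B c x)"
        by (simp add: algebra_simps power_add)
    qed (intro continuous_intros S_continuous[OF u_symbol] S_continuous[OF v_symbol]; assumption)+
  qed
  {
    case 0
    then show ?case by (rule S_0)
  next
    case (Suc n)
    obtain u' where u_deriv: "\<And>c x. c \<in> I \<Longrightarrow> ((\<lambda>c. u c x) has_real_derivative u' c x) (at c)"
      "S n A (\<lambda>c x. \<mu> c * u' c x)"
      by (rule S_SucE[OF Suc.prems(1)]) (rule that)
    obtain v' where v_deriv: "\<And>c x. c \<in> I \<Longrightarrow> ((\<lambda>c. v c x) has_real_derivative v' c x) (at c)"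
      "S n B (\<lambda>c x. \<mu> c * v' c x)"
      by (rule S_SucE[OF Suc.prems(2)]) (rule that)
    have "S n (\<lambda>c x. A c x * B c x) (\<lambda>c x. (\<mu> c * u' c x) * v c x + u c x * (\<mu> c * v' c x))"
      using Suc.IH[OF u_deriv(2) S_Suc_imp_S[OF Suc.prems(2)]] Suc.IH[OF S_Suc_imp_S[OF Suc.prems(1)] v_deriv(2)]
      by (rule S_add)
    then have "S n (\<lambda>c x. A c x * B c x) (\<lambda>c x. \<mu> c * (u' c x * v c x + v' c x * u c x))"
      by (rule S_cong) (simp add: algebra_simps)
    then show ?case
      by (rule S_SucI[OF S_0[OF Suc.prems], rotated]) (intro DERIV_mult u_deriv v_deriv)
  }
qed

lemma S_mult_weaken:
  assumes "S n A u" "S n B v" "\<And>c x. c \<in> I \<Longrightarrow> A c x * B c x \<le> K * D c x" "\<And>c x. c \<in> I \<Longrightarrow> 0 \<le> D c x"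
  shows "S n D (\<lambda>c x. u c x * v c x)"
  by (rule S_weaken[OF S_mult[OF assms(1,2)] assms(3,4)])

lemma S_mult_bounded:
  assumes "S n (\<lambda>_ _. 1) u" "S n B v"
  shows "S n B (\<lambda>c x. u c x * v c x)"
  using S_mult[OF assms] by simp

lemma S_const: "S n (\<lambda>_ _. 1) (\<lambda>_ _. k)"
proof (induction n arbitrary: k)
  have S_0: "S 0 (\<lambda>_ _. 1) (\<lambda>_ _. k)" for k
    by (rule S_0I_no_growth[where K = "\<bar>k\<bar>"]) auto
  {
    case 0
    show ?case by (rule S_0)
  next
    case (Suc n)
    show ?case using Suc[of 0] by (intro S_SucI[OF S_0, where u' = "\<lambda>_ _. 0"]) auto
  }
qed

lemma S_cmult: "S n B v \<Longrightarrow> S n B (\<lambda>c x. k * v c x)"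
  by (rule S_mult_bounded[OF S_const])

lemma S_diff:
  assumes "S n B u" "S n B v"
  shows "S n B (\<lambda>c x. u c x - v c x)"
  using S_add[OF assms(1) S_cmult[OF assms(2), of "-1"]] by simp

lemma S_bootstrap:
  assumes "S 0 B u" "\<And>c x. c \<in> I \<Longrightarrow> ((\<lambda>c. u c x) has_real_derivative u' c x) (at c)"
    and "\<And>k. k < n \<Longrightarrow> S k B u \<Longrightarrow> S k B (\<lambda>c x. \<mu> c * u' c x)"
  shows "S n B u"
  using assms(3)
proof (induction n)
  case (Suc n)
  then have "S n B (\<lambda>c x. \<mu> c * u' c x)" by simp
  with assms(1,2) show ?case by (rule S_SucI)
qed (use assms(1) in simp)

lemma S_bootstrap_chain:
  assumes "S n A s" "S 0 B u"
    and deriv: "\<And>c x s'. c \<in> I \<Longrightarrow> ((\<lambda>c. s c x) has_real_derivative s') (at c) \<Longrightarrow>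
      ((\<lambda>c. u c x) has_real_derivative g c x * s') (at c)"
    and step: "\<And>k v. k < n \<Longrightarrow> S k B u \<Longrightarrow> S k A v \<Longrightarrow> S k B (\<lambda>c x. g c x * v c x)"
  shows "S n B u"
proof (cases n)
  case (Suc m)
  obtain s' where s_deriv: "\<And>c x. c \<in> I \<Longrightarrow> ((\<lambda>c. s c x) has_real_derivative s' c x) (at c)"
    "S m A (\<lambda>c x. \<mu> c * s' c x)"
    by (rule S_SucE[OF assms(1)[unfolded Suc]]) (rule that)
  show ?thesis
  proof (rule S_bootstrap[OF assms(2) deriv[OF _ s_deriv(1)]])
    fix k assume "k < n" "S k B u"
    then have "S k B (\<lambda>c x. g c x * (\<mu> c * s' c x))"
      using S_antimono[OF s_deriv(2), of k] Suc by (intro step) auto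
    then show "S k B (\<lambda>c x. \<mu> c * (g c x * s' c x))"
      by (rule S_cong) (simp only: mult.left_commute)
  qed
qed (use assms(2) in simp)

lemma S_inverse:
  assumes u_symbol: "S n A u" and bound: "\<And>c x. c \<in> I \<Longrightarrow> \<bar>1 / u c x\<bar> \<le> M * B c x"
    and "\<And>c x. c \<in> I \<Longrightarrow> A c x * B c x \<le> K" "\<And>c x. c \<in> I \<Longrightarrow> 0 \<le> B c x" "\<And>c x. c \<in> I \<Longrightarrow> u c x \<noteq> 0"
  shows "S n B (\<lambda>c x. 1 / u c x)"
proof (rule S_bootstrap_chain[OF u_symbol])
  show "S 0 B (\<lambda>c x. 1 / u c x)"
    using assms(4,5)
    by (intro S_0I_no_growth[OF bound] continuous_intros S_continuous[OF u_symbol]) auto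
  show "((\<lambda>c. 1 / u c x) has_real_derivative - 1 / (u c x)^2 * u') (at c)"
    if "c \<in> I" "((\<lambda>c. u c x) has_real_derivative u') (at c)" for c x u'
    using that assms(5) by (auto intro!: derivative_eq_intros simp: power2_eq_square)
  fix k v assume inverse_symbol: "S k B (\<lambda>c x. 1 / u c x)" and v_symbol: "S k A v"
  have "S k (\<lambda>_ _. 1) (\<lambda>c x. v c x * (1 / u c x))"
    by (rule S_mult_weaken[OF v_symbol inverse_symbol]) (use assms(3) in auto)
  from S_cmult[OF S_mult_bounded[OF this inverse_symbol], of "-1"]
  show "S k B (\<lambda>c x. - 1 / (u c x)^2 * v c x)"
    by (rule S_cong) (simp add: power2_eq_square)
qed

end

locale smooth_symbol_calculus = symbol_calculus +
  fixes \<mu>' :: "real \<Rightarrow> real"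
  assumes S_\<mu>': "S n (\<lambda>_ _. 1) (\<lambda>c _. \<mu>' c)"
    and \<mu>_DERIV: "c \<in> I \<Longrightarrow> (\<mu> has_real_derivative \<mu>' c) (at c)"
    and \<mu>_nonzero: "c \<in> I \<Longrightarrow> \<mu> c \<noteq> 0"
begin

lemma S_scaled_deriv:
  assumes u_symbol: "S (Suc n) B (\<lambda>c x. \<mu> c ^ j * u c x)"
  shows "c \<in> I \<Longrightarrow> ((\<lambda>c. u c x) has_real_derivative deriv (\<lambda>c. u c x) c) (at c)"
    and "S n B (\<lambda>c x. \<mu> c ^ Suc j * deriv (\<lambda>c. u c x) c)"
proof -
  obtain v where scaled_deriv: "\<And>c x. c \<in> I \<Longrightarrow> ((\<lambda>c. \<mu> c ^ j * u c x) has_real_derivative v c x) (at c)"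
    "S n B (\<lambda>c x. \<mu> c * v c x)"
    by (rule S_SucE[OF u_symbol]) (rule that)
  define w where "w c x = (v c x - real j * \<mu>' c * \<mu> c ^ j / \<mu> c * u c x) / \<mu> c ^ j" for c x
  have u_DERIV: "((\<lambda>c. u c x) has_real_derivative w c x) (at c)" if c_mem: "c \<in> I" for c x
  proof -
    have "((\<lambda>c. \<mu> c ^ j) has_real_derivative real j * \<mu>' c * \<mu> c ^ j / \<mu> c) (at c)"
    proof (cases j)
      case (Suc i)
      show ?thesis unfolding Suc
        by (rule DERIV_cong[OF DERIV_power_Suc[OF \<mu>_DERIV[OF c_mem]]]) (use \<mu>_nonzero[OF c_mem] in simp)
    qed simp
    then have "((\<lambda>c. (\<mu> c ^ j * u c x) / \<mu> c ^ j) has_real_derivative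
        (v c x * \<mu> c ^ j - (\<mu> c ^ j * u c x) * (real j * \<mu>' c * \<mu> c ^ j / \<mu> c)) / (\<mu> c ^ j * \<mu> c ^ j)) (at c)"
      using \<mu>_nonzero[OF c_mem] by (intro DERIV_divide scaled_deriv(1)[OF c_mem]) auto
    then have "((\<lambda>c. u c x) has_real_derivative
        (v c x * \<mu> c ^ j - (\<mu> c ^ j * u c x) * (real j * \<mu>' c * \<mu> c ^ j / \<mu> c)) / (\<mu> c ^ j * \<mu> c ^ j)) (at c)"
      by (rule has_field_derivative_transform_within_open[OF _ open_I c_mem]) (use \<mu>_nonzero in auto)
    then show ?thesis
      by (rule DERIV_cong) (use \<mu>_nonzero[OF c_mem] in \<open>simp add: w_def field_simps\<close>)
  qed
  then have deriv_u: "deriv (\<lambda>c. u c x) c = w c x" if "c \<in> I" for c x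
    using that by (simp add: DERIV_imp_deriv)
  show "c \<in> I \<Longrightarrow> ((\<lambda>c. u c x) has_real_derivative deriv (\<lambda>c. u c x) c) (at c)"
    using u_DERIV deriv_u by simp
  have "S n B (\<lambda>c x. \<mu> c * v c x - (real j * \<mu>' c) * (\<mu> c ^ j * u c x))"
    by (intro S_diff scaled_deriv(2) S_mult_bounded[OF _ S_Suc_imp_S[OF u_symbol]] S_cmult S_\<mu>')
  then show "S n B (\<lambda>c x. \<mu> c ^ Suc j * deriv (\<lambda>c. u c x) c)"
    by (rule S_cong) (simp add: deriv_u w_def \<mu>_nonzero field_simps)
qed

lemma S_param_deriv:
  assumes "S n B u" "j \<le> n"
  shows "S (n - j) B (\<lambda>c x. \<mu> c ^ j * param_deriv j u c x)"
  using assms(2)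
proof (induction j)
  case (Suc j)
  then have "S (Suc (n - Suc j)) B (\<lambda>c x. \<mu> c ^ j * param_deriv j u c x)"
    by (simp add: Suc_diff_Suc)
  from S_scaled_deriv(2)[OF this] show ?case by simp
qed (use assms(1) in simp)

lemma S_param_deriv_DERIV:
  assumes "S n B u" "j < n" "c \<in> I"
  shows "((\<lambda>c. param_deriv j u c x) has_real_derivative param_deriv (Suc j) u c x) (at c)"
proof -
  have "S (Suc (n - Suc j)) B (\<lambda>c x. \<mu> c ^ j * param_deriv j u c x)"
    using S_param_deriv[OF assms(1), of j] assms(2) by (simp add: Suc_diff_Suc)
  from S_scaled_deriv(1)[OF this assms(3)] show ?thesis by simp
qed

end

lemma abs_tanh_le_1: "\<bar>tanh y\<bar> \<le> (1::real)"
  using tanh_real_lt_1[of y] tanh_real_gt_neg1[of y] by linarith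

abbreviation euler_symbol :: "real set \<Rightarrow> nat \<Rightarrow> (real \<Rightarrow> real) \<Rightarrow> (real \<Rightarrow> real) \<Rightarrow> bool" where
  "euler_symbol J n B \<phi> \<equiv> symbol J (\<lambda>w. w) (\<lambda>_ _. 1) n (\<lambda>w _. B w) (\<lambda>w _. \<phi> w)"

lemma euler_symbol_calculus: "open J \<Longrightarrow> symbol_calculus J (\<lambda>_ _. 1)"
  by unfold_locales auto

lemma euler_symbol_deriv:
  assumes "euler_symbol J (Suc n) B \<phi>" "open J" "\<And>w. w \<in> J \<Longrightarrow> (\<phi> has_real_derivative \<phi>' w) (at w)"
  shows "euler_symbol J n B (\<lambda>w. w * \<phi>' w)"
proof -
  interpret symbol_calculus J "\<lambda>w. w" "\<lambda>_ _. 1" by (rule euler_symbol_calculus[OF assms(2)])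
  obtain \<psi> where \<phi>_deriv: "\<And>w x. w \<in> J \<Longrightarrow> (\<phi> has_real_derivative \<psi> w x) (at w)"
    "S n (\<lambda>w _. B w) (\<lambda>w x. w * \<psi> w x)"
    by (rule S_SucE[OF assms(1)]) (rule that)
  from \<phi>_deriv(2) show ?thesis
    by (rule S_cong) (use DERIV_unique[OF \<phi>_deriv(1) assms(3)] in simp)
qed

lemma euler_symbol_DERIV:
  assumes "euler_symbol J (Suc n) B \<phi>"
  obtains \<phi>' where "\<And>w. w \<in> J \<Longrightarrow> (\<phi> has_real_derivative \<phi>' w) (at w)"
proof -
  obtain \<psi> where "\<And>w x :: real. w \<in> J \<Longrightarrow> (\<phi> has_real_derivative \<psi> w x) (at w)"
    using assms by auto
  then show ?thesis by (rule that)
qed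

lemma euler_symbol_if_scaled_derivs_bounded:
  assumes J_open: "open J"
    and deriv: "\<And>k w. k < n \<Longrightarrow> w \<in> J \<Longrightarrow> (D k has_real_derivative D (Suc k) w) (at w)"
    and bound: "\<And>k w. k \<le> n \<Longrightarrow> w \<in> J \<Longrightarrow> \<bar>w ^ k * D k w\<bar> \<le> K * B w"
    and cont: "continuous_on J (D n)" and B_nonneg: "\<And>w. w \<in> J \<Longrightarrow> 0 \<le> B w"
  shows "euler_symbol J n B (D 0)"
proof -
  interpret symbol_calculus J "\<lambda>w. w" "\<lambda>_ _. 1" by (rule euler_symbol_calculus[OF J_open])
  have D_cont: "continuous_on J (D k)" if "k \<le> n" for k
  proof (cases "k = n")
    case False
    then show ?thesis
      using deriv[of k] that DERIV_isCont by (intro continuous_at_imp_continuous_on) auto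
  qed (use cont in simp)
  have "euler_symbol J i B (\<lambda>w. w ^ k * D k w)" if "k + i \<le> n" for i k
    using that
  proof (induction i arbitrary: k)
    have S_0: "euler_symbol J 0 B (\<lambda>w. w ^ k * D k w)" if "k \<le> n" for k
      by (rule S_0I_no_growth) (use bound that B_nonneg D_cont in \<open>auto intro!: continuous_intros\<close>)
    {
      case (0 k)
      then show ?case by (intro S_0) simp
    next
      case (Suc i k)
      have "euler_symbol J i B (\<lambda>w. real k * (w ^ k * D k w) + w ^ Suc k * D (Suc k) w)"
        by (intro S_add S_cmult Suc.IH) (use Suc.prems in auto)
      then have "euler_symbol J i B (\<lambda>w. w * (real k * w ^ (k - 1) * D k w + D (Suc k) w * w ^ k))"
        by (rule S_cong) (cases k; simp add: algebra_simps)
      then show ?case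
      proof (rule S_SucI[rotated 2])
        show "euler_symbol J 0 B (\<lambda>w. w ^ k * D k w)" using Suc.prems by (intro S_0) simp
        show "((\<lambda>w. w ^ k * D k w) has_real_derivative real k * w ^ (k - 1) * D k w + D (Suc k) w * w ^ k) (at w)"
          if "w \<in> J" for w and x :: real
          using DERIV_mult[OF DERIV_pow deriv[OF _ that]] Suc.prems by simp
      qed
    }
  qed
  from this[of 0 n] show ?thesis by simp
qed

context symbol_calculus
begin

lemma S_0_compose:
  assumes u_symbol: "S k A u" "\<And>c x. c \<in> I \<Longrightarrow> u c x \<in> J" and \<phi>_symbol: "euler_symbol J n B \<phi>" and J_open: "open J"
  shows "S 0 (\<lambda>c x. B (u c x)) (\<lambda>c x. \<phi> (u c x))"
proof -
  interpret J: symbol_calculus J "\<lambda>w. w" "\<lambda>_ _. 1" by (rule euler_symbol_calculus[OF J_open])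
  obtain K where \<phi>_bound: "\<And>w. w \<in> J \<Longrightarrow> \<bar>\<phi> w\<bar> \<le> K * B w"
    using J.S_boundE[OF \<phi>_symbol] by auto
  have \<phi>_cont: "continuous_on J \<phi>" by (rule J.S_continuous(1)[OF \<phi>_symbol])
  show ?thesis
  proof (rule S_0I_no_growth)
    show "continuous_on I (\<lambda>c. \<phi> (u c x))" for x
      using u_symbol(2) by (intro continuous_on_compose2[OF \<phi>_cont S_continuous(1)[OF u_symbol(1)]]) auto
    show "continuous_on UNIV (\<lambda>x. \<phi> (u c x))" if "c \<in> I" for c
      using u_symbol(2) that by (intro continuous_on_compose2[OF \<phi>_cont S_continuous(2)[OF u_symbol(1) that]]) auto
  qed (use \<phi>_bound J.S_size_nonneg[OF \<phi>_symbol] u_symbol(2) in auto)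
qed

lemma S_compose:
  assumes "open J" "J \<subseteq> {0<..}"
    and u_symbol: "S n u u" "\<And>c x. c \<in> I \<Longrightarrow> u c x \<in> J"
    and \<phi>_symbol: "euler_symbol J n B \<phi>"
  shows "S n (\<lambda>c x. B (u c x)) (\<lambda>c x. \<phi> (u c x))"
  using u_symbol(1) \<phi>_symbol
proof (induction n arbitrary: \<phi>)
  case 0
  then show ?case by (intro S_0_compose[OF _ u_symbol(2) _ assms(1)])
next
  case (Suc n)
  have u_pos: "0 < u c x" if "c \<in> I" for c x
    using u_symbol(2)[OF that] assms(2) by auto
  obtain u' where u_deriv: "\<And>c x. c \<in> I \<Longrightarrow> ((\<lambda>c. u c x) has_real_derivative u' c x) (at c)"
    "S n u (\<lambda>c x. \<mu> c * u' c x)"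
    by (rule S_SucE[OF Suc.prems(1)]) (rule that)
  obtain \<phi>' where \<phi>_deriv: "\<And>w. w \<in> J \<Longrightarrow> (\<phi> has_real_derivative \<phi>' w) (at w)"
    using euler_symbol_DERIV[OF Suc.prems(2)] by blast
  have S_u: "S n u u" by (rule S_Suc_imp_S[OF Suc.prems(1)])
  have "S n (\<lambda>c x. 1 / u c x) (\<lambda>c x. 1 / u c x)"
    by (rule S_inverse[OF S_u, of 1 _ 1])
      (use u_pos in \<open>auto simp: less_imp_le less_imp_neq[symmetric] abs_of_pos\<close>)
  then have "S n (\<lambda>_ _. 1) (\<lambda>c x. \<mu> c * u' c x * (1 / u c x))"
    by (rule S_mult_weaken[OF u_deriv(2), of _ _ 1]) (use u_pos in \<open>auto simp: less_imp_neq[symmetric]\<close>)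
  then have "S n (\<lambda>c x. B (u c x)) (\<lambda>c x. \<mu> c * u' c x * (1 / u c x) * (u c x * \<phi>' (u c x)))"
    using Suc.IH[OF S_u euler_symbol_deriv[OF Suc.prems(2) assms(1) \<phi>_deriv]] by (rule S_mult_bounded)
  then have "S n (\<lambda>c x. B (u c x)) (\<lambda>c x. \<mu> c * (\<phi>' (u c x) * u' c x))"
    by (rule S_cong) (use u_pos in \<open>simp add: less_imp_neq[symmetric]\<close>)
  moreover have "((\<lambda>c. \<phi> (u c x)) has_real_derivative \<phi>' (u c x) * u' c x) (at c)" if "c \<in> I" for c x
    using that by (intro DERIV_chain2[OF \<phi>_deriv] u_deriv u_symbol(2))
  moreover have "S 0 (\<lambda>c x. B (u c x)) (\<lambda>c x. \<phi> (u c x))"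
    using Suc.prems by (intro S_0_compose[OF _ u_symbol(2) _ assms(1)])
  ultimately show ?case by (intro S_SucI)
qed

lemma S_tanh:
  assumes s_symbol: "S n (\<lambda>_ _. 1) s"
  shows "S n (\<lambda>_ _. 1) (\<lambda>c x. tanh (s c x))"
proof (rule S_bootstrap_chain[OF s_symbol])
  show "S 0 (\<lambda>_ _. 1) (\<lambda>c x. tanh (s c x))"
    by (rule S_0I_no_growth[where K = 1])
      (auto intro!: continuous_intros S_continuous[OF s_symbol] simp: abs_tanh_le_1)
  show "((\<lambda>c. tanh (s c x)) has_real_derivative (1 - tanh (s c x) * tanh (s c x)) * s') (at c)"
    if "((\<lambda>c. s c x) has_real_derivative s') (at c)" for c x s'
    using that by (auto intro!: derivative_eq_intros simp: power2_eq_square)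
qed (intro S_mult_bounded S_diff S_const; assumption)

end

abbreviation sech_square :: "real \<Rightarrow> real" where "sech_square y \<equiv> 1 - (tanh y)^2"

lemma sech_square_pos: "0 < sech_square y" and sech_square_le_1: "sech_square y \<le> 1"
  using tanh_real_lt_1[of y] tanh_real_gt_neg1[of y] by (auto simp: abs_square_less_1 abs_less_iff)

lemma (in symbol_calculus) S_sech_square:
  assumes s_symbol: "S n (\<lambda>_ _. 1) s"
  shows "S n (\<lambda>c x. sech_square (s c x)) (\<lambda>c x. sech_square (s c x))"
proof (rule S_bootstrap_chain[OF s_symbol])
  show "S 0 (\<lambda>c x. sech_square (s c x)) (\<lambda>c x. sech_square (s c x))"
    by (rule S_0I_no_growth[where K = 1])
      (auto intro!: continuous_intros S_continuous[OF s_symbol]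
        simp: abs_square_le_1 abs_tanh_le_1 less_imp_le sech_square_pos)
  show "((\<lambda>c. sech_square (s c x)) has_real_derivative - 2 * tanh (s c x) * sech_square (s c x) * s') (at c)"
    if "((\<lambda>c. s c x) has_real_derivative s') (at c)" for c x s'
    using that by (auto intro!: derivative_eq_intros)
  fix k v
  assume "k < n" and "S k (\<lambda>c x. sech_square (s c x)) (\<lambda>c x. sech_square (s c x))" and "S k (\<lambda>_ _. 1) v"
  then have "S k (\<lambda>c x. sech_square (s c x)) (\<lambda>c x. ((- 2) * (tanh (s c x) * v c x)) * sech_square (s c x))"
    using S_antimono[OF s_symbol, of k] by (intro S_mult_bounded S_cmult S_tanh) auto
  then show "S k (\<lambda>c x. sech_square (s c x)) (\<lambda>c x. - 2 * tanh (s c x) * sech_square (s c x) * v c x)"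
    by (rule S_cong) (simp add: algebra_simps)
qed

section \<open>The phase function\<close>

lemma mult_sech_square_mem:
  assumes "\<mu> \<in> {0<..<w}"
  shows "\<mu> * sech_square y \<in> {0<..<w}"
proof -
  have "\<mu> * sech_square y \<le> \<mu> * 1"
    using assms sech_square_le_1[of y] by (intro mult_left_mono) auto
  moreover have "0 < \<mu> * sech_square y"
    using assms sech_square_pos[of y] by (intro mult_pos_pos) auto
  ultimately show ?thesis using assms by auto
qed

lemma continuous_on_mult_sech_square:
  assumes "continuous_on {0<..<w} k" "continuous_on A f" "continuous_on A g" "f ` A \<subseteq> {0<..<w}"
  shows "continuous_on A (\<lambda>z. k (f z * sech_square (g z)))"
  by (rule continuous_on_compose2[OF assms(1)])
    (use assms in \<open>auto intro!: continuous_intros simp del: greaterThanLessThan_iff intro: mult_sech_square_mem\<close>)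

text \<open>This is the integral of \<open>k (\<mu> sech\<^sup>2)\<close> from \<open>0\<close> to \<open>t\<close>, for either sign of \<open>t\<close>.\<close>

definition sech_integral :: "(real \<Rightarrow> real) \<Rightarrow> real \<Rightarrow> real \<Rightarrow> real" where
  "sech_integral k t \<mu> = t * integral {0..1} (\<lambda>r. k (\<mu> * sech_square (t * r)))"

lemma sech_integral_minus: "sech_integral k (- t) \<mu> = - sech_integral k t \<mu>"
  by (simp add: sech_integral_def)

lemma continuous_on_sech_integral:
  assumes k_cont: "continuous_on {0<..<w} k"
    and f_g: "continuous_on A f" "continuous_on A g" "g ` A \<subseteq> {0<..<w}"
  shows "continuous_on A (\<lambda>z. sech_integral k (f z) (g z))"
proof -
  have "continuous_on (UNIV \<times> {0<..<w}) (\<lambda>z. integral (cbox 0 1) (\<lambda>r. k (snd z * sech_square (fst z * r))))"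
    by (rule integral_continuous_on_param, unfold split_beta, rule continuous_on_mult_sech_square[OF k_cont])
      (auto intro!: continuous_intros)
  then have "continuous_on (UNIV \<times> {0<..<w}) (\<lambda>z. sech_integral k (fst z) (snd z))"
    unfolding sech_integral_def by (intro continuous_intros) simp
  from continuous_on_compose2[OF this continuous_on_Pair[OF f_g(1,2)]] show ?thesis
    using f_g(3) by (simp add: image_subset_iff)
qed

lemma sech_integral_has_derivative_upper:
  assumes k_cont: "continuous_on {0<..<w} k" and \<mu>_in: "\<mu> \<in> {0<..<w}"
  shows "((\<lambda>t. sech_integral k t \<mu>) has_real_derivative k (\<mu> * sech_square t)) (at t)"
proof -
  define g where "g y = k (\<mu> * sech_square y)" for y
  have g_cont: "continuous_on UNIV g"
    unfolding g_def using \<mu>_in by (intro continuous_on_mult_sech_square[OF k_cont]) (auto intro!: continuous_intros)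
  obtain G where G_deriv: "(G has_real_derivative g y) (at y)" for y
    using einterval_antiderivative[of "-\<infinity>" \<infinity> g] g_cont
    by (auto simp: continuous_on_eq_continuous_at has_real_derivative_iff_has_vector_derivative)
  have "sech_integral k t \<mu> = G t - G 0" for t
  proof -
    have "((\<lambda>r. g (t * r) * t) has_integral G (t * 1) - G (t * 0)) {0..1}"
      by (rule fundamental_theorem_of_calculus)
        (auto intro!: derivative_eq_intros DERIV_chain2[OF G_deriv]
          simp: has_real_derivative_iff_has_vector_derivative[symmetric])
    from integral_unique[OF this] show ?thesis by (simp add: sech_integral_def g_def mult.commute)
  qed
  then show ?thesis using G_deriv[of t] by (auto intro!: derivative_eq_intros simp: g_def)
qed

lemma sech_integral_has_derivative_scale:
  assumes k_deriv: "\<And>y. y \<in> {0<..<w} \<Longrightarrow> (k has_real_derivative k' y) (at y)"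
    and k'_cont: "continuous_on {0<..<w} (\<lambda>y. y * k' y)" and \<mu>_in: "\<mu> \<in> {0<..<w}"
  shows "((\<lambda>\<mu>. sech_integral k t \<mu>) has_real_derivative sech_integral (\<lambda>y. y * k' y) t \<mu> / \<mu>) (at \<mu>)"
proof -
  let ?J = "{0<..<w}"
  let ?\<theta> = "\<lambda>x r. (x * sech_square (t * r)) * k' (x * sech_square (t * r))"
  have k_cont: "continuous_on ?J k"
    using k_deriv DERIV_isCont by (blast intro: continuous_at_imp_continuous_on)
  have "((\<lambda>\<mu>. integral (cbox 0 1) (\<lambda>r. k (\<mu> * sech_square (t * r)))) has_real_derivative
      integral (cbox 0 1) (\<lambda>r. ?\<theta> \<mu> r / \<mu>)) (at \<mu> within ?J)"
  proof (rule leibniz_rule_field_derivative)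
    fix x r assume x_mem: "x \<in> ?J"
    have "((\<lambda>\<mu>. k (\<mu> * sech_square (t * r))) has_real_derivative
        k' (x * sech_square (t * r)) * sech_square (t * r)) (at x)"
      by (rule DERIV_chain2[where f = k and g = "\<lambda>\<mu>. \<mu> * sech_square (t * r)",
            OF k_deriv[OF mult_sech_square_mem[OF x_mem]]])
        (auto intro!: derivative_eq_intros)
    then show "((\<lambda>\<mu>. k (\<mu> * sech_square (t * r))) has_real_derivative ?\<theta> x r / x) (at x within ?J)"
      by (rule has_field_derivative_at_within[OF DERIV_cong]) (use x_mem in simp)
  next
    show "(\<lambda>r. k (x * sech_square (t * r))) integrable_on cbox 0 1" if "x \<in> ?J" for x
      using that by (intro integrable_continuous continuous_on_mult_sech_square[OF k_cont])
        (auto intro!: continuous_intros)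
  next
    have "continuous_on (?J \<times> cbox 0 1) (\<lambda>z. ?\<theta> (fst z) (snd z))"
      by (rule continuous_on_mult_sech_square[OF k'_cont]) (auto intro!: continuous_intros)
    then show "continuous_on (?J \<times> cbox 0 1) (\<lambda>(x, r). ?\<theta> x r / x)"
      unfolding split_beta by (rule continuous_on_divide) (auto intro!: continuous_intros)
  qed (use \<mu>_in in auto)
  moreover have "integral (cbox 0 1) (\<lambda>r. ?\<theta> \<mu> r / \<mu>) = integral {0..1} (?\<theta> \<mu>) / \<mu>"
    by (simp only: integral_divide cbox_interval)
  ultimately have "((\<lambda>\<mu>. integral {0..1} (\<lambda>r. k (\<mu> * sech_square (t * r)))) has_real_derivative
      integral {0..1} (?\<theta> \<mu>) / \<mu>) (at \<mu>)"
    using \<mu>_in by (simp add: at_within_open[of \<mu> ?J])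
  from DERIV_cmult[OF this, of t] show ?thesis
    by (simp add: sech_integral_def)
qed

lemma sech_integral_has_derivative:
  assumes k_deriv: "\<And>y. y \<in> {0<..<w} \<Longrightarrow> (k has_real_derivative k' y) (at y)"
    and k'_cont: "continuous_on {0<..<w} (\<lambda>y. y * k' y)" and \<mu>_in: "\<mu> \<in> {0<..<w}"
  shows "((\<lambda>(\<mu>, t). sech_integral k t \<mu>) has_derivative
      (\<lambda>(a, b). sech_integral (\<lambda>y. y * k' y) t \<mu> / \<mu> * a + k (\<mu> * sech_square t) * b)) (at (\<mu>, t))"
proof -
  let ?J = "{0<..<w}"
  let ?d = "sech_integral (\<lambda>y. y * k' y) t \<mu> / \<mu>"
  have k_cont: "continuous_on ?J k"
    using k_deriv DERIV_isCont by (blast intro: continuous_at_imp_continuous_on)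
  have "((\<lambda>(\<mu>, t). sech_integral k t \<mu>) has_derivative
      (\<lambda>(a, b). ?d * a + blinfun_mult_right (k (\<mu> * sech_square t)) b)) (at (\<mu>, t) within ?J \<times> UNIV)"
  proof (rule has_derivative_partialsI)
    show "((\<lambda>\<mu>. sech_integral k t \<mu>) has_derivative (\<lambda>a. ?d * a)) (at \<mu> within ?J)"
      using sech_integral_has_derivative_scale[OF k_deriv k'_cont \<mu>_in] has_field_derivative_at_within
      unfolding has_field_derivative_def by blast
    show "((\<lambda>t. sech_integral k t \<nu>) has_derivative blinfun_mult_right (k (\<nu> * sech_square t))) (at t within UNIV)"
      if "\<nu> \<in> ?J" for \<nu> t
      using sech_integral_has_derivative_upper[OF k_cont that, of t] by (simp add: has_field_derivative_def)
    have "continuous_on (?J \<times> UNIV) (\<lambda>z. blinfun_mult_right (k (fst z * sech_square (snd z))))"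
      by (intro bounded_linear.continuous_on[OF bounded_linear_blinfun_mult_right]
          continuous_on_mult_sech_square[OF k_cont] continuous_intros) auto
    then show "continuous (at (\<mu>, t) within ?J \<times> UNIV) (\<lambda>(\<mu>, t). blinfun_mult_right (k (\<mu> * sech_square t)))"
      using \<mu>_in by (auto simp: continuous_on_eq_continuous_within case_prod_unfold)
  qed (use \<mu>_in in auto)
  then show ?thesis
    using \<mu>_in by (subst (asm) at_within_open) (auto intro: open_Times)
qed

lemma sech_integral_chain:
  assumes k_deriv: "\<And>y. y \<in> {0<..<w} \<Longrightarrow> (k has_real_derivative k' y) (at y)"
    and k'_cont: "continuous_on {0<..<w} (\<lambda>y. y * k' y)" and \<mu>_in: "\<mu> c \<in> {0<..<w}"
    and derivs: "(\<mu> has_real_derivative \<mu>') (at c)" "(s has_real_derivative s') (at c)"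
  shows "((\<lambda>c. sech_integral k (s c) (\<mu> c)) has_real_derivative
      k (\<mu> c * sech_square (s c)) * s' + sech_integral (\<lambda>y. y * k' y) (s c) (\<mu> c) / \<mu> c * \<mu>') (at c)"
proof -
  have "((\<lambda>c. (\<mu> c, s c)) has_derivative (\<lambda>h. (\<mu>' * h, s' * h))) (at c)"
    using derivs unfolding has_field_derivative_def by (rule has_derivative_Pair)
  from has_derivative_compose[OF this sech_integral_has_derivative[OF k_deriv k'_cont \<mu>_in]]
  show ?thesis
    unfolding has_field_derivative_def prod.case
    by (rule has_derivative_eq_rhs) (auto simp: fun_eq_iff algebra_simps)
qed

lemma sech_integral_average_bounds:
  assumes k_cont: "continuous_on {0<..<w} k" and \<mu>_in: "\<mu> \<in> {0<..<w}"
    and bounds: "\<And>y. y \<in> {0<..<w} \<Longrightarrow> a \<le> k y \<and> k y \<le> b"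
  obtains \<kappa> where "sech_integral k t \<mu> = t * \<kappa>" "a \<le> \<kappa>" "\<kappa> \<le> b"
proof
  have k_integrable: "(\<lambda>r. k (\<mu> * sech_square (t * r))) integrable_on {0..1}"
    using \<mu>_in by (intro integrable_continuous_real continuous_on_mult_sech_square[OF k_cont])
      (auto intro!: continuous_intros)
  show "a \<le> integral {0..1} (\<lambda>r. k (\<mu> * sech_square (t * r)))"
    using integral_le[of "\<lambda>_. a" "{0..1}", OF integrable_const_ivl k_integrable]
      bounds mult_sech_square_mem[OF \<mu>_in] by simp
  show "integral {0..1} (\<lambda>r. k (\<mu> * sech_square (t * r))) \<le> b"
    using integral_le[of _ "{0..1}" "\<lambda>_. b", OF k_integrable integrable_const_ivl]
      bounds mult_sech_square_mem[OF \<mu>_in] by simp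
qed (simp add: sech_integral_def)

locale phase =
  fixes w :: real and q q' :: "real \<Rightarrow> real"
  assumes q_DERIV: "y \<in> {0<..<w} \<Longrightarrow> (q has_real_derivative q' y) (at y)"
    and \<theta>q_continuous: "continuous_on {0<..<w} (\<lambda>y. y * q' y)"
    and q_bounds: "y \<in> {0<..<w} \<Longrightarrow> 1/2 \<le> q y \<and> q y \<le> 2"
begin

lemma q_continuous: "continuous_on {0<..<w} q"
  using q_DERIV DERIV_isCont by (blast intro: continuous_at_imp_continuous_on)

lemma q_pos: "y \<in> {0<..<w} \<Longrightarrow> 0 < q y"
  using q_bounds[of y] by simp

lemma sech_integral_less_iff:
  assumes \<mu>_in: "\<mu> \<in> {0<..<w}"
  shows "sech_integral q s \<mu> < sech_integral q t \<mu> \<longleftrightarrow> s < t"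
proof -
  have "sech_integral q s \<mu> < sech_integral q t \<mu>" if "s < t" for s t
    using sech_integral_has_derivative_upper[OF q_continuous \<mu>_in] q_pos[OF mult_sech_square_mem[OF \<mu>_in]]
    by (intro DERIV_pos_imp_increasing[OF that] exI[of _ "q (\<mu> * sech_square _)"] conjI)
  from this[of s t] this[of t s] show ?thesis by (cases s t rule: linorder_cases) auto
qed

lemma sech_integral_bij:
  assumes \<mu>_in: "\<mu> \<in> {0<..<w}"
  shows "\<exists>!t. sech_integral q t \<mu> = y"
proof -
  obtain \<kappa> where average: "sech_integral q (2 * \<bar>y\<bar>) \<mu> = 2 * \<bar>y\<bar> * \<kappa>" "1/2 \<le> \<kappa>"
    using sech_integral_average_bounds[OF q_continuous \<mu>_in q_bounds] by metis
  then have "\<bar>y\<bar> \<le> sech_integral q (2 * \<bar>y\<bar>) \<mu>"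
    using mult_left_mono[OF average(2), of "2 * \<bar>y\<bar>"] by simp
  then have "sech_integral q (- 2 * \<bar>y\<bar>) \<mu> \<le> y" "y \<le> sech_integral q (2 * \<bar>y\<bar>) \<mu>"
    using sech_integral_minus[of q "2 * \<bar>y\<bar>" \<mu>] by auto
  then have "\<exists>t\<ge>- 2 * \<bar>y\<bar>. t \<le> 2 * \<bar>y\<bar> \<and> sech_integral q t \<mu> = y"
    using sech_integral_has_derivative_upper[OF q_continuous \<mu>_in]
    by (intro IVT') (auto intro!: continuous_at_imp_continuous_on DERIV_isCont)
  moreover have "s = t" if "sech_integral q s \<mu> = y" "sech_integral q t \<mu> = y" for s t
    using sech_integral_less_iff[OF \<mu>_in, of s t] sech_integral_less_iff[OF \<mu>_in, of t s] that by auto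
  ultimately show ?thesis by blast
qed

definition phi :: "real \<Rightarrow> real \<Rightarrow> real" where
  "phi \<mu> y = (THE t. sech_integral q t \<mu> = y)"

lemma sech_integral_phi: "\<mu> \<in> {0<..<w} \<Longrightarrow> sech_integral q (phi \<mu> y) \<mu> = y"
  unfolding phi_def by (rule theI'[OF sech_integral_bij])

lemma phi_eqI: "\<mu> \<in> {0<..<w} \<Longrightarrow> sech_integral q t \<mu> = y \<Longrightarrow> phi \<mu> y = t"
  unfolding phi_def using sech_integral_bij by blast

lemma phi_minus: "\<mu> \<in> {0<..<w} \<Longrightarrow> phi \<mu> (- y) = - phi \<mu> y"
  by (rule phi_eqI) (auto simp: sech_integral_minus sech_integral_phi)

lemma phi_bounds:
  assumes "\<mu> \<in> {0<..<w}"
  shows "\<bar>phi \<mu> y\<bar> \<le> 2 * \<bar>y\<bar>" "\<bar>y\<bar> \<le> 2 * \<bar>phi \<mu> y\<bar>"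
proof -
  obtain \<kappa> where average: "sech_integral q (phi \<mu> y) \<mu> = phi \<mu> y * \<kappa>" "1/2 \<le> \<kappa>" "\<kappa> \<le> 2"
    using sech_integral_average_bounds[OF q_continuous assms q_bounds] by metis
  have "\<bar>y\<bar> = \<bar>phi \<mu> y * \<kappa>\<bar>"
    using sech_integral_phi[OF assms, of y] average(1) by simp
  also have "\<dots> = \<bar>phi \<mu> y\<bar> * \<kappa>"
    using average(2) by (simp add: abs_mult)
  finally have "\<bar>y\<bar> = \<bar>phi \<mu> y\<bar> * \<kappa>" .
  then show "\<bar>phi \<mu> y\<bar> \<le> 2 * \<bar>y\<bar>" "\<bar>y\<bar> \<le> 2 * \<bar>phi \<mu> y\<bar>"
    using mult_left_mono[OF average(2), of "\<bar>phi \<mu> y\<bar>"] mult_left_mono[OF average(3), of "\<bar>phi \<mu> y\<bar>"] by auto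
qed

lemma phi_has_derivative:
  fixes \<mu> y :: real
  assumes \<mu>_in: "\<mu> \<in> {0<..<w}"
  defines "s \<equiv> phi \<mu> y"
  shows "((\<lambda>(\<mu>, y). (\<mu>, phi \<mu> y)) has_derivative
      (\<lambda>(a, b). (a, (b - sech_integral (\<lambda>z. z * q' z) s \<mu> / \<mu> * a) / q (\<mu> * sech_square s)))) (at (\<mu>, y))"
proof -
  let ?d = "sech_integral (\<lambda>z. z * q' z) s \<mu> / \<mu>" and ?q = "q (\<mu> * sech_square s)"
  let ?F = "\<lambda>(\<mu>, t). (\<mu>, sech_integral q t \<mu>)"
  show ?thesis
  proof (rule has_derivative_inverse_strong_x[where S = "{0<..<w} \<times> UNIV" and f = ?F])
    show "continuous_on ({0<..<w} \<times> UNIV) ?F"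
      unfolding split_beta
      by (intro continuous_on_Pair continuous_on_sech_integral[OF q_continuous]) (auto intro!: continuous_intros)
    have "((\<lambda>z. (fst z, (\<lambda>(\<mu>, t). sech_integral q t \<mu>) z)) has_derivative
        (\<lambda>h. (fst h, (\<lambda>(a, b). ?d * a + ?q * b) h))) (at (\<mu>, s))"
      by (intro has_derivative_Pair sech_integral_has_derivative[OF q_DERIV \<theta>q_continuous \<mu>_in])
        (auto intro!: derivative_intros)
    then show "(?F has_derivative (\<lambda>(a, b). (a, ?d * a + ?q * b))) (at (case (\<mu>, y) of (\<mu>, y) \<Rightarrow> (\<mu>, phi \<mu> y)))"
      by (simp add: case_prod_unfold s_def)
    show "(\<lambda>(a, b). (a, ?d * a + ?q * b)) \<circ> (\<lambda>(a, b). (a, (b - ?d * a) / ?q)) = id"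
      using q_pos[OF mult_sech_square_mem[OF \<mu>_in], of s] by (auto simp: fun_eq_iff)
  qed (use \<mu>_in in \<open>auto simp: open_Times sech_integral_phi phi_eqI\<close>)
qed

lemma phi_chain:
  assumes \<mu>_c: "\<mu> c \<in> {0<..<w}" "(\<mu> has_real_derivative \<mu>') (at c)"
    and y_deriv: "(y has_real_derivative y') (at c)"
  defines "s \<equiv> phi (\<mu> c) (y c)"
  shows "((\<lambda>c. phi (\<mu> c) (y c)) has_real_derivative
      (y' - sech_integral (\<lambda>z. z * q' z) s (\<mu> c) / \<mu> c * \<mu>') / q (\<mu> c * sech_square s)) (at c)"
proof -
  have "((\<lambda>c. (\<mu> c, y c)) has_derivative (\<lambda>h. (\<mu>' * h, y' * h))) (at c)"
    using \<mu>_c(2) y_deriv unfolding has_field_derivative_def by (rule has_derivative_Pair)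
  from has_derivative_snd[OF has_derivative_compose[OF this phi_has_derivative[OF \<mu>_c(1)]]]
  show ?thesis
    unfolding has_field_derivative_def prod.case snd_conv s_def
    by (rule has_derivative_eq_rhs) (auto simp: fun_eq_iff field_simps)
qed

end

section \<open>The nonlinearity\<close>

lemma tendsto_div_power_if_deriv:
  fixes g g' :: "real \<Rightarrow> real"
  assumes deriv: "\<forall>\<^sub>F e in at 0. (g has_real_derivative g' e) (at e)" and g_tendsto: "(g \<longlongrightarrow> 0) (at 0)"
    and g'_tendsto: "((\<lambda>e. g' e / e ^ n) \<longlongrightarrow> a) (at 0)"
  shows "((\<lambda>e. g e / e ^ Suc n) \<longlongrightarrow> a / real (Suc n)) (at 0)"
proof (rule lhopital[where f' = g' and g' = "\<lambda>e. real (Suc n) * e ^ n"])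
  have nonzero: "\<forall>\<^sub>F e::real in at 0. e \<noteq> 0" by (simp add: eventually_at_filter)
  then show "\<forall>\<^sub>F e::real in at 0. e ^ Suc n \<noteq> 0" by eventually_elim simp
  from nonzero show "\<forall>\<^sub>F e::real in at 0. real (Suc n) * e ^ n \<noteq> 0" by eventually_elim simp
  show "\<forall>\<^sub>F e in at 0. ((\<lambda>e. e ^ Suc n) has_real_derivative real (Suc n) * e ^ n) (at e)"
    using DERIV_pow[of "Suc n"] by (intro always_eventually) simp
  have "((\<lambda>e. g' e / e ^ n / real (Suc n)) \<longlongrightarrow> a / real (Suc n)) (at 0)"
    by (intro tendsto_divide g'_tendsto tendsto_const) simp
  then show "((\<lambda>e. g' e / (real (Suc n) * e ^ n)) \<longlongrightarrow> a / real (Suc n)) (at 0)"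
    by (simp add: mult.commute)
qed (use deriv g_tendsto in \<open>auto intro!: tendsto_eq_intros\<close>)

locale pressure_law =
  fixes f f1 f2 f3 :: "real \<Rightarrow> real" and cs :: real
  assumes f_DERIV: "\<forall>x\<ge>0. (f has_real_derivative f1 x) (at x within {0..})"
    and f1_DERIV: "\<forall>x\<ge>0. (f1 has_real_derivative f2 x) (at x within {0..})"
    and f2_DERIV: "\<forall>x\<ge>0. (f2 has_real_derivative f3 x) (at x within {0..})"
    and f3_continuous: "continuous_on {0..} f3"
    and f_at_1: "f 1 = 0"
    and f1_at_1_neg: "f1 1 < 0"
    and cs_eq: "cs = sqrt (- 2 * f1 1)"
    and Fpot_ge: "\<forall>\<rho>\<ge>0. cs^2 / 4 * (1 - \<rho>)^2 \<le> Fpot f \<rho>"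
begin

lemma cs_pos: "0 < cs" and cs_sq: "cs^2 = - 2 * f1 1"
  using f1_at_1_neg by (auto simp: cs_eq)

lemma f_derivs_at:
  assumes "0 < x"
  shows "(f has_real_derivative f1 x) (at x)" "(f1 has_real_derivative f2 x) (at x)"
    "(f2 has_real_derivative f3 x) (at x)"
proof -
  have "at x within {0..} = at x"
    using assms by (intro at_within_interior) simp
  then show "(f has_real_derivative f1 x) (at x)" "(f1 has_real_derivative f2 x) (at x)"
    "(f2 has_real_derivative f3 x) (at x)"
    using f_DERIV f1_DERIV f2_DERIV assms by (metis less_imp_le)+
qed

lemma Fpot_1: "Fpot f 1 = 0"
  by (simp add: Fpot_def one_ereal_def)

lemma Fpot_DERIV:
  assumes "0 < x"
  shows "(Fpot f has_real_derivative - f x) (at x)"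
proof -
  have "continuous_on {0..} f"
    unfolding continuous_on_eq_continuous_within using f_DERIV DERIV_continuous by fastforce
  then have f_cont: "continuous_on {0..x+1} f"
    by (rule continuous_on_subset) auto
  have "((\<lambda>u. LBINT y=(1::real)..u. f y) has_vector_derivative f x) (at x within {0..x+1})"
    by (rule interval_integral_FTC2[OF _ _ f_cont]) (use assms in auto)
  moreover have "at x within {0..x+1} = at x"
    using assms by (intro at_within_interior) simp
  ultimately have "((\<lambda>u. LBINT y=(1::real)..u. f y) has_real_derivative f x) (at x)"
    by (simp add: has_real_derivative_iff_has_vector_derivative)
  from DERIV_minus[OF this] show ?thesis
    unfolding Fpot_def[abs_def] by (subst interval_integral_endpoints_reverse) (simp add: one_ereal_def)
qed

text \<open>\<open>N k\<close> is the \<open>k\<close>th derivative of \<open>N 0\<close>, for \<open>k \<le> 4\<close> only.\<close>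

definition N :: "nat \<Rightarrow> real \<Rightarrow> real" where
  "N k e =
    (if k = 0 then cs^2 * e^2 - 4 * (1 - e) * Fpot f (1 - e)
     else if k = 1 then 2 * cs^2 * e + 4 * Fpot f (1 - e) - 4 * (1 - e) * f (1 - e)
     else if k = 2 then 2 * cs^2 + 8 * f (1 - e) + 4 * (1 - e) * f1 (1 - e)
     else if k = 3 then - 12 * f1 (1 - e) - 4 * (1 - e) * f2 (1 - e)
     else 16 * f2 (1 - e) + 4 * (1 - e) * f3 (1 - e))"

lemma N_DERIV:
  assumes "e < 1" "k < 4"
  shows "(N k has_real_derivative N (Suc k) e) (at e)"
proof -
  have shift: "((\<lambda>e. 1 - e) has_real_derivative - 1) (at e)"
    by (auto intro!: derivative_eq_intros)
  have shift_pos: "0 < 1 - e" using assms by simp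
  note derivs = DERIV_chain2[where g = "\<lambda>e. 1 - e", OF Fpot_DERIV[OF shift_pos] shift]
    DERIV_chain2[where g = "\<lambda>e. 1 - e", OF f_derivs_at(1)[OF shift_pos] shift]
    DERIV_chain2[where g = "\<lambda>e. 1 - e", OF f_derivs_at(2)[OF shift_pos] shift]
    DERIV_chain2[where g = "\<lambda>e. 1 - e", OF f_derivs_at(3)[OF shift_pos] shift]
  consider "k = 0" | "k = 1" | "k = 2" | "k = 3" using assms(2) by linarith
  then show ?thesis
    by cases (simp_all add: N_def[abs_def] numeral_eq_Suc,
        (rule derivative_eq_intros derivs refl | simp add: algebra_simps)+)
qed

lemma N_continuous:
  assumes "k \<le> 4"
  shows "continuous_on {..<1} (N k)"
proof (cases "k = 4")
  case True
  have "continuous_on {0<..} f2"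
    using f_derivs_at(3) DERIV_isCont by (auto intro!: continuous_at_imp_continuous_on)
  then have "continuous_on {..<1} (\<lambda>e. f2 (1 - e))" "continuous_on {..<1} (\<lambda>e. f3 (1 - e))"
    by (auto intro!: continuous_on_compose2[of "{0<..}" f2] continuous_on_compose2[OF f3_continuous]
        continuous_intros)
  then show ?thesis unfolding True N_def[abs_def] by (auto intro!: continuous_intros)
next
  case False
  then show ?thesis
    using N_DERIV[of _ k] assms DERIV_isCont by (intro continuous_at_imp_continuous_on) auto
qed

lemma N_tendsto:
  assumes "k \<le> 4"
  shows "(N k \<longlongrightarrow> N k 0) (at 0)"
  using N_continuous[OF assms] by (simp add: continuous_on_eq_continuous_at isCont_def)

lemma N_at_0: "k < 3 \<Longrightarrow> N k 0 = 0"
  by (auto simp: N_def Fpot_1 f_at_1 cs_sq)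

text \<open>Truncated subtraction makes \<open>N 3\<close> and \<open>N 4\<close> bounded.\<close>

lemma N_div_power_tendsto:
  assumes "k \<le> 4"
  shows "((\<lambda>e. N k e / e ^ (3 - k)) \<longlongrightarrow> N (max k 3) 0 / fact (3 - k)) (at 0)"
proof (cases "k \<le> 3")
  case True
  then show ?thesis
  proof (induction rule: inc_induct)
    case base
    show ?case using N_tendsto[of 3] by simp
  next
    case (step k)
    have "\<forall>\<^sub>F e::real in at 0. e < 1"
      by (rule order_tendstoD(2)[OF tendsto_ident_at]) simp
    then have deriv: "\<forall>\<^sub>F e in at 0. (N k has_real_derivative N (Suc k) e) (at e)"
      by eventually_elim (use step.hyps in \<open>simp add: N_DERIV\<close>)
    have N_k_tendsto: "(N k \<longlongrightarrow> 0) (at 0)"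
      using N_tendsto[of k] N_at_0[of k] step.hyps by simp
    define n where "n = 3 - Suc k"
    have "3 - k = Suc n" "max k 3 = max (Suc k) 3"
      using step.hyps by (auto simp: n_def)
    with tendsto_div_power_if_deriv[OF deriv N_k_tendsto step.IH[folded n_def]] show ?case
      by (simp add: mult.commute)
  qed
next
  case False
  then have "k = 4" using assms by simp
  then show ?thesis using N_tendsto[of 4] by simp
qed

lemma N_le:
  assumes "e < 1"
  shows "N 0 e \<le> cs^2 * e^3"
proof -
  have "4 * (1 - e) * (cs^2 / 4 * (1 - (1 - e))^2) \<le> 4 * (1 - e) * Fpot f (1 - e)"
    using Fpot_ge[rule_format, of "1 - e"] assms by (intro mult_left_mono) auto
  moreover have "4 * (1 - e) * (cs^2 / 4 * (1 - (1 - e))^2) = cs^2 * e^2 - cs^2 * e^3"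
    by (simp add: left_diff_distrib power2_eq_square power3_eq_cube)
  ultimately show ?thesis by (simp add: N_def)
qed

text \<open>The bound (H1) is one-sided on either side of the density \<open>1\<close>, which forces \<open>f2 1 = 0\<close>.\<close>

lemma N_3_at_0: "N 3 0 = 6 * cs^2"
proof (rule antisym)
  have "((\<lambda>e. N 0 e / e^3) \<longlongrightarrow> N 3 0 / 6) (at 0)"
    using N_div_power_tendsto[of 0] by (simp add: eval_nat_numeral)
  then have ratio_tendsto: "((\<lambda>e. N 0 e / e^3) \<longlongrightarrow> N 3 0 / 6) (at_right 0)"
      "((\<lambda>e. N 0 e / e^3) \<longlongrightarrow> N 3 0 / 6) (at_left 0)"
    by (auto intro: tendsto_within_subset)
  have "\<forall>\<^sub>F e in at_right (0::real). e \<in> {0<..<1}" by (rule eventually_at_right_real) simp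
  then have "\<forall>\<^sub>F e in at_right (0::real). N 0 e / e^3 \<le> cs^2"
    by eventually_elim (use N_le in \<open>auto simp: divide_le_eq\<close>)
  then have "N 3 0 / 6 \<le> cs^2" by (rule tendsto_upperbound[OF ratio_tendsto(1)]) simp
  then show "N 3 0 \<le> 6 * cs^2" by simp
  have "\<forall>\<^sub>F e in at_left (0::real). e \<in> {-1<..<0}" by (rule eventually_at_left_real) simp
  then have "\<forall>\<^sub>F e in at_left (0::real). cs^2 \<le> N 0 e / e^3"
  proof eventually_elim
    case (elim e)
    then have "e^3 < 0" by (simp add: power_less_zero_eq)
    then show ?case using N_le[of e] elim by (simp add: le_divide_eq)
  qed
  then have "cs^2 \<le> N 3 0 / 6" by (rule tendsto_lowerbound[OF ratio_tendsto(2)]) simp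
  then show "6 * cs^2 \<le> N 3 0" by simp
qed

text \<open>With \<open>\<omega> e = N 0 e / e\<^sup>2\<close>, these are \<open>e\<^sup>3 \<omega>' e\<close>, the ratio \<open>\<omega> e / (e \<omega>' e)\<close>, and its derivative.\<close>

definition \<Delta> :: "real \<Rightarrow> real" where "\<Delta> e = e * N 1 e - 2 * N 0 e"
definition \<kappa> :: "real \<Rightarrow> real" where "\<kappa> e = N 0 e / \<Delta> e"
definition \<kappa>' :: "real \<Rightarrow> real" where "\<kappa>' e = (N 1 e * \<Delta> e - N 0 e * (e * N 2 e - N 1 e)) / (\<Delta> e * \<Delta> e)"

lemma N_012_tendsto:
  "((\<lambda>e. N 0 e / e^3) \<longlongrightarrow> cs^2) (at_right 0)" "((\<lambda>e. N 1 e / e^2) \<longlongrightarrow> 3 * cs^2) (at_right 0)"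
  "((\<lambda>e. N 2 e / e) \<longlongrightarrow> 6 * cs^2) (at_right 0)"
  using N_div_power_tendsto[of 0] N_div_power_tendsto[of 1] N_div_power_tendsto[of 2]
  by (auto simp: N_3_at_0 fact_numeral intro: tendsto_within_subset)

lemma \<Delta>_tendsto: "((\<lambda>e. \<Delta> e / e^3) \<longlongrightarrow> cs^2) (at_right 0)"
proof -
  have "((\<lambda>e. N 1 e / e^2 - 2 * (N 0 e / e^3)) \<longlongrightarrow> 3 * cs^2 - 2 * cs^2) (at_right 0)"
    by (intro tendsto_intros N_012_tendsto)
  then have "((\<lambda>e. N 1 e / e^2 - 2 * (N 0 e / e^3)) \<longlongrightarrow> cs^2) (at_right 0)" by simp
  then show ?thesis
    by (rule Lim_transform_eventually)
      (auto simp: eventually_at_filter \<Delta>_def field_simps power2_eq_square power3_eq_cube)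
qed

lemma \<kappa>_tendsto: "(\<kappa> \<longlongrightarrow> 1) (at_right 0)"
proof -
  have "((\<lambda>e. (N 0 e / e^3) / (\<Delta> e / e^3)) \<longlongrightarrow> cs^2 / cs^2) (at_right 0)"
    using cs_pos by (intro tendsto_divide N_012_tendsto \<Delta>_tendsto) simp
  then have "((\<lambda>e. (N 0 e / e^3) / (\<Delta> e / e^3)) \<longlongrightarrow> 1) (at_right 0)" using cs_pos by simp
  then show ?thesis
    by (rule Lim_transform_eventually) (auto simp: eventually_at_filter \<kappa>_def)
qed

lemma \<kappa>'_tendsto: "((\<lambda>e. e * \<kappa>' e) \<longlongrightarrow> 0) (at_right 0)"
proof -
  let ?num = "\<lambda>e. (N 1 e / e^2) * (\<Delta> e / e^3) - (N 0 e / e^3) * (N 2 e / e - N 1 e / e^2)"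
  have "((\<lambda>e. ?num e / ((\<Delta> e / e^3) * (\<Delta> e / e^3))) \<longlongrightarrow>
      ((3 * cs^2) * cs^2 - cs^2 * (6 * cs^2 - 3 * cs^2)) / (cs^2 * cs^2)) (at_right 0)"
    using cs_pos by (intro tendsto_intros N_012_tendsto \<Delta>_tendsto) simp
  then have "((\<lambda>e. ?num e / ((\<Delta> e / e^3) * (\<Delta> e / e^3))) \<longlongrightarrow> 0) (at_right 0)" by simp
  moreover have "?num e / ((\<Delta> e / e^3) * (\<Delta> e / e^3)) = e * \<kappa>' e" if "e \<noteq> 0" for e
  proof -
    have "?num e = (N 1 e * \<Delta> e - N 0 e * (e * N 2 e - N 1 e)) / e^5"
      using that by (simp add: field_simps eval_nat_numeral)
    then show ?thesis using that by (simp add: \<kappa>'_def eval_nat_numeral)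
  qed
  ultimately show ?thesis
    by (elim Lim_transform_eventually) (simp add: eventually_at_filter)
qed

lemma N_eventually_bounded:
  obtains K where "\<forall>\<^sub>F e in at_right 0. \<forall>k\<le>4. \<bar>N k e\<bar> \<le> K * e ^ (3 - k)"
proof -
  define l where "l k = N (max k 3) 0 / fact (3 - k)" for k
  define K where "K = (\<Sum>k\<le>4. \<bar>l k\<bar> + 1)"
  have limit_le_K: "\<bar>l k\<bar> + 1 \<le> K" if "k \<le> 4" for k
    unfolding K_def using that by (intro member_le_sum[of k "{..4}" "\<lambda>k. \<bar>l k\<bar> + 1"]) auto
  have e_pos: "\<forall>\<^sub>F e in at_right 0. 0 < (e::real)"
    by (rule eventually_at_right_less)
  have "\<forall>\<^sub>F e in at_right 0. \<forall>k\<in>{..4}. \<bar>N k e\<bar> \<le> K * e ^ (3 - k)"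
  proof (intro eventually_ball_finite ballI)
    fix k :: nat assume k_mem: "k \<in> {..4}"
    have "((\<lambda>e. \<bar>N k e / e ^ (3 - k)\<bar>) \<longlongrightarrow> \<bar>l k\<bar>) (at_right 0)"
      unfolding l_def using N_div_power_tendsto[of k] k_mem
      by (intro tendsto_rabs) (auto intro: tendsto_within_subset)
    then have "\<forall>\<^sub>F e in at_right 0. \<bar>N k e / e ^ (3 - k)\<bar> < \<bar>l k\<bar> + 1"
      by (rule order_tendstoD) simp
    with e_pos show "\<forall>\<^sub>F e in at_right 0. \<bar>N k e\<bar> \<le> K * e ^ (3 - k)"
    proof eventually_elim
      case (elim e)
      then have "\<bar>N k e\<bar> < (\<bar>l k\<bar> + 1) * e ^ (3 - k)" by (simp add: abs_divide divide_less_eq)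
      also have "\<dots> \<le> K * e ^ (3 - k)" using limit_le_K k_mem elim by (intro mult_right_mono) auto
      finally show ?case by simp
    qed
  qed simp
  then show ?thesis by (intro that[of K]) (simp add: Ball_def)
qed

text \<open>The residual \<open>e1\<^sup>2 - ((cs\<^sup>2 - c\<^sup>2) e\<^sup>2 - N 0 e)\<close>, divided by \<open>1 - e\<close>, is the first integral of the equation.\<close>

lemma TW_second_equation_iff:
  assumes e_less: "e < 1" and first_equation: "c / 2 * e = v * (1 - e)"
  shows "c * v = f (1 - e) - v^2 - e2 / (2 * (1 - e)) - e1^2 / (4 * (1 - e)^2) \<longleftrightarrow>
    e2 = (cs^2 - c^2) * e - N 1 e / 2 - (e1^2 - ((cs^2 - c^2) * e^2 - N 0 e)) / (2 * (1 - e))"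
proof -
  define a where "a = 1 - e"
  define F where "F = Fpot f a"
  have a_nonzero: "a \<noteq> 0" and e_eq: "e = 1 - a" using e_less by (auto simp: a_def)
  have v_eq: "v = c / 2 * e / a" using first_equation a_nonzero by (simp add: a_def field_simps)
  have N_eq: "N 1 e = 2 * cs^2 * e + 4 * F - 4 * a * f a" "N 0 e = cs^2 * e^2 - 4 * a * F"
    by (simp_all add: N_def a_def F_def)
  have "c * v + v^2 = c^2 * (1 - a^2) / (4 * a^2)"
    unfolding v_eq e_eq using a_nonzero by (simp add: field_simps power2_eq_square)
  then have "c * v = f a - v^2 - e2 / (2 * a) - e1^2 / (4 * a^2) \<longleftrightarrow>
      c^2 * (1 - a^2) / (4 * a^2) = f a - e2 / (2 * a) - e1^2 / (4 * a^2)" by auto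
  also have "f a - e2 / (2 * a) - e1^2 / (4 * a^2) = (4 * a^2 * f a - 2 * a * e2 - e1^2) / (4 * a^2)"
    using a_nonzero by (simp add: diff_divide_distrib power2_eq_square)
  also have "c^2 * (1 - a^2) / (4 * a^2) = (4 * a^2 * f a - 2 * a * e2 - e1^2) / (4 * a^2) \<longleftrightarrow>
      c^2 * (1 - a^2) = 4 * a^2 * f a - 2 * a * e2 - e1^2"
    using a_nonzero by simp
  also have "\<dots> \<longleftrightarrow> 2 * a * e2 = 2 * a * ((cs^2 - c^2) * e) - a * N 1 e - (e1^2 - ((cs^2 - c^2) * e^2 - N 0 e))"
    unfolding N_eq unfolding e_eq by (auto simp: algebra_simps power2_eq_square)
  also have "\<dots> \<longleftrightarrow> e2 = (cs^2 - c^2) * e - N 1 e / 2 - (e1^2 - ((cs^2 - c^2) * e^2 - N 0 e)) / (2 * a)"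
    using a_nonzero by (auto simp: field_simps)
  finally show ?thesis by (simp only: a_def)
qed

end

locale small_amplitude = pressure_law +
  fixes \<delta> K :: real
  assumes \<delta>_pos: "0 < \<delta>" and \<delta>_less_1: "\<delta> < 1"
    and \<Delta>_ge: "e \<in> {0<..\<delta>} \<Longrightarrow> cs^2 / 2 * e^3 \<le> \<Delta> e"
    and N_ge: "e \<in> {0<..\<delta>} \<Longrightarrow> cs^2 / 2 * e^3 \<le> N 0 e"
    and N_bound: "e \<in> {0<..\<delta>} \<Longrightarrow> k \<le> 4 \<Longrightarrow> \<bar>N k e\<bar> \<le> K * e ^ (3 - k)"
    and \<kappa>_bounds: "e \<in> {0<..\<delta>} \<Longrightarrow> 7/8 \<le> \<kappa> e \<and> \<kappa> e \<le> 2 \<and> \<bar>e * \<kappa>' e\<bar> \<le> 1/32"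

lemma (in pressure_law) ex_small_amplitude: "\<exists>\<delta> K. small_amplitude f f1 f2 f3 cs \<delta> K"
proof -
  obtain K where "\<forall>\<^sub>F e in at_right 0. \<forall>k\<le>4. \<bar>N k e\<bar> \<le> K * e ^ (3 - k)"
    by (rule N_eventually_bounded)
  moreover have "\<forall>\<^sub>F e in at_right 0. cs^2 / 2 < \<Delta> e / e^3" "\<forall>\<^sub>F e in at_right 0. cs^2 / 2 < N 0 e / e^3"
    using cs_pos order_tendstoD(1)[OF \<Delta>_tendsto, of "cs^2 / 2"]
      order_tendstoD(1)[OF N_012_tendsto(1), of "cs^2 / 2"] by auto
  moreover have "\<forall>\<^sub>F e in at_right 0. 7/8 < \<kappa> e" "\<forall>\<^sub>F e in at_right 0. \<kappa> e < 2"
    using order_tendstoD(1)[OF \<kappa>_tendsto, of "7/8"] order_tendstoD(2)[OF \<kappa>_tendsto, of 2] by simp_all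
  moreover have "\<forall>\<^sub>F e in at_right 0. \<bar>e * \<kappa>' e\<bar> < 1/32"
    using order_tendstoD(2)[OF tendsto_rabs[OF \<kappa>'_tendsto], of "1/32"] by simp
  ultimately have "\<forall>\<^sub>F e in at_right 0. cs^2 / 2 < \<Delta> e / e^3 \<and> cs^2 / 2 < N 0 e / e^3 \<and>
      (\<forall>k\<le>4. \<bar>N k e\<bar> \<le> K * e ^ (3 - k)) \<and> 7/8 < \<kappa> e \<and> \<kappa> e < 2 \<and> \<bar>e * \<kappa>' e\<bar> < 1/32"
    by eventually_elim blast
  then obtain b where near_0: "0 < b" "\<And>e. 0 < e \<Longrightarrow> e < b \<Longrightarrow> cs^2 / 2 < \<Delta> e / e^3 \<and> cs^2 / 2 < N 0 e / e^3 \<and>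
      (\<forall>k\<le>4. \<bar>N k e\<bar> \<le> K * e ^ (3 - k)) \<and> 7/8 < \<kappa> e \<and> \<kappa> e < 2 \<and> \<bar>e * \<kappa>' e\<bar> < 1/32"
    unfolding eventually_at_right_field by blast
  define \<delta> where "\<delta> = min (b / 2) (1/2)"
  have "small_amplitude f f1 f2 f3 cs \<delta> K"
  proof unfold_locales
    show "0 < \<delta>" "\<delta> < 1" using near_0(1) by (auto simp: \<delta>_def)
    fix e assume "e \<in> {0<..\<delta>}"
    then have e_small: "0 < e" "e < b" using near_0(1) by (auto simp: \<delta>_def)
    show "cs^2 / 2 * e^3 \<le> \<Delta> e" "cs^2 / 2 * e^3 \<le> N 0 e"
      using near_0(2)[OF e_small] e_small by (auto simp: less_divide_eq)
    show "\<bar>N k e\<bar> \<le> K * e ^ (3 - k)" if "k \<le> 4" for k using near_0(2)[OF e_small] that by blast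
    show "7/8 \<le> \<kappa> e \<and> \<kappa> e \<le> 2 \<and> \<bar>e * \<kappa>' e\<bar> \<le> 1/32" using near_0(2)[OF e_small] by auto
  qed
  then show ?thesis by blast
qed

context small_amplitude
begin

lemma \<Delta>_pos: "e \<in> {0<..\<delta>} \<Longrightarrow> 0 < \<Delta> e"
  using \<Delta>_ge[of e] cs_pos by (auto intro!: less_le_trans[of 0 "cs^2 / 2 * e^3" "\<Delta> e"])

lemma N_pos: "e \<in> {0<..\<delta>} \<Longrightarrow> 0 < N 0 e"
  using N_ge[of e] cs_pos by (auto intro!: less_le_trans[of 0 "cs^2 / 2 * e^3" "N 0 e"])

lemma K_nonneg: "0 \<le> K"
  using N_bound[of \<delta> 3] \<delta>_pos by simp

definition \<omega> :: "real \<Rightarrow> real" where "\<omega> e = N 0 e / e^2"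
definition w :: real where "w = \<omega> \<delta>"
definition h :: "real \<Rightarrow> real" where "h y = (THE e. e \<in> {0<..<\<delta>} \<and> \<omega> e = y)"
definition q :: "real \<Rightarrow> real" where "q y = \<kappa> (h y)"
definition q' :: "real \<Rightarrow> real" where "q' y = \<kappa>' (h y) * (h y * q y / y)"

lemma \<omega>_DERIV:
  assumes "e \<in> {0<..\<delta>}"
  shows "(\<omega> has_real_derivative \<Delta> e / e^3) (at e)"
proof -
  have e_bounds: "e \<noteq> 0" "e < 1" using assms \<delta>_less_1 by auto
  have "((\<lambda>e. N 0 e / e^2) has_real_derivative (N 1 e * e^2 - N 0 e * (2 * e)) / (e^2 * e^2)) (at e)"
    using N_DERIV[of e 0] by (intro DERIV_divide) (use e_bounds in \<open>auto intro!: derivative_eq_intros\<close>)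
  moreover have "(N 1 e * e^2 - N 0 e * (2 * e)) / (e^2 * e^2) = \<Delta> e / e^3"
    using e_bounds by (simp add: \<Delta>_def field_simps power2_eq_square power3_eq_cube)
  ultimately show ?thesis unfolding \<omega>_def[abs_def] by simp
qed

lemma \<omega>_continuous: "continuous_on {0<..\<delta>} \<omega>"
  using \<omega>_DERIV DERIV_isCont by (blast intro: continuous_at_imp_continuous_on)

lemma \<omega>_less:
  assumes "0 < e" "e < e'" "e' \<le> \<delta>"
  shows "\<omega> e < \<omega> e'"
proof (rule DERIV_pos_imp_increasing[OF assms(2)])
  fix x assume "e \<le> x" "x \<le> e'"
  then have "x \<in> {0<..\<delta>}" using assms by auto
  then show "\<exists>y. (\<omega> has_real_derivative y) (at x) \<and> 0 < y"
    using \<omega>_DERIV \<Delta>_pos[of x] by (intro exI[of _ "\<Delta> x / x^3"]) auto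
qed

lemma \<omega>_bounds:
  assumes "e \<in> {0<..\<delta>}"
  shows "cs^2 / 2 * e \<le> \<omega> e" "\<omega> e \<le> K * e"
  using N_ge[OF assms] abs_le_D1[OF N_bound[OF assms, of 0]] assms
  by (auto simp: \<omega>_def field_simps power2_eq_square power3_eq_cube)

lemma w_pos: "0 < w"
  using N_pos[of \<delta>] \<delta>_pos by (simp add: w_def \<omega>_def)

lemma \<omega>_bij:
  assumes y_mem: "y \<in> {0<..<w}"
  shows "\<exists>!e. e \<in> {0<..<\<delta>} \<and> \<omega> e = y"
proof -
  define e0 where "e0 = min (\<delta> / 2) (y / (2 * (K + 1)))"
  have e0_mem: "0 < e0" "e0 < \<delta>" using \<delta>_pos y_mem K_nonneg by (auto simp: e0_def)
  have "K * e0 \<le> (K + 1) * e0" using e0_mem by (simp add: algebra_simps)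
  also have "\<dots> \<le> (K + 1) * (y / (2 * (K + 1)))"
    using K_nonneg by (intro mult_left_mono) (auto simp: e0_def)
  also have "\<dots> = y / 2" using K_nonneg by (simp add: field_simps)
  finally have "\<omega> e0 \<le> y" using \<omega>_bounds(2)[of e0] e0_mem y_mem by auto
  moreover have "y \<le> \<omega> \<delta>" using y_mem by (auto simp: w_def)
  moreover have "continuous_on {e0..\<delta>} \<omega>"
    using e0_mem by (intro continuous_on_subset[OF \<omega>_continuous]) auto
  ultimately obtain e where e_props: "e0 \<le> e" "e \<le> \<delta>" "\<omega> e = y"
    using IVT'[of \<omega> e0 y \<delta>] e0_mem by auto
  moreover have "e \<noteq> \<delta>" using e_props(3) y_mem by (auto simp: w_def)
  ultimately have "e \<in> {0<..<\<delta>} \<and> \<omega> e = y" using e0_mem by auto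
  moreover have "e' = e" if "e' \<in> {0<..<\<delta>} \<and> \<omega> e' = y" for e'
    using \<omega>_less[of e e'] \<omega>_less[of e' e] that e_props e0_mem by (cases e e' rule: linorder_cases) auto
  ultimately show ?thesis by blast
qed

lemma h_mem: "y \<in> {0<..<w} \<Longrightarrow> h y \<in> {0<..<\<delta>}" and \<omega>_h: "y \<in> {0<..<w} \<Longrightarrow> \<omega> (h y) = y"
  unfolding h_def using theI'[OF \<omega>_bij] by blast+

lemma \<omega>_mem: "e \<in> {0<..<\<delta>} \<Longrightarrow> \<omega> e \<in> {0<..<w}"
  using \<omega>_less[of e \<delta>] N_pos[of e] by (auto simp: w_def \<omega>_def)

lemma h_\<omega>: "e \<in> {0<..<\<delta>} \<Longrightarrow> h (\<omega> e) = e"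
  unfolding h_def using \<omega>_bij[OF \<omega>_mem] by blast

lemma h_mem_closed: "y \<in> {0<..<w} \<Longrightarrow> h y \<in> {0<..\<delta>}"
  using h_mem by force

lemma h_le: "y \<in> {0<..<w} \<Longrightarrow> h y \<le> 2 / cs^2 * y"
  using \<omega>_bounds(1)[OF h_mem_closed] \<omega>_h cs_pos by (simp add: field_simps)

lemma N_h:
  assumes "y \<in> {0<..<w}"
  shows "N 0 (h y) = y * (h y)^2"
  using \<omega>_h[OF assms] h_mem[OF assms] by (simp add: \<omega>_def field_simps)

lemma h_DERIV:
  assumes y_mem: "y \<in> {0<..<w}"
  shows "(h has_real_derivative h y * q y / y) (at y)"
proof -
  have h_y: "h y \<in> {0<..\<delta>}" "h y \<noteq> 0" using h_mem_closed[OF y_mem] by auto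
  have \<Delta>_nonzero: "\<Delta> (h y) \<noteq> 0" using \<Delta>_pos[OF h_y(1)] by simp
  have "(h has_real_derivative inverse (\<Delta> (h y) / (h y)^3)) (at y)"
    unfolding has_field_derivative_def
  proof (rule has_derivative_inverse_strong_x[where S = "{0<..<\<delta>}"])
    show "(\<omega> has_derivative (*) (\<Delta> (h y) / (h y)^3)) (at (h y))"
      using \<omega>_DERIV[OF h_y(1)] by (simp add: has_field_derivative_def)
    show "(*) (\<Delta> (h y) / (h y)^3) \<circ> (*) (inverse (\<Delta> (h y) / (h y)^3)) = id"
      using \<Delta>_nonzero h_y by (auto simp: fun_eq_iff)
    show "continuous_on {0<..<\<delta>} \<omega>"
      by (rule continuous_on_subset[OF \<omega>_continuous]) auto
  qed (use h_mem[OF y_mem] \<omega>_h[OF y_mem] h_\<omega> in auto)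
  moreover have "inverse (\<Delta> (h y) / (h y)^3) = h y * q y / y"
    unfolding q_def \<kappa>_def N_h[OF y_mem] using y_mem h_y \<Delta>_nonzero
    by (simp add: field_simps power2_eq_square power3_eq_cube)
  ultimately show ?thesis by simp
qed

lemma N_1_h:
  assumes "y \<in> {0<..<w}"
  shows "N 1 (h y) = y * h y * (2 + 1 / q y)"
proof -
  have h_y: "h y \<in> {0<..\<delta>}" "h y \<noteq> 0" using h_mem_closed[OF assms] by auto
  have "N 0 (h y) \<noteq> 0" "\<Delta> (h y) \<noteq> 0" using N_pos[OF h_y(1)] \<Delta>_pos[OF h_y(1)] by auto
  then have "N 0 (h y) * (2 + 1 / q y) = h y * N 1 (h y)"
    by (simp add: q_def \<kappa>_def \<Delta>_def field_simps)
  then show ?thesis unfolding N_h[OF assms] using h_y(2) by (simp add: power2_eq_square)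
qed

lemma \<kappa>_DERIV:
  assumes "e \<in> {0<..<\<delta>}"
  shows "(\<kappa> has_real_derivative \<kappa>' e) (at e)"
proof -
  have N_derivs: "(N 0 has_real_derivative N 1 e) (at e)" "(N 1 has_real_derivative N 2 e) (at e)"
    using N_DERIV[of e 0] N_DERIV[of e 1] assms \<delta>_less_1 by (auto simp: numeral_2_eq_2)
  have "(\<Delta> has_real_derivative e * N 2 e - N 1 e) (at e)"
    unfolding \<Delta>_def[abs_def] using N_derivs by (auto intro!: derivative_eq_intros)
  moreover have "\<Delta> e \<noteq> 0" using \<Delta>_pos[of e] assms by auto
  ultimately show ?thesis unfolding \<kappa>_def[abs_def] \<kappa>'_def by (intro DERIV_divide N_derivs(1))
qed

lemma q_DERIV:
  assumes "y \<in> {0<..<w}"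
  shows "(q has_real_derivative q' y) (at y)"
proof -
  have "((\<lambda>y. \<kappa> (h y)) has_real_derivative \<kappa>' (h y) * (h y * q y / y)) (at y)"
    by (rule DERIV_chain2[where f = \<kappa>, OF \<kappa>_DERIV[OF h_mem[OF assms]] h_DERIV[OF assms]])
  then show ?thesis by (simp only: q_def[abs_def] q'_def)
qed

lemma q_estimates:
  assumes "y \<in> {0<..<w}"
  shows "7/8 \<le> q y" "q y \<le> 2" "\<bar>y * q' y\<bar> \<le> 1/16"
proof -
  note \<kappa>_h_y = \<kappa>_bounds[OF h_mem_closed[OF assms]]
  show q_y_bounds: "7/8 \<le> q y" "q y \<le> 2" using \<kappa>_h_y by (auto simp: q_def)
  have "y * q' y = h y * \<kappa>' (h y) * q y" using assms by (simp add: q'_def)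
  then have "\<bar>y * q' y\<bar> = \<bar>h y * \<kappa>' (h y)\<bar> * q y" using q_y_bounds by (simp add: abs_mult)
  also have "\<dots> \<le> 1/32 * 2" using \<kappa>_h_y q_y_bounds by (intro mult_mono) auto
  finally show "\<bar>y * q' y\<bar> \<le> 1/16" by simp
qed

sublocale E: symbol_calculus "{0<..<\<delta>}" "\<lambda>e. e" "\<lambda>_ _. 1" by (rule euler_symbol_calculus) simp
sublocale Y: symbol_calculus "{0<..<w}" "\<lambda>y. y" "\<lambda>_ _. 1" by (rule euler_symbol_calculus) simp

lemma N_euler_symbol:
  assumes "k + n \<le> 4"
  shows "euler_symbol {0<..<\<delta>} n (\<lambda>e. e ^ (3 - k)) (N k)"
proof -
  have e_bounds: "e < 1" "e \<in> {0<..\<delta>}" "0 < e" if "e \<in> {0<..<\<delta>}" for e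
    using that \<delta>_less_1 by auto
  have "euler_symbol {0<..<\<delta>} n (\<lambda>e. e ^ (3 - k)) ((\<lambda>i. N (k + i)) 0)"
  proof (rule euler_symbol_if_scaled_derivs_bounded)
    show "(N (k + i) has_real_derivative N (k + Suc i) e) (at e)" if "i < n" "e \<in> {0<..<\<delta>}" for i e
      using N_DERIV[of e "k + i"] e_bounds[OF that(2)] that(1) assms by simp
    show "\<bar>e ^ i * N (k + i) e\<bar> \<le> K * e ^ (3 - k)" if "i \<le> n" "e \<in> {0<..<\<delta>}" for i e
    proof -
      note e_in = e_bounds[OF that(2)]
      have "\<bar>e ^ i * N (k + i) e\<bar> \<le> e ^ i * (K * e ^ (3 - (k + i)))"
        using N_bound[OF e_in(2), of "k + i"] that assms e_in by (simp add: abs_mult mult_left_mono)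
      also have "\<dots> = K * e ^ (i + (3 - (k + i)))" by (simp add: power_add)
      also have "\<dots> \<le> K * e ^ (3 - k)"
        using K_nonneg e_in by (intro mult_left_mono power_decreasing) auto
      finally show ?thesis .
    qed
    show "continuous_on {0<..<\<delta>} (N (k + n))"
      using \<delta>_less_1 by (intro continuous_on_subset[OF N_continuous[OF assms]]) auto
  qed auto
  then show ?thesis by simp
qed

lemma \<kappa>_euler_symbol: "euler_symbol {0<..<\<delta>} 2 (\<lambda>_. 1) \<kappa>"
proof -
  have e_bounds: "e \<in> {0<..\<delta>}" "0 < e" if "e \<in> {0<..<\<delta>}" for e using that by auto
  have N_symbol: "euler_symbol {0<..<\<delta>} 2 (\<lambda>e. e^3) (N 0)"
    using N_euler_symbol[of 0 2] by simp
  have "euler_symbol {0<..<\<delta>} 2 (\<lambda>e. e^3) (\<lambda>e. e * N 1 e)"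
  proof (rule euler_symbol_deriv)
    show "euler_symbol {0<..<\<delta>} (Suc 2) (\<lambda>e. e^3) (N 0)" using N_euler_symbol[of 0 "Suc 2"] by simp
    show "(N 0 has_real_derivative N 1 e) (at e)" if "e \<in> {0<..<\<delta>}" for e
      using N_DERIV[of e 0] that \<delta>_less_1 by simp
  qed simp
  then have \<Delta>_symbol: "euler_symbol {0<..<\<delta>} 2 (\<lambda>e. e^3) \<Delta>"
    unfolding \<Delta>_def[abs_def] by (intro E.S_diff E.S_cmult N_symbol)
  have "euler_symbol {0<..<\<delta>} 2 (\<lambda>e. 1 / e^3) (\<lambda>e. 1 / \<Delta> e)"
  proof (rule E.S_inverse[OF \<Delta>_symbol, of "2 / cs^2" _ 1])
    fix e assume e_mem: "e \<in> {0<..<\<delta>}"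
    have "1 / \<Delta> e \<le> 1 / (cs^2 / 2 * e^3)"
      using \<Delta>_ge[OF e_bounds(1)[OF e_mem]] cs_pos e_bounds(2)[OF e_mem] by (intro frac_le) auto
    then show "\<bar>1 / \<Delta> e\<bar> \<le> 2 / cs^2 * (1 / e^3)" using \<Delta>_pos[OF e_bounds(1)[OF e_mem]] by simp
    show "\<Delta> e \<noteq> 0" using \<Delta>_pos[OF e_bounds(1)[OF e_mem]] by simp
  qed auto
  from E.S_mult_weaken[OF N_symbol this, of 1 "\<lambda>_ _. 1"]
  show ?thesis by (simp add: \<kappa>_def[abs_def])
qed

lemma q_euler_symbol_if_h:
  assumes "euler_symbol {0<..<w} n h h" "n \<le> 2"
  shows "euler_symbol {0<..<w} n (\<lambda>_. 1) q"
  unfolding q_def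
  by (rule Y.S_compose[OF _ _ assms(1) h_mem E.S_antimono[OF \<kappa>_euler_symbol assms(2)]]) auto

lemma h_euler_symbol: "euler_symbol {0<..<w} 2 h h"
proof (rule Y.S_bootstrap[where u' = "\<lambda>y _. h y * q y / y"])
  have h_cont: "continuous_on {0<..<w} h"
    using h_DERIV DERIV_isCont by (blast intro: continuous_at_imp_continuous_on)
  show "euler_symbol {0<..<w} 0 h h"
    by (rule Y.S_0I_no_growth[of _ 1]) (use h_mem h_cont in \<open>auto simp: less_imp_le\<close>)
  fix n :: nat assume "n < 2" "euler_symbol {0<..<w} n h h"
  then have "euler_symbol {0<..<w} n h (\<lambda>y. q y * h y)"
    by (intro Y.S_mult_bounded q_euler_symbol_if_h) auto
  then show "euler_symbol {0<..<w} n h (\<lambda>y. y * (h y * q y / y))"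
    by (rule Y.S_cong) auto
qed (rule h_DERIV)

lemma q_euler_symbol: "euler_symbol {0<..<w} 2 (\<lambda>_. 1) q"
  by (rule q_euler_symbol_if_h[OF h_euler_symbol]) simp

lemma \<theta>q_euler_symbol: "euler_symbol {0<..<w} 1 (\<lambda>_. 1) (\<lambda>y. y * q' y)"
  by (rule euler_symbol_deriv) (use q_euler_symbol q_DERIV in \<open>auto simp: numeral_2_eq_2\<close>)

sublocale phase w q q'
proof
  show "continuous_on {0<..<w} (\<lambda>y. y * q' y)"
    by (rule Y.S_continuous(1)[OF \<theta>q_euler_symbol])
  show "1/2 \<le> q y \<and> q y \<le> 2" if "y \<in> {0<..<w}" for y using q_estimates[OF that] by auto
qed (rule q_DERIV)

end

section \<open>The solitary waves\<close>

locale solitary_waves = small_amplitude +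
  fixes c0 :: real
  assumes c0_pos: "0 < c0" and c0_less: "c0 < cs"
    and gap_c0_le: "cs^2 - c0^2 \<le> w" and cs_sq_le: "cs^2 \<le> 3 * c0^2"

lemma (in pressure_law) ex_solitary_waves: "\<exists>\<delta> K c0. solitary_waves f f1 f2 f3 cs \<delta> K c0"
proof -
  obtain \<delta> K where "small_amplitude f f1 f2 f3 cs \<delta> K" using ex_small_amplitude by blast
  then interpret small_amplitude f f1 f2 f3 cs \<delta> K .
  define t where "t = min w (cs^2 / 2)"
  define c0 where "c0 = sqrt (cs^2 - t)"
  have t_bounds: "0 < t" "t \<le> w" "t \<le> cs^2 / 2" using w_pos cs_pos by (auto simp: t_def)
  have c0_sq: "c0^2 = cs^2 - t" using t_bounds cs_pos by (simp add: c0_def)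
  have "solitary_waves f f1 f2 f3 cs \<delta> K c0"
  proof unfold_locales
    have "0 < cs^2 - t" using t_bounds cs_pos by simp
    then show "0 < c0" by (simp add: c0_def)
    have "c0^2 < cs^2" using c0_sq t_bounds by simp
    then show "c0 < cs" using cs_pos by (simp add: power2_less_imp_less)
    show "cs^2 - c0^2 \<le> w" "cs^2 \<le> 3 * c0^2" unfolding c0_sq using t_bounds by auto
  qed
  then show ?thesis by blast
qed

context solitary_waves
begin

definition speeds :: "real set" where "speeds = {c0<..<cs}"
definition \<mu> :: "real \<Rightarrow> real" where "\<mu> c = cs^2 - c^2"
definition growth :: "real \<Rightarrow> real \<Rightarrow> real" where "growth c x = 1 + sqrt (\<mu> c) * \<bar>x\<bar>"
definition \<sigma> :: "real \<Rightarrow> real \<Rightarrow> real" where "\<sigma> c x = phi (\<mu> c) (sqrt (\<mu> c) * x / 2)"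
definition level :: "real \<Rightarrow> real \<Rightarrow> real" where "level c x = \<mu> c * sech_square (\<sigma> c x)"
definition eta :: "real \<Rightarrow> real \<Rightarrow> real" where "eta c x = h (level c x)"

lemma c_pos: "c \<in> speeds \<Longrightarrow> 0 < c" and c_less: "c \<in> speeds \<Longrightarrow> c < cs"
  using c0_pos by (auto simp: speeds_def)

lemma \<mu>_mem:
  assumes "c \<in> speeds"
  shows "\<mu> c \<in> {0<..<w}"
proof -
  have "c0^2 < c^2" "c^2 < cs^2"
    using assms c0_pos by (auto simp: speeds_def intro!: power_strict_mono)
  then show ?thesis using gap_c0_le by (auto simp: \<mu>_def)
qed

lemma \<mu>_pos: "c \<in> speeds \<Longrightarrow> 0 < \<mu> c"
  using \<mu>_mem by auto

lemma \<mu>_continuous: "continuous_on A \<mu>"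
  unfolding \<mu>_def by (intro continuous_intros)

lemma level_mem: "c \<in> speeds \<Longrightarrow> level c x \<in> {0<..<w}"
  unfolding level_def by (rule mult_sech_square_mem[OF \<mu>_mem])

sublocale symbol_calculus speeds \<mu> growth
proof
  show "1 \<le> growth c x" if "c \<in> speeds" for c x
    using \<mu>_pos[OF that] by (simp add: growth_def)
qed (simp add: speeds_def)

lemma S_c: "S n (\<lambda>_ _. 1) (\<lambda>c _. c)"
proof (rule S_bootstrap[where u' = "\<lambda>_ _. 1"])
  show "S 0 (\<lambda>_ _. 1) (\<lambda>c _. c)"
    by (rule S_0I_no_growth[where K = cs])
      (use c_pos c_less in \<open>auto intro!: continuous_intros simp: abs_of_pos less_imp_le\<close>)
  show "S k (\<lambda>_ _. 1) (\<lambda>c x. \<mu> c * 1)" if "S k (\<lambda>_ _. 1) (\<lambda>c _. c)" for k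
    using S_diff[OF S_const[of k "cs^2"] S_mult_bounded[OF that that]]
    by (rule S_cong) (simp add: \<mu>_def power2_eq_square)
qed auto

lemma S_\<mu>_bounded: "S n (\<lambda>_ _. 1) (\<lambda>c _. \<mu> c)"
  using S_diff[OF S_const[of n "cs^2"] S_mult_bounded[OF S_c S_c]]
  by (rule S_cong) (simp add: \<mu>_def power2_eq_square)

sublocale smooth_symbol_calculus speeds \<mu> growth "\<lambda>c. - 2 * c"
proof
  show "S n (\<lambda>_ _. 1) (\<lambda>c _. - 2 * c)" for n by (intro S_cmult S_c)
  show "(\<mu> has_real_derivative - 2 * c) (at c)" for c
    unfolding \<mu>_def by (auto intro!: derivative_eq_intros)
  show "\<mu> c \<noteq> 0" if "c \<in> speeds" for c using \<mu>_pos[OF that] by simp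
qed

lemma S_\<mu>: "S n (\<lambda>c _. \<mu> c) (\<lambda>c _. \<mu> c)"
proof (rule S_bootstrap[where u' = "\<lambda>c _. - 2 * c"])
  show "S 0 (\<lambda>c _. \<mu> c) (\<lambda>c _. \<mu> c)"
    by (rule S_0I_no_growth[where K = 1])
      (use \<mu>_pos \<mu>_continuous in \<open>auto simp: less_imp_le abs_of_pos\<close>)
  show "S k (\<lambda>c _. \<mu> c) (\<lambda>c x. \<mu> c * (- 2 * c))" if "S k (\<lambda>c _. \<mu> c) (\<lambda>c _. \<mu> c)" for k
    using S_mult_bounded[OF S_\<mu>' that] by (rule S_cong) (simp add: mult.commute)
qed (rule \<mu>_DERIV)

lemma sqrt_\<mu>_DERIV:
  assumes c_mem: "c \<in> speeds"
  shows "((\<lambda>c. sqrt (\<mu> c)) has_real_derivative - c / sqrt (\<mu> c)) (at c)"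
  by (rule DERIV_cong[OF DERIV_chain2[OF DERIV_real_sqrt[OF \<mu>_pos[OF c_mem]] \<mu>_DERIV[OF c_mem]]])
    (simp add: inverse_eq_divide)

lemma \<mu>_times_div_sqrt: "c \<in> speeds \<Longrightarrow> \<mu> c * (a / sqrt (\<mu> c)) = a * sqrt (\<mu> c)"
  using real_div_sqrt[of "\<mu> c"] \<mu>_pos[of c] by (simp add: less_imp_le field_simps)

lemma S_sqrt_\<mu>: "S n (\<lambda>_ _. 1) (\<lambda>c _. sqrt (\<mu> c))"
proof (rule S_bootstrap[where u' = "\<lambda>c _. - c / sqrt (\<mu> c)"])
  show "S 0 (\<lambda>_ _. 1) (\<lambda>c _. sqrt (\<mu> c))"
    by (rule S_0I_no_growth[where K = "sqrt w"])
      (use \<mu>_mem w_pos \<mu>_continuous in \<open>auto simp: less_imp_le intro!: continuous_intros\<close>)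
  show "S k (\<lambda>_ _. 1) (\<lambda>c x. \<mu> c * (- c / sqrt (\<mu> c)))" if "S k (\<lambda>_ _. 1) (\<lambda>c _. sqrt (\<mu> c))" for k
    using S_mult_bounded[OF S_cmult[OF S_c, of _ "-1"] that]
    by (rule S_cong) (simp only: \<mu>_times_div_sqrt mult_minus1)
qed (rule sqrt_\<mu>_DERIV)

lemma S_sqrt_\<mu>_x: "S n (\<lambda>_ _. 1) (\<lambda>c x. sqrt (\<mu> c) * x)"
proof (rule S_bootstrap[where u' = "\<lambda>c x. - c / sqrt (\<mu> c) * x"])
  show "S 0 (\<lambda>_ _. 1) (\<lambda>c x. sqrt (\<mu> c) * x)"
  proof (rule S_0I[where K = 1 and N = 1])
    show "\<bar>sqrt (\<mu> c) * x\<bar> \<le> 1 * growth c x ^ 1 * 1" if "c \<in> speeds" for c x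
      using \<mu>_pos[OF that] by (simp add: growth_def abs_mult)
  qed (use \<mu>_continuous in \<open>auto intro!: continuous_intros\<close>)
  show "S k (\<lambda>_ _. 1) (\<lambda>c x. \<mu> c * (- c / sqrt (\<mu> c) * x))"
    if "S k (\<lambda>_ _. 1) (\<lambda>c x. sqrt (\<mu> c) * x)" for k
    using S_mult_bounded[OF S_cmult[OF S_c, of _ "-1"] that]
    by (rule S_cong) (simp only: mult.assoc[symmetric] \<mu>_times_div_sqrt mult_minus1)
qed (rule DERIV_cmult_right[OF sqrt_\<mu>_DERIV])

lemma \<sigma>_DERIV_x:
  assumes c_mem: "c \<in> speeds"
  shows "(\<sigma> c has_real_derivative sqrt (\<mu> c) / 2 / q (level c x)) (at x)"
proof -
  have "((\<lambda>x. phi (\<mu> c) (sqrt (\<mu> c) * x / 2)) has_real_derivative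
      (sqrt (\<mu> c) / 2 - sech_integral (\<lambda>z. z * q' z) (\<sigma> c x) (\<mu> c) / \<mu> c * 0) / q (level c x)) (at x)"
    unfolding \<sigma>_def level_def
    by (rule phi_chain[where \<mu> = "\<lambda>_. \<mu> c" and y = "\<lambda>x. sqrt (\<mu> c) * x / 2"])
      (use \<mu>_mem[OF c_mem] in \<open>auto intro!: derivative_eq_intros\<close>)
  then show ?thesis by (simp add: \<sigma>_def[abs_def])
qed

definition d\<sigma>_dc :: "real \<Rightarrow> real \<Rightarrow> real" where
  "d\<sigma>_dc c x = (- c / sqrt (\<mu> c) * x / 2 -
     sech_integral (\<lambda>z. z * q' z) (\<sigma> c x) (\<mu> c) / \<mu> c * (- 2 * c)) / q (level c x)"

lemma \<sigma>_DERIV_c: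
  assumes c_mem: "c \<in> speeds"
  shows "((\<lambda>c. \<sigma> c x) has_real_derivative d\<sigma>_dc c x) (at c)"
  unfolding \<sigma>_def d\<sigma>_dc_def level_def
  by (rule phi_chain[where y = "\<lambda>c. sqrt (\<mu> c) * x / 2"])
    (intro \<mu>_mem \<mu>_DERIV DERIV_cdivide DERIV_cmult_right sqrt_\<mu>_DERIV c_mem)+

lemma \<sigma>_bounds:
  assumes "c \<in> speeds"
  shows "\<bar>\<sigma> c x\<bar> \<le> sqrt (\<mu> c) * \<bar>x\<bar>" "sqrt (\<mu> c) * \<bar>x\<bar> \<le> 4 * \<bar>\<sigma> c x\<bar>"
  using phi_bounds[OF \<mu>_mem[OF assms], of "sqrt (\<mu> c) * x / 2"] \<mu>_pos[OF assms]
  by (auto simp: \<sigma>_def abs_mult)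

lemma \<sigma>_minus: "c \<in> speeds \<Longrightarrow> \<sigma> c (- x) = - \<sigma> c x"
  using phi_minus[OF \<mu>_mem, of c "sqrt (\<mu> c) * x / 2"] by (simp add: \<sigma>_def)

lemma S_0_\<sigma>: "S 0 (\<lambda>_ _. 1) \<sigma>"
proof (rule S_0I[where K = 1 and N = 1])
  show "\<bar>\<sigma> c x\<bar> \<le> 1 * growth c x ^ 1 * 1" if "c \<in> speeds" for c x
    using \<sigma>_bounds(1)[OF that, of x] by (simp add: growth_def)
  show "continuous_on speeds (\<lambda>c. \<sigma> c x)" for x
    using \<sigma>_DERIV_c DERIV_isCont by (blast intro: continuous_at_imp_continuous_on)
  show "continuous_on UNIV (\<sigma> c)" if "c \<in> speeds" for c
    using \<sigma>_DERIV_x[OF that] DERIV_isCont by (blast intro: continuous_at_imp_continuous_on)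
qed simp

lemma S_level:
  assumes "S n (\<lambda>_ _. 1) \<sigma>"
  shows "S n level level"
  using S_mult[OF S_\<mu> S_sech_square[OF assms]] by (simp add: level_def[abs_def])

lemma S_compose_level:
  assumes "S n (\<lambda>_ _. 1) \<sigma>" "euler_symbol {0<..<w} n B k"
  shows "S n (\<lambda>c x. B (level c x)) (\<lambda>c x. k (level c x))"
  by (rule S_compose[OF _ _ S_level[OF assms(1)] level_mem assms(2)]) auto

lemma S_0_sech_integral:
  assumes k_symbol: "euler_symbol {0<..<w} n (\<lambda>_. 1) k"
  shows "S 0 (\<lambda>_ _. 1) (\<lambda>c x. sech_integral k (\<sigma> c x) (\<mu> c))"
proof -
  obtain M where k_bound: "0 \<le> M" "\<And>y. y \<in> {0<..<w} \<Longrightarrow> \<bar>k y\<bar> \<le> M"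
    using Y.S_boundE[OF k_symbol] by auto
  have k_cont: "continuous_on {0<..<w} k" by (rule Y.S_continuous(1)[OF k_symbol])
  show ?thesis
  proof (rule S_0I[where K = M and N = 1])
    fix c x assume c_mem: "c \<in> speeds"
    have "- M \<le> k y \<and> k y \<le> M" if "y \<in> {0<..<w}" for y using k_bound(2)[OF that] by auto
    from sech_integral_average_bounds[OF k_cont \<mu>_mem[OF c_mem] this]
    obtain a where "sech_integral k (\<sigma> c x) (\<mu> c) = \<sigma> c x * a" "- M \<le> a" "a \<le> M" by metis
    then have "\<bar>sech_integral k (\<sigma> c x) (\<mu> c)\<bar> \<le> growth c x * M"
      using \<sigma>_bounds(1)[OF c_mem, of x] L_ge_1[OF c_mem, of x]
      by (auto simp: abs_mult growth_def intro!: mult_mono)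
    then show "\<bar>sech_integral k (\<sigma> c x) (\<mu> c)\<bar> \<le> M * growth c x ^ 1 * 1" by (simp add: mult.commute)
  next
    show "continuous_on speeds (\<lambda>c. sech_integral k (\<sigma> c x) (\<mu> c))" for x
      using \<mu>_mem by (intro continuous_on_sech_integral[OF k_cont] S_continuous[OF S_0_\<sigma>] \<mu>_continuous) auto
    show "continuous_on UNIV (\<lambda>x. sech_integral k (\<sigma> c x) (\<mu> c))" if "c \<in> speeds" for c
      using \<mu>_mem[OF that]
      by (intro continuous_on_sech_integral[OF k_cont] S_continuous[OF S_0_\<sigma>] that continuous_on_const) auto
  qed simp
qed

lemma S_sech_integral:
  assumes "S n (\<lambda>_ _. 1) \<sigma>" "euler_symbol {0<..<w} n (\<lambda>_. 1) k"
  shows "S n (\<lambda>_ _. 1) (\<lambda>c x. sech_integral k (\<sigma> c x) (\<mu> c))"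
  using assms
proof (induction n arbitrary: k)
  case 0
  then show ?case by (intro S_0_sech_integral)
next
  case (Suc n)
  obtain k' where k_deriv: "\<And>y. y \<in> {0<..<w} \<Longrightarrow> (k has_real_derivative k' y) (at y)"
    using euler_symbol_DERIV[OF Suc.prems(2)] by blast
  have \<theta>k: "euler_symbol {0<..<w} n (\<lambda>_. 1) (\<lambda>y. y * k' y)"
    by (rule euler_symbol_deriv[OF Suc.prems(2) _ k_deriv]) simp_all
  obtain \<sigma>' where \<sigma>_deriv: "\<And>c x. c \<in> speeds \<Longrightarrow> ((\<lambda>c. \<sigma> c x) has_real_derivative \<sigma>' c x) (at c)"
    "S n (\<lambda>_ _. 1) (\<lambda>c x. \<mu> c * \<sigma>' c x)"
    by (rule S_SucE[OF Suc.prems(1)]) (rule that)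
  have S_\<sigma>: "S n (\<lambda>_ _. 1) \<sigma>" by (rule S_Suc_imp_S[OF Suc.prems(1)])
  have k_level_symbol: "S n (\<lambda>_ _. 1) (\<lambda>c x. k (level c x))"
    by (rule S_compose_level[OF S_\<sigma> Y.S_Suc_imp_S[OF Suc.prems(2)]])
  have "S n (\<lambda>_ _. 1) (\<lambda>c x. k (level c x) * (\<mu> c * \<sigma>' c x) +
      (- 2 * c) * sech_integral (\<lambda>y. y * k' y) (\<sigma> c x) (\<mu> c))"
    by (intro S_add S_mult_bounded k_level_symbol \<sigma>_deriv(2) S_\<mu>' Suc.IH S_\<sigma> \<theta>k)
  then have "S n (\<lambda>_ _. 1) (\<lambda>c x. \<mu> c * (k (\<mu> c * sech_square (\<sigma> c x)) * \<sigma>' c x +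
      sech_integral (\<lambda>y. y * k' y) (\<sigma> c x) (\<mu> c) / \<mu> c * (- 2 * c)))"
    by (rule S_cong) (use \<mu>_nonzero in \<open>simp add: level_def field_simps\<close>)
  then show ?case
    by (rule S_SucI[OF S_0_sech_integral[OF Suc.prems(2)], rotated])
      (intro sech_integral_chain[OF k_deriv Y.S_continuous(1)[OF \<theta>k]] \<mu>_mem \<mu>_DERIV \<sigma>_deriv(1))
qed

lemma S_inverse_q:
  assumes "S n (\<lambda>_ _. 1) \<sigma>" "n \<le> 2"
  shows "S n (\<lambda>_ _. 1) (\<lambda>c x. 1 / q (level c x))"
proof (rule S_inverse[where K = 1 and M = 2])
  show "S n (\<lambda>_ _. 1) (\<lambda>c x. q (level c x))"
    by (rule S_compose_level[OF assms(1) Y.S_antimono[OF q_euler_symbol assms(2)]])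
  fix c x assume "c \<in> speeds"
  then have "7/8 \<le> q (level c x)" by (intro q_estimates level_mem)
  then show "\<bar>1 / q (level c x)\<bar> \<le> 2 * 1" "q (level c x) \<noteq> 0"
    by (auto simp: divide_simps abs_if)
qed auto

lemma S_\<sigma>: "S 2 (\<lambda>_ _. 1) \<sigma>"
proof (rule S_bootstrap[OF S_0_\<sigma> \<sigma>_DERIV_c])
  fix k :: nat assume symbol_k: "k < 2" "S k (\<lambda>_ _. 1) \<sigma>"
  have "S k (\<lambda>_ _. 1) (\<lambda>c x. (((- (1/2)) * c) * (sqrt (\<mu> c) * x) +
      (2 * c) * sech_integral (\<lambda>z. z * q' z) (\<sigma> c x) (\<mu> c)) * (1 / q (level c x)))"
    by (intro S_mult_bounded S_add S_cmult S_c S_sqrt_\<mu>_x S_sech_integral S_inverse_q symbol_k(2)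
        Y.S_antimono[OF \<theta>q_euler_symbol]) (use symbol_k(1) in auto)
  then show "S k (\<lambda>_ _. 1) (\<lambda>c x. \<mu> c * d\<sigma>_dc c x)"
  proof (rule S_cong)
    fix c x assume c_mem: "c \<in> speeds"
    have "\<mu> c * (- c / sqrt (\<mu> c) * x / 2) = (\<mu> c * (- c / sqrt (\<mu> c))) * (x / 2)" by simp
    also have "\<dots> = (- (1/2)) * c * (sqrt (\<mu> c) * x)" unfolding \<mu>_times_div_sqrt[OF c_mem] by simp
    finally have "\<mu> c * (- c / sqrt (\<mu> c) * x / 2 -
        sech_integral (\<lambda>z. z * q' z) (\<sigma> c x) (\<mu> c) / \<mu> c * (- 2 * c))
      = (- (1/2)) * c * (sqrt (\<mu> c) * x) + 2 * c * sech_integral (\<lambda>z. z * q' z) (\<sigma> c x) (\<mu> c)"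
      using \<mu>_nonzero[OF c_mem] by (simp add: right_diff_distrib)
    then show "((- (1/2)) * c * (sqrt (\<mu> c) * x) + 2 * c * sech_integral (\<lambda>z. z * q' z) (\<sigma> c x) (\<mu> c)) *
        (1 / q (level c x)) = \<mu> c * d\<sigma>_dc c x"
      unfolding d\<sigma>_dc_def by simp
  qed
qed

lemma S_eta: "S 2 eta eta"
  using S_compose_level[OF S_\<sigma> h_euler_symbol] by (simp add: eta_def[abs_def])

lemma eta_mem: "c \<in> speeds \<Longrightarrow> eta c x \<in> {0<..<\<delta>}"
  unfolding eta_def by (intro h_mem level_mem)

lemma eta_minus: "c \<in> speeds \<Longrightarrow> eta c (- x) = eta c x"
  by (simp add: eta_def level_def \<sigma>_minus)

lemma eta_0: "c \<in> speeds \<Longrightarrow> eta c 0 = h (\<mu> c)"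
  using \<sigma>_minus[of c 0] by (simp add: eta_def level_def)

definition eta_dx :: "nat \<Rightarrow> real \<Rightarrow> real \<Rightarrow> real" where
  "eta_dx k c x =
    (if k = 0 then eta c x
     else if k = 1 then - sqrt (\<mu> c) * tanh (\<sigma> c x) * eta c x
     else if k = 2 then \<mu> c * eta c x - N 1 (eta c x) / 2
     else (\<mu> c - N 2 (eta c x) / 2) * (- sqrt (\<mu> c) * tanh (\<sigma> c x) * eta c x))"

lemma eta_dx_0: "eta_dx 0 = eta"
  by (simp add: eta_dx_def fun_eq_iff)

lemma eta_dx_2: "eta_dx 2 c x = \<mu> c * eta c x - N 1 (eta c x) / 2"
  by (simp add: eta_dx_def)

lemma eta_dx_1_at_0: "c \<in> speeds \<Longrightarrow> eta_dx 1 c 0 = 0"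
  using \<sigma>_minus[of c 0] by (simp add: eta_dx_def)

lemma eta_dx_1_nonzero:
  assumes "c \<in> speeds" "x \<noteq> 0"
  shows "eta_dx 1 c x \<noteq> 0"
proof -
  have "\<sigma> c x \<noteq> 0"
    using \<sigma>_bounds(2)[OF assms(1), of x] \<mu>_pos[OF assms(1)] assms(2) by (auto simp: mult_le_0_iff)
  then show ?thesis
    using \<mu>_pos[OF assms(1)] eta_mem[OF assms(1), of x] by (auto simp: eta_dx_def)
qed

lemma eta_dx_1_sq:
  assumes "c \<in> speeds"
  shows "(eta_dx 1 c x)^2 = \<mu> c * (eta c x)^2 - N 0 (eta c x)"
  using \<mu>_pos[OF assms] N_h[OF level_mem[OF assms, of x]]
  by (simp add: eta_dx_def power_mult_distrib level_def eta_def algebra_simps)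

lemma eta_DERIV_x:
  assumes c_mem: "c \<in> speeds"
  shows "(eta c has_real_derivative eta_dx 1 c x) (at x)"
proof -
  have level_q_pos: "0 < q (level c x)" "0 < level c x"
    using q_pos[OF level_mem[OF c_mem]] level_mem[OF c_mem, of x] by auto
  have "((\<lambda>x. \<mu> c * sech_square (\<sigma> c x)) has_real_derivative
      \<mu> c * (- 2 * tanh (\<sigma> c x) * sech_square (\<sigma> c x) * (sqrt (\<mu> c) / 2 / q (level c x)))) (at x)"
    by (rule derivative_eq_intros refl \<sigma>_DERIV_x[OF c_mem] | simp)+
  then have "(level c has_real_derivative - tanh (\<sigma> c x) * level c x * sqrt (\<mu> c) / q (level c x)) (at x)"
    unfolding level_def[abs_def] by (rule DERIV_cong) (simp add: level_def)
  from DERIV_chain2[OF h_DERIV[OF level_mem[OF c_mem]] this]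
  show ?thesis unfolding eta_def[abs_def]
    by (rule DERIV_cong) (use level_q_pos in \<open>simp add: eta_dx_def eta_def field_simps\<close>)
qed

lemma eta_dx_1_DERIV_x:
  assumes c_mem: "c \<in> speeds"
  shows "(eta_dx 1 c has_real_derivative eta_dx 2 c x) (at x)"
proof -
  have q_nonzero: "q (level c x) \<noteq> 0" using q_pos[OF level_mem[OF c_mem, of x]] by simp
  define r where "r = sqrt (\<mu> c)"
  have r_sq: "r * r = \<mu> c" using \<mu>_pos[OF c_mem] by (simp add: r_def)
  have dx_1: "eta_dx 1 c x = - r * tanh (\<sigma> c x) * eta c x" for x by (simp add: eta_dx_def r_def)
  have "((\<lambda>x. - r * tanh (\<sigma> c x) * eta c x) has_real_derivative
      - r * (sech_square (\<sigma> c x) * (r / 2 / q (level c x))) * eta c x + eta_dx 1 c x * (- r * tanh (\<sigma> c x))) (at x)"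
    by (rule derivative_eq_intros refl \<sigma>_DERIV_x[OF c_mem, folded r_def] eta_DERIV_x[OF c_mem] | simp)+
  moreover have
    "- r * (sech_square (\<sigma> c x) * (r / 2 / q (level c x))) * eta c x + eta_dx 1 c x * (- r * tanh (\<sigma> c x))
      = eta c x * (- ((r * r) * sech_square (\<sigma> c x)) / (2 * q (level c x)) + (r * r) * (tanh (\<sigma> c x))^2)"
    unfolding dx_1 using q_nonzero by (simp add: field_simps power2_eq_square)
  moreover have "\<dots> = eta c x * (- level c x / (2 * q (level c x)) + \<mu> c - level c x)"
    unfolding r_sq level_def by (simp add: algebra_simps)
  moreover have "\<dots> = eta_dx 2 c x"
    unfolding eta_dx_2 eta_def N_1_h[OF level_mem[OF c_mem]] using q_nonzero by (simp add: field_simps)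
  ultimately show ?thesis unfolding dx_1[abs_def] by metis
qed

lemma eta_dx_DERIV_x:
  assumes c_mem: "c \<in> speeds" and k_less: "k < 3"
  shows "(eta_dx k c has_real_derivative eta_dx (Suc k) c x) (at x)"
proof -
  consider "k = 0" | "k = 1" | "k = 2" using k_less by linarith
  then show ?thesis
  proof cases
    assume "k = 0"
    then show ?thesis using eta_DERIV_x[OF c_mem] by (simp add: eta_dx_0)
  next
    assume "k = 1"
    then show ?thesis using eta_dx_1_DERIV_x[OF c_mem] by (simp add: numeral_2_eq_2)
  next
    assume k_eq: "k = 2"
    have "(N 1 has_real_derivative N 2 (eta c x)) (at (eta c x))"
      using N_DERIV[of "eta c x" 1] eta_mem[OF c_mem, of x] \<delta>_less_1 by (simp add: numeral_2_eq_2)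
    from DERIV_chain2[OF this eta_DERIV_x[OF c_mem]]
    have "((\<lambda>x. \<mu> c * eta c x - N 1 (eta c x) / 2) has_real_derivative
        (\<mu> c - N 2 (eta c x) / 2) * eta_dx 1 c x) (at x)"
      using eta_DERIV_x[OF c_mem, of x] by (auto intro!: derivative_eq_intros simp: algebra_simps)
    then show ?thesis by (simp add: k_eq eta_dx_def[abs_def])
  qed
qed

lemma S_eta_dx: "S 2 eta (eta_dx k)"
proof -
  have S_N: "S 2 (\<lambda>c x. eta c x ^ (3 - k)) (\<lambda>c x. N k (eta c x))" if "k \<le> 2" for k
    by (rule S_compose[OF _ _ S_eta eta_mem N_euler_symbol]) (use that in auto)
  have eta_01: "0 \<le> eta c x" "eta c x \<le> 1" if "c \<in> speeds" for c x
    using eta_mem[OF that, of x] \<delta>_less_1 by auto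
  have "S 2 (\<lambda>c x. eta c x ^ 2) (\<lambda>c x. N 1 (eta c x))" using S_N[of 1] by simp
  then have S_N_1: "S 2 eta (\<lambda>c x. N 1 (eta c x))"
    by (rule S_weaken[where K = 1]) (use eta_01 in \<open>auto simp: power2_eq_square mult_left_le\<close>)
  have "S 2 eta (\<lambda>c x. N 2 (eta c x))" using S_N[of 2] by simp
  then have S_N_2: "S 2 (\<lambda>_ _. 1) (\<lambda>c x. N 2 (eta c x))"
    by (rule S_weaken[where K = 1]) (use eta_01 in auto)
  have S_1: "S 2 eta (\<lambda>c x. ((- 1) * sqrt (\<mu> c) * tanh (\<sigma> c x)) * eta c x)"
    by (intro S_mult_bounded S_cmult S_sqrt_\<mu> S_tanh S_\<sigma> S_eta)
  have S_2: "S 2 eta (\<lambda>c x. \<mu> c * eta c x - (1/2) * N 1 (eta c x))"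
    by (intro S_diff S_mult_bounded S_\<mu>_bounded S_eta S_cmult S_N_1)
  have S_3: "S 2 eta (\<lambda>c x. (\<mu> c - (1/2) * N 2 (eta c x)) * (((- 1) * sqrt (\<mu> c) * tanh (\<sigma> c x)) * eta c x))"
    by (intro S_mult_bounded[OF _ S_1] S_diff S_\<mu>_bounded S_cmult S_N_2)
  consider "k = 0" | "k = 1" | "k = 2" | "k \<noteq> 0" "k \<noteq> 1" "k \<noteq> 2" by blast
  then show ?thesis
    by cases (rule S_cong[OF S_eta] S_cong[OF S_1] S_cong[OF S_2] S_cong[OF S_3], simp add: eta_dx_def)+
qed

definition vel_dx :: "nat \<Rightarrow> real \<Rightarrow> real \<Rightarrow> real" where
  "vel_dx k c x = c / 2 *
    (if k = 0 then eta c x / (1 - eta c x)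
     else if k = 1 then eta_dx 1 c x / (1 - eta c x)^2
     else eta_dx 2 c x / (1 - eta c x)^2 + 2 * (eta_dx 1 c x)^2 / (1 - eta c x)^3)"

lemma vel_dx_DERIV_x:
  assumes c_mem: "c \<in> speeds" and k_less: "k < 2"
  shows "(vel_dx k c has_real_derivative vel_dx (Suc k) c x) (at x)"
proof -
  have nonzero: "1 - eta c x \<noteq> 0" using eta_mem[OF c_mem, of x] \<delta>_less_1 by auto
  consider "k = 0" | "k = 1" using k_less by linarith
  then show ?thesis
  proof cases
    assume k_eq: "k = 0"
    have "((\<lambda>x. eta c x / (1 - eta c x)) has_real_derivative
        (eta_dx 1 c x * (1 - eta c x) - eta c x * (0 - eta_dx 1 c x)) / ((1 - eta c x) * (1 - eta c x))) (at x)"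
      by (intro DERIV_divide DERIV_diff DERIV_const eta_DERIV_x[OF c_mem] nonzero)
    from DERIV_cmult[OF this, of "c / 2"] show ?thesis
      unfolding k_eq vel_dx_def[abs_def] by (simp add: algebra_simps power2_eq_square)
  next
    assume k_eq: "k = 1"
    let ?a = "1 - eta c x"
    have "((\<lambda>x. (1 - eta c x)^2) has_real_derivative - 2 * ?a * eta_dx 1 c x) (at x)"
      using eta_DERIV_x[OF c_mem, of x] by (auto intro!: derivative_eq_intros simp: algebra_simps)
    from DERIV_divide[OF eta_dx_1_DERIV_x[OF c_mem] this]
    have "((\<lambda>x. eta_dx 1 c x / (1 - eta c x)^2) has_real_derivative
        (eta_dx 2 c x * ?a^2 - eta_dx 1 c x * (- 2 * ?a * eta_dx 1 c x)) / (?a^2 * ?a^2)) (at x)"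
      using nonzero by simp
    moreover have "(u2 * a^2 - u1 * (- 2 * a * u1)) / (a^2 * a^2) = u2 / a^2 + 2 * u1^2 / a^3"
      if "a \<noteq> 0" for a u1 u2 :: real
      using that by (simp add: field_simps power2_eq_square power3_eq_cube)
    from this[OF nonzero] have "(eta_dx 2 c x * ?a^2 - eta_dx 1 c x * (- 2 * ?a * eta_dx 1 c x)) / (?a^2 * ?a^2)
        = eta_dx 2 c x / ?a^2 + 2 * (eta_dx 1 c x)^2 / ?a^3" .
    ultimately have "((\<lambda>x. eta_dx 1 c x / (1 - eta c x)^2) has_real_derivative
        eta_dx 2 c x / ?a^2 + 2 * (eta_dx 1 c x)^2 / ?a^3) (at x)" by simp
    from DERIV_cmult[OF this, of "c / 2"] show ?thesis
      unfolding k_eq vel_dx_def[abs_def] by simp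
  qed
qed

lemma S_vel_dx: "S 2 eta (vel_dx k)"
proof -
  have eta_bounds: "1 - \<delta> \<le> 1 - eta c x" "1 - eta c x \<noteq> 0" "0 \<le> eta c x" "eta c x \<le> 1"
    if "c \<in> speeds" for c x
    using eta_mem[OF that, of x] \<delta>_less_1 by auto
  have bounded: "S 2 (\<lambda>_ _. 1) u" if "S 2 eta u" for u
    by (rule S_weaken[OF that, of 1]) (use eta_bounds in auto)
  have S_inverse_gap: "S 2 (\<lambda>_ _. 1) (\<lambda>c x. 1 / (1 - eta c x))"
  proof (rule S_inverse[where K = 1 and M = "1 / (1 - \<delta>)"])
    show "S 2 (\<lambda>_ _. 1) (\<lambda>c x. 1 - eta c x)" by (intro S_diff S_const bounded S_eta)
    show "\<bar>1 / (1 - eta c x)\<bar> \<le> 1 / (1 - \<delta>) * 1" if "c \<in> speeds" for c x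
      using eta_bounds[OF that, of x] \<delta>_less_1 by (auto simp: abs_divide intro!: divide_left_mono)
  qed (use eta_bounds in auto)
  have S_0: "S 2 eta (\<lambda>c x. ((1/2) * c) * ((1 / (1 - eta c x)) * eta c x))"
    by (intro S_mult_bounded S_cmult S_c S_inverse_gap S_eta)
  have S_1: "S 2 eta (\<lambda>c x. ((1/2) * c) * (((1 / (1 - eta c x)) * (1 / (1 - eta c x))) * eta_dx 1 c x))"
    by (intro S_mult_bounded S_cmult S_c S_inverse_gap S_eta_dx)
  have S_2: "S 2 eta (\<lambda>c x. ((1/2) * c) * (((1 / (1 - eta c x)) * (1 / (1 - eta c x))) * eta_dx 2 c x +
      (((2 * (1 / (1 - eta c x))) * (1 / (1 - eta c x))) * (1 / (1 - eta c x)) * eta_dx 1 c x) * eta_dx 1 c x))"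
    by (intro S_mult_bounded S_cmult S_add S_c S_inverse_gap S_eta_dx bounded[OF S_eta_dx])
  consider "k = 0" | "k = 1" | "k \<noteq> 0" "k \<noteq> 1" by blast
  then show ?thesis
    by cases (rule S_cong[OF S_0] S_cong[OF S_1] S_cong[OF S_2],
        simp add: vel_dx_def power2_eq_square power3_eq_cube mult.assoc)+
qed

lemma TW_hy_eta:
  assumes c_mem: "c \<in> speeds"
  shows "TW_hy f c (eta c) (vel_dx 0 c)"
  unfolding TW_hy_def
proof
  fix x
  have deriv_eta: "deriv (eta c) = eta_dx 1 c"
    using eta_DERIV_x[OF c_mem] by (auto simp: fun_eq_iff DERIV_imp_deriv)
  have deriv_eta_dx_1: "deriv (eta_dx 1 c) x = eta_dx 2 c x"
    by (rule DERIV_imp_deriv[OF eta_dx_1_DERIV_x[OF c_mem]])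
  have less_1: "eta c x < 1" using eta_mem[OF c_mem, of x] \<delta>_less_1 by auto
  then have first: "c / 2 * eta c x = vel_dx 0 c x * (1 - eta c x)"
    by (simp add: vel_dx_def field_simps)
  have "eta_dx 2 c x = (cs^2 - c^2) * eta c x - N 1 (eta c x) / 2
      - ((eta_dx 1 c x)^2 - ((cs^2 - c^2) * (eta c x)^2 - N 0 (eta c x))) / (2 * (1 - eta c x))"
    using eta_dx_1_sq[OF c_mem, of x] by (simp add: eta_dx_2 \<mu>_def)
  then have "c * vel_dx 0 c x = f (1 - eta c x) - (vel_dx 0 c x)^2 - eta_dx 2 c x / (2 * (1 - eta c x))
      - (eta_dx 1 c x)^2 / (4 * (1 - eta c x)^2)"
    using TW_second_equation_iff[OF less_1 first] by blast
  then show "(eta c has_real_derivative deriv (eta c) x) (at x) \<and>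
      (deriv (eta c) has_real_derivative deriv (deriv (eta c)) x) (at x) \<and>
      c / 2 * eta c x = vel_dx 0 c x * (1 - eta c x) \<and>
      c * vel_dx 0 c x = f (1 - eta c x) - (vel_dx 0 c x)^2 - deriv (deriv (eta c)) x / (2 * (1 - eta c x))
        - (deriv (eta c) x)^2 / (4 * (1 - eta c x)^2)"
    unfolding deriv_eta deriv_eta_dx_1
    using first eta_dx_1_DERIV_x[OF c_mem] eta_DERIV_x[OF c_mem, of x] by simp
qed

lemma Sup_eta_less_1:
  assumes "c \<in> speeds"
  shows "Sup (range (eta c)) < 1"
proof -
  have "Sup (range (eta c)) \<le> \<delta>"
    using eta_mem[OF assms] by (intro cSUP_least) (auto simp: less_imp_le)
  then show ?thesis using \<delta>_less_1 by simp
qed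

lemma eta_not_constant:
  assumes c_mem: "c \<in> speeds"
  shows "\<nexists>a. \<forall>x. eta c x = a"
proof
  assume "\<exists>a. \<forall>x. eta c x = a"
  then obtain a where "eta c = (\<lambda>_. a)" by blast
  then have "((\<lambda>_. a) has_real_derivative eta_dx 1 c 1) (at 1)" using eta_DERIV_x[OF c_mem, of 1] by simp
  then have "eta_dx 1 c 1 = 0" using DERIV_unique[OF _ DERIV_const] by blast
  then show False using eta_dx_1_nonzero[OF c_mem, of 1] by simp
qed

end

section \<open>Exponential decay\<close>

lemma sech_square_le_exp: "sech_square y \<le> 4 * exp (- 2 * \<bar>y\<bar>)"
proof -
  have "exp \<bar>y\<bar> \<le> 2 * cosh y" by (auto simp: cosh_def abs_if)
  then have "(exp \<bar>y\<bar>)^2 \<le> (2 * cosh y)^2" by (intro power_mono) auto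
  then have exp_le: "exp (2 * \<bar>y\<bar>) \<le> 4 * (cosh y)^2"
    by (simp add: exp_double power_mult_distrib)
  have "sech_square y = ((cosh y)^2 - (sinh y)^2) / (cosh y)^2"
    by (simp add: tanh_def power_divide diff_divide_distrib)
  also have "\<dots> = 1 / (cosh y)^2" by (simp add: cosh_square_eq)
  also have "\<dots> \<le> 4 * exp (- 2 * \<bar>y\<bar>)"
    using exp_le by (simp add: exp_minus field_simps)
  finally show ?thesis .
qed

lemma one_plus_power_times_exp_le:
  fixes z :: real
  assumes "0 \<le> z"
  shows "(1 + z) ^ n * exp (- z / 2) \<le> (4 * (real n + 1)) ^ n * exp (- z / 4)"
proof -
  define r where "r = 4 * (real n + 1)"
  have r_ge_1: "1 \<le> r" by (simp add: r_def)
  have "1 + z \<le> r * (1 + z / r)" using r_ge_1 assms by (simp add: algebra_simps)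
  also have "\<dots> \<le> r * exp (z / r)"
    using r_ge_1 exp_ge_add_one_self[of "z / r"] by (intro mult_left_mono) auto
  finally have "(1 + z) ^ n \<le> (r * exp (z / r)) ^ n" using assms by (intro power_mono) auto
  also have "\<dots> = r ^ n * exp (n * (z / r))" by (simp only: power_mult_distrib exp_of_nat_mult)
  also have "\<dots> \<le> r ^ n * exp (z / 4)"
    using assms r_ge_1 by (intro mult_left_mono) (auto simp: r_def field_simps)
  finally have "(1 + z) ^ n * exp (- z / 2) \<le> r ^ n * exp (z / 4) * exp (- z / 2)"
    by (intro mult_right_mono) auto
  then show ?thesis by (simp add: r_def mult.assoc exp_add[symmetric])
qed

context solitary_waves
begin

definition envelope :: "real \<Rightarrow> real \<Rightarrow> real" where
  "envelope c x = exp (- (sqrt (\<mu> c) * \<bar>x\<bar>) / 4)"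

lemma eta_le_exp:
  assumes c_mem: "c \<in> speeds"
  shows "eta c x \<le> 8 / cs^2 * \<mu> c * exp (- (sqrt (\<mu> c) * \<bar>x\<bar>) / 2)"
proof -
  have "sech_square (\<sigma> c x) \<le> 4 * exp (- 2 * \<bar>\<sigma> c x\<bar>)" by (rule sech_square_le_exp)
  also have "\<dots> \<le> 4 * exp (- (sqrt (\<mu> c) * \<bar>x\<bar>) / 2)" using \<sigma>_bounds(2)[OF c_mem, of x] by simp
  finally have "level c x \<le> \<mu> c * (4 * exp (- (sqrt (\<mu> c) * \<bar>x\<bar>) / 2))"
    unfolding level_def using \<mu>_pos[OF c_mem] by (intro mult_left_mono) auto
  then have "2 / cs^2 * level c x \<le> 2 / cs^2 * (\<mu> c * (4 * exp (- (sqrt (\<mu> c) * \<bar>x\<bar>) / 2)))"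
    by (intro mult_left_mono) auto
  with h_le[OF level_mem[OF c_mem, of x]] show ?thesis by (simp add: eta_def)
qed

lemma S_envelope_bound:
  assumes u_symbol: "S n eta u"
  obtains M where "0 \<le> M" "\<And>c x. c \<in> speeds \<Longrightarrow> \<bar>u c x\<bar> \<le> M * \<mu> c * envelope c x"
proof -
  obtain n M where u_bound: "0 \<le> M" "\<And>c x. c \<in> speeds \<Longrightarrow> \<bar>u c x\<bar> \<le> M * growth c x ^ n * eta c x"
    by (rule S_boundE[OF u_symbol]) (rule that)
  show ?thesis
  proof (rule that)
    show "0 \<le> M * (8 / cs^2) * (4 * (real n + 1)) ^ n" using u_bound by simp
    fix c x assume c_mem: "c \<in> speeds"
    let ?z = "sqrt (\<mu> c) * \<bar>x\<bar>"
    have "\<bar>u c x\<bar> \<le> M * growth c x ^ n * (8 / cs^2 * \<mu> c * exp (- ?z / 2))"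
      using u_bound(1) L_ge_1[OF c_mem, of x]
      by (intro order_trans[OF u_bound(2)[OF c_mem]] mult_left_mono eta_le_exp c_mem) auto
    also have "\<dots> = M * (8 / cs^2) * \<mu> c * ((1 + ?z) ^ n * exp (- ?z / 2))" by (simp add: growth_def)
    also have "\<dots> \<le> M * (8 / cs^2) * \<mu> c * ((4 * (real n + 1)) ^ n * exp (- ?z / 4))"
      using u_bound(1) \<mu>_pos[OF c_mem] by (intro mult_left_mono one_plus_power_times_exp_le) auto
    finally show "\<bar>u c x\<bar> \<le> M * (8 / cs^2) * (4 * (real n + 1)) ^ n * \<mu> c * envelope c x"
      by (simp add: envelope_def mult_ac)
  qed
qed

lemma param_deriv_envelope_bound:
  assumes "S n eta u" "j \<le> n"
  obtains M where "0 \<le> M"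
    "\<And>c x. c \<in> speeds \<Longrightarrow> \<mu> c ^ j * \<bar>param_deriv j u c x\<bar> \<le> M * \<mu> c * envelope c x"
proof -
  obtain M where "0 \<le> M"
    "\<And>c x. c \<in> speeds \<Longrightarrow> \<bar>\<mu> c ^ j * param_deriv j u c x\<bar> \<le> M * \<mu> c * envelope c x"
    by (rule S_envelope_bound[OF S_param_deriv[OF assms]]) (rule that)
  then show ?thesis
    using \<mu>_pos by (intro that[of M]) (auto simp: abs_mult less_imp_le)
qed

lemma param_deriv_continuous:
  assumes "S n eta u" "j \<le> n"
  shows "continuous_on speeds (\<lambda>c. param_deriv j u c x)"
    and "c \<in> speeds \<Longrightarrow> continuous_on UNIV (param_deriv j u c)"
proof -
  note cont = S_continuous[OF S_param_deriv[OF assms]]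
  have "continuous_on speeds (\<lambda>c. (\<mu> c ^ j * param_deriv j u c x) / \<mu> c ^ j)"
    using \<mu>_nonzero by (intro continuous_on_divide cont \<mu>_continuous continuous_on_power) auto
  then show "continuous_on speeds (\<lambda>c. param_deriv j u c x)"
    by (rule continuous_on_cong[THEN iffD1, rotated 2]) (use \<mu>_nonzero in auto)
  assume c_mem: "c \<in> speeds"
  then have "continuous_on UNIV (\<lambda>x. (\<mu> c ^ j * param_deriv j u c x) / \<mu> c ^ j)"
    using \<mu>_nonzero[OF c_mem] by (intro continuous_on_divide cont continuous_on_const) auto
  then show "continuous_on UNIV (param_deriv j u c)" using \<mu>_nonzero[OF c_mem] by simp
qed

lemma param_deriv_exp_decaying:
  assumes u_symbol: "S n eta u" "j \<le> n"
  shows "exp_decaying speeds (param_deriv j u)"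
  unfolding exp_decaying_def
proof (intro conjI ballI open_I param_deriv_continuous[OF u_symbol])
  obtain M where deriv_bound: "0 \<le> M"
    "\<And>c x. c \<in> speeds \<Longrightarrow> \<mu> c ^ j * \<bar>param_deriv j u c x\<bar> \<le> M * \<mu> c * envelope c x"
    by (rule param_deriv_envelope_bound[OF u_symbol]) (rule that)
  fix c assume c_mem: "c \<in> speeds"
  define c1 where "c1 = (c + cs) / 2"
  have c1_mem: "c < c1" "c1 \<in> speeds" using c_mem by (auto simp: c1_def speeds_def)
  define a where "a = sqrt (\<mu> c1) / 4"
  have a_pos: "0 < a" using \<mu>_pos[OF c1_mem(2)] by (simp add: a_def)
  have "\<forall>\<^sub>F c' in nhds c. c' \<in> {c0<..<c1}"
    using c_mem c1_mem by (intro eventually_nhds_in_open) (auto simp: speeds_def)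
  then have "\<forall>\<^sub>F c' in nhds c. \<forall>x. \<bar>param_deriv j u c' x\<bar> \<le> M * w / \<mu> c1 ^ j * exp (- a * \<bar>x\<bar>)"
  proof (eventually_elim, intro allI)
    fix c' x assume c'_mem: "c' \<in> {c0<..<c1}"
    then have c'_speed: "c' \<in> speeds" using c1_mem by (auto simp: speeds_def)
    have "c'^2 \<le> c1^2" using c'_mem c0_pos by (intro power_mono) auto
    then have \<mu>_mono: "\<mu> c1 \<le> \<mu> c'" by (simp add: \<mu>_def)
    have "\<mu> c1 ^ j * \<bar>param_deriv j u c' x\<bar> \<le> \<mu> c' ^ j * \<bar>param_deriv j u c' x\<bar>"
      using \<mu>_mono \<mu>_pos[OF c1_mem(2)] by (intro mult_right_mono power_mono) auto
    also have "\<dots> \<le> M * \<mu> c' * envelope c' x" by (rule deriv_bound(2)[OF c'_speed])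
    also have "\<dots> \<le> M * w * exp (- a * \<bar>x\<bar>)"
    proof (intro mult_mono)
      have "sqrt (\<mu> c1) * \<bar>x\<bar> \<le> sqrt (\<mu> c') * \<bar>x\<bar>" using \<mu>_mono by (intro mult_right_mono) auto
      then show "envelope c' x \<le> exp (- a * \<bar>x\<bar>)" by (simp add: envelope_def a_def)
    qed (use deriv_bound(1) \<mu>_mem[OF c'_speed] in \<open>auto simp: envelope_def\<close>)
    finally show "\<bar>param_deriv j u c' x\<bar> \<le> M * w / \<mu> c1 ^ j * exp (- a * \<bar>x\<bar>)"
      using \<mu>_pos[OF c1_mem(2)] by (simp add: field_simps)
  qed
  with a_pos show "\<exists>a>0. \<exists>K. \<forall>\<^sub>F c' in nhds c. \<forall>x. \<bar>param_deriv j u c' x\<bar> \<le> K * exp (- a * \<bar>x\<bar>)" by blast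
qed

lemma Cp_exp_decaying_family_param_deriv:
  assumes "\<And>k. S p eta (U k)"
    and "\<And>k c x. k < n \<Longrightarrow> c \<in> speeds \<Longrightarrow> (U k c has_real_derivative U (Suc k) c x) (at x)"
  shows "Cp_exp_decaying_family speeds p n (\<lambda>k j. param_deriv j (U k))"
proof
  show "((\<lambda>c. param_deriv j (U k) c x) has_real_derivative param_deriv (Suc j) (U k) c x) (at c)"
    if "j < p" "c \<in> speeds" for k j c x
    using assms(1) that by (rule S_param_deriv_DERIV)
  show "isCont (\<lambda>c. param_deriv p (U k) c x) c" if "c \<in> speeds" for k c x
    using param_deriv_continuous(1)[OF assms(1), of p k x] that open_I
    by (simp add: continuous_on_eq_continuous_at)
qed (use assms(2) in \<open>auto intro: param_deriv_exp_decaying[OF assms(1)]\<close>)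

lemma pd_envelope_bound:
  assumes U_symbol: "\<And>k. S p eta (U k)"
    and deriv_x: "\<And>k c x. k < n \<Longrightarrow> c \<in> speeds \<Longrightarrow> (U k c has_real_derivative U (Suc k) c x) (at x)"
  obtains M where "0 \<le> M" "\<And>j k c x. j \<le> p \<Longrightarrow> k \<le> n \<Longrightarrow> c \<in> speeds \<Longrightarrow>
    \<mu> c powi (int j - 1) * \<bar>pd (U 0) j k c x\<bar> \<le> M * envelope c x"
proof -
  interpret Cp_exp_decaying_family speeds p n "\<lambda>k j. param_deriv j (U k)"
    using U_symbol deriv_x by (rule Cp_exp_decaying_family_param_deriv)
  have "\<forall>i\<in>{..p} \<times> {..n}. \<exists>M\<ge>0. \<forall>c\<in>speeds. \<forall>x.
      \<mu> c ^ fst i * \<bar>param_deriv (fst i) (U (snd i)) c x\<bar> \<le> M * \<mu> c * envelope c x"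
    using param_deriv_envelope_bound[OF U_symbol] by (metis SigmaE atMost_iff fst_conv)
  then obtain M where deriv_bound: "\<And>i. i \<in> {..p} \<times> {..n} \<Longrightarrow> 0 \<le> M i" "\<And>i c x. i \<in> {..p} \<times> {..n} \<Longrightarrow> c \<in> speeds \<Longrightarrow>
      \<mu> c ^ fst i * \<bar>param_deriv (fst i) (U (snd i)) c x\<bar> \<le> M i * \<mu> c * envelope c x"
    by metis
  show ?thesis
  proof (rule that[of "sum M ({..p} \<times> {..n})"])
    show "0 \<le> sum M ({..p} \<times> {..n})" using deriv_bound(1) by (rule sum_nonneg)
    fix j k c x assume j_k: "j \<le> p" "k \<le> n" and c_mem: "c \<in> speeds"
    have "\<mu> c powi (int j - 1) * \<bar>pd (U 0) j k c x\<bar> = \<mu> c ^ j * \<bar>param_deriv j (U k) c x\<bar> / \<mu> c"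
      using pd_D[OF j_k(2,1) c_mem] \<mu>_nonzero[OF c_mem] by (simp add: power_int_diff)
    also have "\<dots> \<le> M (j, k) * envelope c x"
      using deriv_bound(2)[of "(j, k)" c x] j_k c_mem \<mu>_pos[OF c_mem] by (simp add: divide_le_eq mult_ac)
    also have "\<dots> \<le> sum M ({..p} \<times> {..n}) * envelope c x"
      using j_k deriv_bound(1) by (intro mult_right_mono member_le_sum) (auto simp: envelope_def)
    finally show "\<mu> c powi (int j - 1) * \<bar>pd (U 0) j k c x\<bar> \<le> sum M ({..p} \<times> {..n}) * envelope c x" .
  qed
qed

lemma eta_vel_decay:
  "\<exists>a M. 0 < a \<and> 0 < M \<and> (\<forall>c\<in>speeds. \<forall>x.
     (\<Sum>k1\<le>3. \<Sum>k2\<le>2. \<Sum>j\<le>2::nat. (cs^2 - c^2) powi (int j - 1) *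
        (\<bar>pd eta j k1 c x\<bar> + c ^ (1 + 2*j + 2*k2) * \<bar>pd (vel_dx 0) j k2 c x\<bar>))
     \<le> M * exp (- a * sqrt (cs^2 - c^2) * \<bar>x\<bar>))"
proof -
  obtain M1 where eta_bound: "0 \<le> M1" "\<And>j k c x. j \<le> 2 \<Longrightarrow> k \<le> 3 \<Longrightarrow> c \<in> speeds \<Longrightarrow>
      \<mu> c powi (int j - 1) * \<bar>pd eta j k c x\<bar> \<le> M1 * envelope c x"
    by (rule pd_envelope_bound[where U = eta_dx and p = 2 and n = 3, unfolded eta_dx_0])
      (auto intro: S_eta_dx eta_dx_DERIV_x that)
  obtain M2 where vel_bound: "0 \<le> M2" "\<And>j k c x. j \<le> 2 \<Longrightarrow> k \<le> 2 \<Longrightarrow> c \<in> speeds \<Longrightarrow>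
      \<mu> c powi (int j - 1) * \<bar>pd (vel_dx 0) j k c x\<bar> \<le> M2 * envelope c x"
    by (rule pd_envelope_bound[where U = vel_dx and p = 2 and n = 2])
      (auto intro: S_vel_dx vel_dx_DERIV_x that)
  define M where "M = M1 + (1 + cs) ^ 9 * M2"
  have M_nonneg: "0 \<le> M" using eta_bound(1) vel_bound(1) cs_pos by (simp add: M_def)
  have term_le: "\<mu> c powi (int j - 1) * (\<bar>pd eta j k1 c x\<bar> + c ^ (1 + 2*j + 2*k2) * \<bar>pd (vel_dx 0) j k2 c x\<bar>)
      \<le> M * envelope c x" if j_k: "k1 \<le> 3" "k2 \<le> 2" "j \<le> 2" and c_mem: "c \<in> speeds" for j k1 k2 c x
  proof -
    let ?p = "1 + 2*j + 2*k2"
    have "c ^ ?p \<le> (1 + cs) ^ ?p" using c_pos[OF c_mem] c_less[OF c_mem] by (intro power_mono) auto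
    also have "\<dots> \<le> (1 + cs) ^ 9" using j_k cs_pos by (intro power_increasing) auto
    finally have "c ^ ?p * (\<mu> c powi (int j - 1) * \<bar>pd (vel_dx 0) j k2 c x\<bar>) \<le> (1 + cs) ^ 9 * (M2 * envelope c x)"
      using \<mu>_pos[OF c_mem] cs_pos by (intro mult_mono vel_bound(2) j_k c_mem) auto
    then show ?thesis
      using eta_bound(2)[OF j_k(3,1) c_mem, of x] by (simp add: M_def algebra_simps)
  qed
  have "(\<Sum>k1\<le>3. \<Sum>k2\<le>2. \<Sum>j\<le>2::nat. (cs^2 - c^2) powi (int j - 1) *
        (\<bar>pd eta j k1 c x\<bar> + c ^ (1 + 2*j + 2*k2) * \<bar>pd (vel_dx 0) j k2 c x\<bar>))
      \<le> (36 * M + 1) * exp (- (1/4) * sqrt (cs^2 - c^2) * \<bar>x\<bar>)" if c_mem: "c \<in> speeds" for c x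
  proof -
    have "(\<Sum>k1\<le>3. \<Sum>k2\<le>2. \<Sum>j\<le>2::nat. \<mu> c powi (int j - 1) *
        (\<bar>pd eta j k1 c x\<bar> + c ^ (1 + 2*j + 2*k2) * \<bar>pd (vel_dx 0) j k2 c x\<bar>))
      \<le> (\<Sum>k1\<le>(3::nat). \<Sum>k2\<le>(2::nat). \<Sum>j\<le>(2::nat). M * envelope c x)"
      using c_mem by (intro sum_mono term_le) auto
    also have "\<dots> \<le> (36 * M + 1) * envelope c x"
      by (simp add: envelope_def algebra_simps)
    finally show ?thesis by (simp add: \<mu>_def envelope_def)
  qed
  then show ?thesis using M_nonneg by (intro exI[of _ "1/4"] exI[of _ "36 * M + 1"]) auto
qed

end

section \<open>The momentum\<close>

lemma integral_pos_if_pos: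
  fixes f :: "'a \<Rightarrow> real"
  assumes f_pos: "integrable M f" "\<And>x. x \<in> space M \<Longrightarrow> 0 < f x" and M_nontrivial: "emeasure M (space M) \<noteq> 0"
  shows "0 < integral\<^sup>L M f"
proof -
  have nonneg: "AE x in M. 0 \<le> f x" using f_pos(2) by (auto intro: less_imp_le)
  have "integral\<^sup>L M f \<noteq> 0"
  proof
    assume "integral\<^sup>L M f = 0"
    then have "AE x in M. f x = 0"
      using integral_nonneg_eq_0_iff_AE[OF f_pos(1) nonneg] by simp
    with AE_space have "AE x in M. False"
      by eventually_elim (use f_pos(2) in fastforce)
    then show False using M_nontrivial by (simp add: AE_iff_measurable[of "space M"])
  qed
  then show ?thesis using integral_nonneg_AE[OF nonneg] by simp
qed

lemma integral_lborel_substitution_bij: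
  fixes f g g' :: "real \<Rightarrow> real"
  assumes g_bij: "\<And>t. (g has_real_derivative g' t) (at t)" "inj g" "surj g"
    and f_integrable: "integrable lborel f" and "(\<lambda>t. \<bar>g' t\<bar> * f (g t)) \<in> borel_measurable borel"
  shows "(LINT t|lborel. \<bar>g' t\<bar> * f (g t)) = (LINT x|lborel. f x)"
proof -
  have "f absolutely_integrable_on range g"
    using f_integrable g_bij(3) by (simp add: set_integrable_def integrable_completion)
  then have "(\<lambda>t. \<bar>g' t\<bar> * f (g t)) absolutely_integrable_on UNIV"
    and integral_eq: "integral UNIV (\<lambda>t. \<bar>g' t\<bar> * f (g t)) = integral UNIV f"
    using has_absolute_integral_change_of_variables_1'[of UNIV g g' f "integral UNIV f"] g_bij by auto
  then have "integrable lborel (\<lambda>t. \<bar>g' t\<bar> * f (g t))"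
    using assms(5) by (simp add: set_integrable_def integrable_completion)
  then show ?thesis
    using integral_eq by (simp add: integral_lborel f_integrable)
qed

lemma exp_decaying_if_sech_dominated:
  assumes I_open: "open I" and cont: "\<And>c. c \<in> I \<Longrightarrow> continuous_on UNIV (u c)"
    and bound: "\<And>c t. c \<in> I \<Longrightarrow> \<bar>u c t\<bar> \<le> M * sech_square t"
  shows "exp_decaying I u"
  unfolding exp_decaying_def
proof (intro conjI ballI I_open cont)
  fix c assume c_mem: "c \<in> I"
  have "\<bar>u c' t\<bar> \<le> 4 * M * exp (- 2 * \<bar>t\<bar>)" if "c' \<in> I" for c' t
  proof -
    have "0 \<le> M" using order_trans[OF abs_ge_zero bound[OF c_mem, of 0]] by simp
    then have "M * sech_square t \<le> M * (4 * exp (- 2 * \<bar>t\<bar>))"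
      by (intro mult_left_mono sech_square_le_exp)
    then show ?thesis using bound[OF that, of t] by simp
  qed
  then have "\<forall>\<^sub>F c' in nhds c. \<forall>t. \<bar>u c' t\<bar> \<le> 4 * M * exp (- 2 * \<bar>t\<bar>)"
    using eventually_nhds_in_open[OF I_open c_mem] by (auto elim: eventually_mono)
  then show "\<exists>a>0. \<exists>K. \<forall>\<^sub>F c' in nhds c. \<forall>t. \<bar>u c' t\<bar> \<le> K * exp (- a * \<bar>t\<bar>)"
    by (intro exI[of _ 2] conjI exI[of _ "4 * M"]) simp_all
qed

context solitary_waves
begin

definition \<psi> :: "real \<Rightarrow> real" where "\<psi> y = (h y)^2 * q y / (1 - h y)"
definition \<theta>\<psi> :: "real \<Rightarrow> real" where
  "\<theta>\<psi> y = \<psi> y * (2 * q y + y * q' y / q y + h y * q y / (1 - h y))"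

lemma \<psi>_DERIV:
  assumes y_mem: "y \<in> {0<..<w}"
  shows "(\<psi> has_real_derivative \<theta>\<psi> y / y) (at y)"
proof -
  have nonzero: "1 - h y \<noteq> 0" "q y \<noteq> 0" "y \<noteq> 0"
    using h_mem[OF y_mem] \<delta>_less_1 q_pos[OF y_mem] y_mem by auto
  have "((\<lambda>y. (h y)^2 * q y / (1 - h y)) has_real_derivative
      ((2 * h y * (h y * q y / y) * q y + q' y * (h y)^2) * (1 - h y) - (h y)^2 * q y * (0 - h y * q y / y)) /
        ((1 - h y) * (1 - h y))) (at y)"
    using h_DERIV[OF y_mem] q_DERIV[OF y_mem]
    by (intro DERIV_divide DERIV_mult DERIV_diff DERIV_const nonzero) (auto intro!: derivative_eq_intros)
  moreover have "((2 * a * (a * p / y) * p + p' * a^2) * b - a^2 * p * (0 - a * p / y)) / (b * b)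
      = (a^2 * p / b) * (2 * p + y * p' / p + a * p / b) / y"
    if "b \<noteq> 0" "p \<noteq> 0" for a b p p' :: real
    using that nonzero(3) by (simp add: field_simps power2_eq_square)
  from this[OF nonzero(1,2)]
  have "((2 * h y * (h y * q y / y) * q y + q' y * (h y)^2) * (1 - h y) - (h y)^2 * q y * (0 - h y * q y / y)) /
        ((1 - h y) * (1 - h y)) = \<theta>\<psi> y / y"
    by (simp only: \<theta>\<psi>_def \<psi>_def)
  ultimately show ?thesis unfolding \<psi>_def[abs_def] by simp
qed

lemma \<psi>_continuous: "continuous_on {0<..<w} \<psi>"
  using \<psi>_DERIV DERIV_isCont by (blast intro: continuous_at_imp_continuous_on)

lemma \<theta>\<psi>_continuous: "continuous_on {0<..<w} \<theta>\<psi>"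
proof -
  have "continuous_on {0<..<w} h"
    using h_DERIV DERIV_isCont by (blast intro: continuous_at_imp_continuous_on)
  moreover have "q y \<noteq> 0" "1 - h y \<noteq> 0" if "y \<in> {0<..<w}" for y
    using h_mem[OF that] \<delta>_less_1 q_pos[OF that] by auto
  ultimately show ?thesis unfolding \<theta>\<psi>_def
    by (intro continuous_on_mult continuous_on_add continuous_on_divide \<theta>q_continuous q_continuous
        \<psi>_continuous continuous_on_diff continuous_on_const) auto
qed

lemma \<psi>_pos: "y \<in> {0<..<w} \<Longrightarrow> 0 < \<psi> y"
  using h_mem[of y] \<delta>_less_1 q_pos[of y] by (simp add: \<psi>_def)

lemma \<psi>_le:
  assumes y_mem: "y \<in> {0<..<w}"
  shows "\<psi> y \<le> 4 / (cs^2 * (1 - \<delta>)) * y"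
proof -
  have h_y: "0 < h y" "h y < \<delta>" "h y \<le> 1" using h_mem[OF y_mem] \<delta>_less_1 by auto
  have "(h y)^2 \<le> 1 * h y" unfolding power2_eq_square using h_y by (intro mult_right_mono) auto
  then have "(h y)^2 \<le> 2 / cs^2 * y" using h_le[OF y_mem] by simp
  then have "(h y)^2 * q y \<le> (2 / cs^2 * y) * 2"
    using q_estimates[OF y_mem] q_pos[OF y_mem] y_mem by (intro mult_mono) auto
  then have "\<psi> y \<le> ((2 / cs^2 * y) * 2) / (1 - \<delta>)"
    unfolding \<psi>_def using h_y \<delta>_less_1 y_mem by (intro frac_le) auto
  then show ?thesis by simp
qed

lemma \<theta>\<psi>_bounds:
  assumes y_mem: "y \<in> {0<..<w}"
  shows "3/2 * \<psi> y \<le> \<theta>\<psi> y" "\<theta>\<psi> y \<le> (5 + 2 / (1 - \<delta>)) * \<psi> y"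
proof -
  have h_y: "0 < h y" "h y < \<delta>" "h y \<le> 1" using h_mem[OF y_mem] \<delta>_less_1 by auto
  note q_y = q_estimates[OF y_mem]
  have "\<bar>y * q' y / q y\<bar> \<le> (1/16) / (1/2)"
    unfolding abs_divide using q_y by (intro frac_le) auto
  then have \<theta>q: "\<bar>y * q' y / q y\<bar> \<le> 1/8" by simp
  have last_term: "0 \<le> h y * q y / (1 - h y)" "h y * q y / (1 - h y) \<le> 2 / (1 - \<delta>)"
  proof -
    have "h y * q y \<le> 1 * 2" using h_y q_y by (intro mult_mono) auto
    then show "h y * q y / (1 - h y) \<le> 2 / (1 - \<delta>)" using h_y \<delta>_less_1 by (intro frac_le) auto
    show "0 \<le> h y * q y / (1 - h y)" using h_y q_y by simp
  qed
  have "3/2 \<le> 2 * q y + y * q' y / q y + h y * q y / (1 - h y)"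
    "2 * q y + y * q' y / q y + h y * q y / (1 - h y) \<le> 5 + 2 / (1 - \<delta>)"
    using abs_le_D1[OF \<theta>q] abs_le_D2[OF \<theta>q] last_term q_y by linarith+
  then show "3/2 * \<psi> y \<le> \<theta>\<psi> y" "\<theta>\<psi> y \<le> (5 + 2 / (1 - \<delta>)) * \<psi> y"
    using \<psi>_pos[OF y_mem] by (simp_all add: \<theta>\<psi>_def mult.commute mult_left_mono)
qed

lemma \<psi>_\<theta>\<psi>_bound:
  obtains M where "0 \<le> M" "\<And>y. y \<in> {0<..<w} \<Longrightarrow> \<psi> y \<le> M * y"
    "\<And>y. y \<in> {0<..<w} \<Longrightarrow> \<bar>\<theta>\<psi> y\<bar> \<le> M * y"
proof -
  define a where "a = 5 + 2 / (1 - \<delta>)"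
  define b where "b = 4 / (cs^2 * (1 - \<delta>))"
  have a_ge_1: "1 \<le> a" using \<delta>_less_1 by (simp add: a_def add_increasing2)
  have b_nonneg: "0 \<le> b" using \<delta>_less_1 by (simp add: b_def)
  have \<psi>_ab: "a * \<psi> y \<le> a * b * y" if "y \<in> {0<..<w}" for y
    using mult_left_mono[OF \<psi>_le[OF that], of a] a_ge_1 by (simp add: b_def)
  show ?thesis
  proof (rule that[of "a * b"])
    show "0 \<le> a * b" using a_ge_1 b_nonneg by simp
    fix y assume y_mem: "y \<in> {0<..<w}"
    have "1 * \<psi> y \<le> a * \<psi> y" using a_ge_1 \<psi>_pos[OF y_mem] by (intro mult_right_mono) auto
    then show "\<psi> y \<le> a * b * y" using \<psi>_ab[OF y_mem] by simp
    show "\<bar>\<theta>\<psi> y\<bar> \<le> a * b * y"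
      using \<theta>\<psi>_bounds[OF y_mem, folded a_def] \<psi>_pos[OF y_mem] \<psi>_ab[OF y_mem] by (simp add: abs_le_iff)
  qed
qed

lemma continuous_on_mult_sech_square_speeds:
  assumes "continuous_on {0<..<w} k" "c \<in> speeds"
  shows "continuous_on UNIV (\<lambda>t. k (\<mu> c * sech_square t))"
  using \<mu>_mem[OF assms(2)] by (intro continuous_on_mult_sech_square[OF assms(1)] continuous_intros) auto

lemma exp_decaying_mult_sech_square:
  assumes k_cont: "continuous_on {0<..<w} k" and M_nonneg: "0 \<le> M" and bound: "\<And>y. y \<in> {0<..<w} \<Longrightarrow> \<bar>k y\<bar> \<le> M * y"
  shows "exp_decaying speeds (\<lambda>c t. k (\<mu> c * sech_square t))"
proof (rule exp_decaying_if_sech_dominated[OF open_I, of _ "M * w"])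
  fix c t assume c_mem: "c \<in> speeds"
  have "M * (\<mu> c * sech_square t) \<le> M * (w * sech_square t)"
    using M_nonneg \<mu>_mem[OF c_mem] sech_square_pos[of t] by (intro mult_left_mono mult_right_mono) auto
  then show "\<bar>k (\<mu> c * sech_square t)\<bar> \<le> M * w * sech_square t"
    using bound[OF mult_sech_square_mem[OF \<mu>_mem[OF c_mem]], of t] by (simp add: mult.assoc)
qed (rule continuous_on_mult_sech_square_speeds[OF k_cont])

lemma \<psi>_exp_decaying: "exp_decaying speeds (\<lambda>c t. \<psi> (\<mu> c * sech_square t))"
  and \<theta>\<psi>_exp_decaying: "exp_decaying speeds (\<lambda>c t. \<theta>\<psi> (\<mu> c * sech_square t))"
proof -
  obtain M where \<psi>_bounds: "0 \<le> M" "\<And>y. y \<in> {0<..<w} \<Longrightarrow> \<psi> y \<le> M * y" "\<And>y. y \<in> {0<..<w} \<Longrightarrow> \<bar>\<theta>\<psi> y\<bar> \<le> M * y"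
    by (rule \<psi>_\<theta>\<psi>_bound) (rule that)
  show "exp_decaying speeds (\<lambda>c t. \<psi> (\<mu> c * sech_square t))"
    using \<psi>_bounds(2) \<psi>_pos
    by (intro exp_decaying_mult_sech_square[OF \<psi>_continuous \<psi>_bounds(1)]) (simp add: abs_of_pos)
  show "exp_decaying speeds (\<lambda>c t. \<theta>\<psi> (\<mu> c * sech_square t))"
    by (rule exp_decaying_mult_sech_square[OF \<theta>\<psi>_continuous \<psi>_bounds(1,3)])
qed

lemma \<psi>_C1_exp_decaying:
  "C1_exp_decaying speeds (\<lambda>c t. \<psi> (\<mu> c * sech_square t)) (\<lambda>c t. \<theta>\<psi> (\<mu> c * sech_square t) / \<mu> c * (- 2 * c))"
  unfolding C1_exp_decaying_def
proof (intro conjI ballI allI \<psi>_exp_decaying)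
  obtain M where \<theta>\<psi>_bound: "0 \<le> M" "\<And>y. y \<in> {0<..<w} \<Longrightarrow> \<bar>\<theta>\<psi> y\<bar> \<le> M * y"
    by (rule \<psi>_\<theta>\<psi>_bound) (rule that)
  show "exp_decaying speeds (\<lambda>c t. \<theta>\<psi> (\<mu> c * sech_square t) / \<mu> c * (- 2 * c))"
  proof (rule exp_decaying_if_sech_dominated[OF open_I, of _ "M * (2 * cs)"])
    fix c t assume c_mem: "c \<in> speeds"
    have "\<bar>\<theta>\<psi> (\<mu> c * sech_square t) / \<mu> c\<bar> \<le> M * sech_square t"
      using \<theta>\<psi>_bound(2)[OF mult_sech_square_mem[OF \<mu>_mem[OF c_mem]], of t] \<mu>_pos[OF c_mem]
      by (simp add: abs_divide divide_le_eq mult_ac)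
    moreover have "\<bar>- 2 * c\<bar> \<le> 2 * cs" using c_pos[OF c_mem] c_less[OF c_mem] by auto
    ultimately have "\<bar>\<theta>\<psi> (\<mu> c * sech_square t) / \<mu> c\<bar> * \<bar>- 2 * c\<bar> \<le> (M * sech_square t) * (2 * cs)"
      using \<theta>\<psi>_bound(1) sech_square_pos[of t] by (intro mult_mono) auto
    then show "\<bar>\<theta>\<psi> (\<mu> c * sech_square t) / \<mu> c * (- 2 * c)\<bar> \<le> M * (2 * cs) * sech_square t"
      unfolding abs_mult by (simp add: mult_ac)
  qed (use \<mu>_nonzero in \<open>auto intro!: continuous_intros continuous_on_mult_sech_square_speeds[OF \<theta>\<psi>_continuous]\<close>)
  fix c t assume c_mem: "c \<in> speeds"
  show "((\<lambda>c. \<psi> (\<mu> c * sech_square t)) has_real_derivative \<theta>\<psi> (\<mu> c * sech_square t) / \<mu> c * (- 2 * c)) (at c)"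
    by (rule DERIV_cong[OF DERIV_chain2[where f = \<psi>, OF \<psi>_DERIV[OF mult_sech_square_mem[OF \<mu>_mem[OF c_mem]]]
            DERIV_cmult_right[OF \<mu>_DERIV[OF c_mem]]]])
      (use sech_square_pos[of t] in simp)
qed

lemma eta_vel_integrable:
  assumes c_mem: "c \<in> speeds"
  shows "integrable lborel (\<lambda>x. eta c x * vel_dx 0 c x)"
proof -
  have decaying: "exp_decaying speeds eta" "exp_decaying speeds (vel_dx 0)"
    using param_deriv_exp_decaying[OF S_eta, of 0] param_deriv_exp_decaying[OF S_vel_dx, of 0] by auto
  have "\<bar>eta c x\<bar> \<le> 1" for x using eta_mem[OF c_mem, of x] \<delta>_less_1 by simp
  from exp_decaying_mult_bounded_integrable[OF decaying(2) c_mem exp_decaying_measurable[OF decaying(1) c_mem] this]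
  show ?thesis by (simp add: mult.commute)
qed

lemma momentum_eq:
  assumes c_mem: "c \<in> speeds"
  shows "momentum (eta c) (vel_dx 0 c) = c / (2 * sqrt (\<mu> c)) * (LINT t|lborel. \<psi> (\<mu> c * sech_square t))"
proof -
  let ?g = "\<lambda>t. 2 / sqrt (\<mu> c) * sech_integral q t (\<mu> c)"
  let ?g' = "\<lambda>t. 2 / sqrt (\<mu> c) * q (\<mu> c * sech_square t)"
  let ?f = "\<lambda>x. eta c x * vel_dx 0 c x"
  have sqrt_pos: "0 < sqrt (\<mu> c)" using \<mu>_pos[OF c_mem] by simp
  have \<sigma>_g: "\<sigma> c (?g t) = t" for t
    unfolding \<sigma>_def using sqrt_pos by (intro phi_eqI \<mu>_mem[OF c_mem]) (simp add: field_simps)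
  have g_\<sigma>: "?g (\<sigma> c x) = x" for x
    unfolding \<sigma>_def using sech_integral_phi[OF \<mu>_mem[OF c_mem]] sqrt_pos by simp
  have g_DERIV: "(?g has_real_derivative ?g' t) (at t)" for t
    by (intro DERIV_cmult sech_integral_has_derivative_upper[OF q_continuous \<mu>_mem[OF c_mem]])
  have g_bij: "inj ?g" "surj ?g"
    by (rule inj_on_inverseI[of _ "\<sigma> c"], rule \<sigma>_g) (rule surjI[of _ "\<sigma> c"], rule g_\<sigma>)

  have integrand: "\<bar>?g' t\<bar> * ?f (?g t) = c / sqrt (\<mu> c) * \<psi> (\<mu> c * sech_square t)" for t
  proof -
    have "\<bar>?g' t\<bar> = ?g' t"
      using q_pos[OF mult_sech_square_mem[OF \<mu>_mem[OF c_mem]], of t] sqrt_pos by (simp add: abs_of_pos)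
    moreover have "eta c (?g t) = h (\<mu> c * sech_square t)"
      unfolding eta_def level_def \<sigma>_g ..
    moreover have "2 / r * p * (e * (c / 2 * (e / (1 - e)))) = c / r * (e^2 * p / (1 - e))" for r p e :: real
      by (cases "e = 1"; cases "r = 0") (simp_all add: power2_eq_square divide_simps)
    ultimately show ?thesis
      unfolding vel_dx_def \<psi>_def by simp
  qed
  have "(\<lambda>t. \<bar>?g' t\<bar> * ?f (?g t)) \<in> borel_measurable borel"
    unfolding integrand using exp_decaying_measurable[OF \<psi>_exp_decaying c_mem] by simp
  from integral_lborel_substitution_bij[OF g_DERIV g_bij eta_vel_integrable[OF c_mem] this]
  show ?thesis unfolding momentum_def integrand by simp
qed

lemma integral_\<psi>_pos:
  assumes c_mem: "c \<in> speeds"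
  shows "0 < (LINT t|lborel. \<psi> (\<mu> c * sech_square t))"
  by (rule integral_pos_if_pos[OF exp_decaying_integrable[OF \<psi>_exp_decaying c_mem]])
    (simp_all add: \<psi>_pos[OF mult_sech_square_mem[OF \<mu>_mem[OF c_mem]]])

lemma integral_\<psi>_le_integral_\<theta>\<psi>:
  assumes c_mem: "c \<in> speeds"
  shows "3/2 * (LINT t|lborel. \<psi> (\<mu> c * sech_square t)) \<le> (LINT t|lborel. \<theta>\<psi> (\<mu> c * sech_square t))"
proof -
  have "(LINT t|lborel. 3/2 * \<psi> (\<mu> c * sech_square t)) \<le> (LINT t|lborel. \<theta>\<psi> (\<mu> c * sech_square t))"
    using exp_decaying_integrable[OF \<psi>_exp_decaying c_mem] exp_decaying_integrable[OF \<theta>\<psi>_exp_decaying c_mem]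
      \<theta>\<psi>_bounds(1)[OF mult_sech_square_mem[OF \<mu>_mem[OF c_mem]]]
    by (intro integral_mono) auto
  then show ?thesis by simp
qed

lemma integral_\<psi>_DERIV:
  assumes c_mem: "c \<in> speeds"
  shows "((\<lambda>c. LINT t|lborel. \<psi> (\<mu> c * sech_square t)) has_real_derivative
    (LINT t|lborel. \<theta>\<psi> (\<mu> c * sech_square t)) / \<mu> c * (- 2 * c)) (at c)"
  using C1_exp_decaying_integral_has_derivative[OF \<psi>_C1_exp_decaying c_mem, of "\<lambda>_. 1" 1] by simp

lemma momentum_decreasing:
  assumes c_mem: "c \<in> speeds"
  shows "\<exists>D. ((\<lambda>c. momentum (eta c) (vel_dx 0 c)) has_real_derivative D) (at c) \<and> D < 0"
proof -
  define P where "P = (LINT t|lborel. \<psi> (\<mu> c * sech_square t))"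
  define Q where "Q = (LINT t|lborel. \<theta>\<psi> (\<mu> c * sech_square t))"
  define r where "r = sqrt (\<mu> c)"
  have r_pos_sq: "0 < r" "r * r = \<mu> c" using \<mu>_pos[OF c_mem] by (auto simp: r_def)
  have "((\<lambda>c. c / (2 * sqrt (\<mu> c))) has_real_derivative
      (1 * (2 * r) - c * (2 * (- c / r))) / ((2 * r) * (2 * r))) (at c)"
    unfolding r_def using \<mu>_pos[OF c_mem]
    by (intro DERIV_divide DERIV_ident DERIV_cmult sqrt_\<mu>_DERIV[OF c_mem]) auto
  from DERIV_mult[OF this integral_\<psi>_DERIV[OF c_mem]]
  have "((\<lambda>c. c / (2 * sqrt (\<mu> c)) * (LINT t|lborel. \<psi> (\<mu> c * sech_square t))) has_real_derivative
      (1 * (2 * r) - c * (2 * (- c / r))) / ((2 * r) * (2 * r)) * P + Q / \<mu> c * (- 2 * c) * (c / (2 * r))) (at c)"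
    by (simp add: r_def P_def Q_def)
  also have "(1 * (2 * r) - c * (2 * (- c / r))) / ((2 * r) * (2 * r)) * P + Q / \<mu> c * (- 2 * c) * (c / (2 * r))
      = ((r * r + c^2) * P - 2 * c^2 * Q) / (2 * r * (r * r))"
    unfolding r_pos_sq(2)[symmetric] using r_pos_sq(1) by (simp add: field_simps power2_eq_square)
  finally have "((\<lambda>c. momentum (eta c) (vel_dx 0 c)) has_real_derivative
      ((r * r + c^2) * P - 2 * c^2 * Q) / (2 * r * (r * r))) (at c)"
    by (rule has_field_derivative_transform_within_open[OF _ open_I c_mem]) (simp add: momentum_eq)
  moreover have "(r * r + c^2) * P - 2 * c^2 * Q < 0"
  proof -
    have "c0^2 < c^2" using c_mem c0_pos by (auto simp: speeds_def intro!: power_strict_mono)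
    then have "r * r + c^2 < 3 * c^2" using cs_sq_le r_pos_sq(2) by (simp add: \<mu>_def)
    then have "(r * r + c^2) * P < (3 * c^2) * P"
      using integral_\<psi>_pos[OF c_mem] by (intro mult_strict_right_mono) (auto simp: P_def)
    also have "\<dots> = 2 * c^2 * (3/2 * P)" by simp
    also have "\<dots> \<le> 2 * c^2 * Q"
      using integral_\<psi>_le_integral_\<theta>\<psi>[OF c_mem] by (intro mult_left_mono) (auto simp: P_def Q_def)
    finally show ?thesis by simp
  qed
  then have "((r * r + c^2) * P - 2 * c^2 * Q) / (2 * r * (r * r)) < 0"
    using r_pos_sq(1) by (simp add: divide_neg_pos)
  ultimately show ?thesis by blast
qed

end

section \<open>Uniqueness\<close>

lemma integrable_ex_greater_less:
  fixes g :: "real \<Rightarrow> real"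
  assumes g_integrable: "integrable lborel g" and g_nonneg: "\<And>x. 0 \<le> g x" and \<epsilon>_pos: "0 < \<epsilon>"
  shows "\<exists>b>a. g b < \<epsilon>"
proof (rule ccontr)
  assume "\<not> (\<exists>b>a. g b < \<epsilon>)"
  then have g_ge: "\<epsilon> \<le> g b" if "b > a" for b using that by force
  have "real n * \<epsilon> \<le> (LINT x|lborel. g x)" for n :: nat
  proof -
    have "(LINT x|lborel. \<epsilon> * indicator {a<..a + real n} x) \<le> (LINT x|lborel. g x)"
    proof (rule integral_mono[OF _ g_integrable])
      show "integrable lborel (\<lambda>x. \<epsilon> * indicator {a<..a + real n} x)" by simp
    qed (use g_ge g_nonneg in \<open>auto simp: indicator_def\<close>)
    then show ?thesis by (simp add: mult.commute)
  qed
  moreover obtain n :: nat where "(LINT x|lborel. g x) / \<epsilon> < real n"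
    using reals_Archimedean2 by blast
  ultimately show False using \<epsilon>_pos by (metis divide_less_eq not_less)
qed

lemma integrable_ex_smaller_less:
  fixes g :: "real \<Rightarrow> real"
  assumes "integrable lborel g" "\<And>x. 0 \<le> g x" "0 < \<epsilon>"
  shows "\<exists>b<a. g b < \<epsilon>"
proof -
  have "integrable lborel (\<lambda>x. g (0 + (-1) * x))"
    by (rule lborel_integrable_real_affine[OF assms(1)]) simp
  from integrable_ex_greater_less[OF this, of \<epsilon> "- a"] assms(2,3)
  obtain b where "b > - a" "g (- b) < \<epsilon>" by auto
  then show ?thesis by (intro exI[of _ "- b"]) auto
qed

lemma L2fun_ex_abs_less:
  assumes "L2fun u" "0 < \<epsilon>"
  shows "\<exists>b>a. \<bar>u b\<bar> < \<epsilon>" "\<exists>b<a. \<bar>u b\<bar> < \<epsilon>"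
proof -
  have "\<bar>u b\<bar> < \<epsilon>" if "(u b)^2 < \<epsilon>^2" for b
    using that assms(2) by (metis abs_ge_zero abs_of_pos power2_abs power2_less_imp_less less_imp_le)
  moreover have "integrable lborel (\<lambda>x. (u x)^2)" using assms(1) by (simp add: L2fun_def)
  ultimately show "\<exists>b>a. \<bar>u b\<bar> < \<epsilon>" "\<exists>b<a. \<bar>u b\<bar> < \<epsilon>"
    using integrable_ex_greater_less[of "\<lambda>x. (u x)^2" "\<epsilon>^2" a]
      integrable_ex_smaller_less[of "\<lambda>x. (u x)^2" "\<epsilon>^2" a] assms(2) by auto
qed

lemma L2fun_pair_vanishing_sequence:
  assumes "L2fun u" "L2fun v"
  obtains X where "(\<lambda>n. u (X n)) \<longlonglongrightarrow> 0" "(\<lambda>n. v (X n)) \<longlonglongrightarrow> 0"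
proof -
  have sum_integrable: "integrable lborel (\<lambda>x. (u x)^2 + (v x)^2)"
    using assms by (auto simp: L2fun_def)
  have "\<exists>x. (u x)^2 + (v x)^2 < 1 / (real n + 1)" for n
    using integrable_ex_greater_less[OF sum_integrable, of "1 / (real n + 1)" 0] by auto
  then obtain X where X_small: "\<And>n. (u (X n))^2 + (v (X n))^2 < 1 / (real n + 1)" by metis
  have vanishing: "w \<longlonglongrightarrow> 0" if "\<And>n. (w n)^2 \<le> 1 / (real n + 1)" for w :: "nat \<Rightarrow> real"
  proof -
    have "(\<lambda>n. (w n)^2) \<longlonglongrightarrow> 0"
    proof (rule Lim_null_comparison)
      show "(\<lambda>n. 1 / (real n + 1)) \<longlonglongrightarrow> 0" by real_asymp
    qed (use that in \<open>auto intro!: always_eventually\<close>)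
    then have "(\<lambda>n. sqrt ((w n)^2)) \<longlonglongrightarrow> sqrt 0" by (intro tendsto_intros)
    then show ?thesis by (simp add: tendsto_rabs_zero_iff)
  qed
  have "(u (X n))^2 \<le> 1 / (real n + 1)" "(v (X n))^2 \<le> 1 / (real n + 1)" for n
    using X_small[of n] zero_le_power2[of "u (X n)"] zero_le_power2[of "v (X n)"] by linarith+
  then show ?thesis by (intro that[of X] vanishing)
qed

lemma bdd_above_if_L2fun_deriv:
  assumes deriv: "\<And>x. (u has_real_derivative u' x) (at x)" "continuous_on UNIV u'"
    and u_L2_deriv: "L2fun u" "L2fun u'"
  shows "bdd_above (range u)"
proof -
  let ?g = "\<lambda>x. (u x)^2 + (u' x)^2"
  have sum_integrable: "integrable lborel ?g" using u_L2_deriv by (auto simp: L2fun_def)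
  have variation: "\<bar>(u b)^2 - (u a)^2\<bar> \<le> (LINT x|lborel. ?g x)" if "a \<le> b" for a b
  proof -
    let ?k = "\<lambda>x. 2 * u x * u' x"
    have FTC: "has_bochner_integral lborel (\<lambda>x. ?k x * indicator {a..b} x) ((u b)^2 - (u a)^2)"
    proof (rule has_bochner_integral_FTC_Icc_real[OF that])
      show "((\<lambda>x. (u x)^2) has_real_derivative ?k x) (at x)" for x
        using deriv(1)[of x] by (auto intro!: derivative_eq_intros)
      show "isCont ?k x" for x
        using DERIV_isCont[OF deriv(1)] deriv(2)
        by (intro continuous_intros) (auto simp: continuous_on_eq_continuous_at)
    qed
    then have "integrable lborel (\<lambda>x. ?k x * indicator {a..b} x)"
      by (simp add: has_bochner_integral_iff)
    then have "(LINT x|lborel. \<bar>?k x * indicator {a..b} x\<bar>) \<le> (LINT x|lborel. ?g x)"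
    proof (intro integral_mono sum_integrable integrable_abs)
      fix x
      have "0 \<le> (\<bar>u x\<bar> - \<bar>u' x\<bar>)^2" by simp
      then have "2 * (\<bar>u x\<bar> * \<bar>u' x\<bar>) \<le> ?g x" unfolding power2_diff by simp
      then show "\<bar>?k x * indicator {a..b} x\<bar> \<le> ?g x" by (auto simp: indicator_def abs_mult)
    qed
    then show ?thesis
      using integral_norm_bound[of lborel "\<lambda>x. ?k x * indicator {a..b} x"]
        has_bochner_integral_integral_eq[OF FTC] by simp
  qed
  have "u x \<le> 1 + ((u 0)^2 + (LINT x|lborel. ?g x))" for x
  proof -
    have "u x \<le> 1 + (u x)^2"
      using zero_le_power2[of "u x - 1/2"] by (simp add: power2_eq_square algebra_simps)
    also have "(u x)^2 \<le> (u 0)^2 + (LINT x|lborel. ?g x)"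
      using variation[of 0 x] variation[of x 0] by (cases "0 \<le> x") auto
    finally show ?thesis by simp
  qed
  then show ?thesis by (auto simp: bdd_above_def)
qed

lemma ex_interior_critical_point:
  fixes u u' :: "real \<Rightarrow> real"
  assumes deriv: "\<And>x. (u has_real_derivative u' x) (at x)"
    and "a < x" "x < b" "u a < u x" "u b < u x"
  shows "\<exists>z. a < z \<and> z < b \<and> u x \<le> u z \<and> u' z = 0"
proof -
  have "continuous_on {a..b} u"
    using deriv DERIV_isCont by (blast intro: continuous_at_imp_continuous_on)
  then have "\<exists>z\<in>{a..b}. \<forall>y\<in>{a..b}. u y \<le> u z"
    using assms by (intro continuous_attains_sup) auto
  then obtain z where z_max: "z \<in> {a..b}" "\<And>y. y \<in> {a..b} \<Longrightarrow> u y \<le> u z" by blast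
  have u_x_le: "u x \<le> u z" using z_max(2)[of x] assms by auto
  then have "z \<noteq> a" "z \<noteq> b" using assms by auto
  then have z_interior: "a < z" "z < b" using z_max(1) by auto
  have "u' z = 0"
    by (rule DERIV_local_max[OF deriv, of "min (z - a) (b - z)"])
      (use z_interior z_max(2) in \<open>auto simp: abs_if split: if_splits\<close>)
  with z_interior u_x_le show ?thesis by blast
qed

lemma Gronwall_zero_right:
  fixes y y' :: "real \<Rightarrow> real"
  assumes deriv: "\<And>x. (y has_real_derivative y' x) (at x)" and growth: "\<And>x. \<bar>y' x\<bar> \<le> M * y x"
    and nonneg: "\<And>x. 0 \<le> y x" and init: "y 0 = 0" and x_nonneg: "0 \<le> x"
  shows "y x = 0"
proof -
  have "y x * exp (- M * x) \<le> y 0 * exp (- M * 0)"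
  proof (rule DERIV_nonpos_imp_nonincreasing[where f = "\<lambda>x. y x * exp (- M * x)", OF x_nonneg])
    fix t
    have "((\<lambda>x. y x * exp (- M * x)) has_real_derivative (y' t - M * y t) * exp (- M * t)) (at t)"
      using deriv[of t] by (auto intro!: derivative_eq_intros simp: algebra_simps)
    moreover have "(y' t - M * y t) * exp (- M * t) \<le> 0"
      using growth[of t] by (intro mult_nonpos_nonneg) auto
    ultimately show "\<exists>z. ((\<lambda>x. y x * exp (- M * x)) has_real_derivative z) (at t) \<and> z \<le> 0" by blast
  qed
  then show ?thesis using nonneg[of x] init by (auto simp: mult_le_0_iff not_le[symmetric])
qed

lemma Gronwall_zero:
  fixes y y' :: "real \<Rightarrow> real"
  assumes "\<And>x. (y has_real_derivative y' x) (at x)" "\<And>x. \<bar>y' x\<bar> \<le> M * y x" "\<And>x. 0 \<le> y x" "y 0 = 0"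
  shows "y x = 0"
proof (cases "0 \<le> x")
  case False
  have "((\<lambda>x. y (- x)) has_real_derivative - y' (- x)) (at x)" for x
    using assms(1)[of "- x"] by (simp add: DERIV_mirror)
  from Gronwall_zero_right[OF this, of M "- x"] assms False show ?thesis by simp
qed (use Gronwall_zero_right[OF assms] in simp)

lemma second_order_ODE_unique:
  fixes u u' w w' g :: "real \<Rightarrow> real"
  assumes u_solution: "\<And>x. (u has_real_derivative u' x) (at x)" "\<And>x. (u' has_real_derivative g (u x)) (at x)"
    and w_solution: "\<And>x. (w has_real_derivative w' x) (at x)" "\<And>x. (w' has_real_derivative g (w x)) (at x)"
    and in_S: "\<And>x. u x \<in> S" "\<And>x. w x \<in> S" and g_lipschitz: "M-lipschitz_on S g"
    and init: "u 0 = w 0" "u' 0 = w' 0"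
  shows "u x = w x"
proof -
  have M_nonneg: "0 \<le> M" by (rule lipschitz_on_nonneg[OF g_lipschitz])
  let ?d = "\<lambda>x. u x - w x" and ?d1 = "\<lambda>x. u' x - w' x" and ?d2 = "\<lambda>x. g (u x) - g (w x)"
  have "(?d x)^2 + (?d1 x)^2 = 0"
  proof (rule Gronwall_zero[where y = "\<lambda>x. (?d x)^2 + (?d1 x)^2"
        and y' = "\<lambda>x. 2 * ?d x * ?d1 x + 2 * ?d1 x * ?d2 x" and M = "1 + M"])
    show "((\<lambda>x. (?d x)^2 + (?d1 x)^2) has_real_derivative 2 * ?d x * ?d1 x + 2 * ?d1 x * ?d2 x) (at x)" for x
      by (rule DERIV_cong[OF DERIV_add[OF DERIV_power[OF DERIV_diff[OF u_solution(1) w_solution(1)]]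
            DERIV_power[OF DERIV_diff[OF u_solution(2) w_solution(2)]]]]) (simp add: algebra_simps)
    show "\<bar>2 * ?d x * ?d1 x + 2 * ?d1 x * ?d2 x\<bar> \<le> (1 + M) * ((?d x)^2 + (?d1 x)^2)" for x
    proof -
      have lipschitz: "\<bar>?d2 x\<bar> \<le> M * \<bar>?d x\<bar>"
        using lipschitz_onD[OF g_lipschitz in_S(1)[of x] in_S(2)[of x]] by (simp add: dist_real_def)
      have "\<bar>2 * ?d x * ?d1 x + 2 * ?d1 x * ?d2 x\<bar> \<le> 2 * \<bar>?d x\<bar> * \<bar>?d1 x\<bar> + 2 * \<bar>?d1 x\<bar> * \<bar>?d2 x\<bar>"
        by (rule order_trans[OF abs_triangle_ineq]) (simp only: abs_mult abs_numeral order_refl)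
      also have "\<dots> \<le> 2 * \<bar>?d x\<bar> * \<bar>?d1 x\<bar> + 2 * \<bar>?d1 x\<bar> * (M * \<bar>?d x\<bar>)"
        using lipschitz by (intro add_left_mono mult_left_mono) auto
      also have "\<dots> = (1 + M) * (2 * \<bar>?d x\<bar> * \<bar>?d1 x\<bar>)" by (simp add: algebra_simps)
      also have "\<dots> \<le> (1 + M) * ((?d x)^2 + (?d1 x)^2)"
        using M_nonneg sum_squares_bound[of "\<bar>?d x\<bar>" "\<bar>?d1 x\<bar>"] by (intro mult_left_mono) auto
      finally show ?thesis .
    qed
  qed (use init in auto)
  then show ?thesis by (simp add: sum_power2_eq_zero_iff)
qed

context pressure_law
begin

lemma TW_first_integral_constant:
  fixes m :: real
  defines "G \<equiv> \<lambda>e e1. (e1^2 - (m * e^2 - N 0 e)) / (1 - e)"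
  assumes u_solution: "\<And>x. (u has_real_derivative u' x) (at x)" "\<And>x. (u' has_real_derivative u'' x) (at x)"
    "\<And>x. u x < 1" and u'': "\<And>x. u'' x = m * u x - N 1 (u x) / 2 - G (u x) (u' x) / 2"
  shows "G (u x) (u' x) = G (u y) (u' y)"
proof (rule DERIV_isconst_all[where f = "\<lambda>x. G (u x) (u' x)"], intro allI)
  fix x
  define a where "a = 1 - u x"
  have a_nonzero: "a \<noteq> 0" using u_solution(3)[of x] by (simp add: a_def)
  let ?num = "\<lambda>x. (u' x)^2 - (m * (u x)^2 - N 0 (u x))"
  have G_eq: "G (u x) (u' x) = ?num x / a" by (simp add: G_def a_def)
  have "(N 0 has_real_derivative N 1 (u x)) (at (u x))"
    using N_DERIV[OF u_solution(3), of 0] by simp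
  from DERIV_chain2[OF this u_solution(1)]
  have "(?num has_real_derivative 2 * u' x * u'' x - (m * (2 * u x * u' x) - N 1 (u x) * u' x)) (at x)"
    using u_solution(1,2)[of x] by (auto intro!: derivative_eq_intros)
  also have "2 * u' x * u'' x - (m * (2 * u x * u' x) - N 1 (u x) * u' x) = - u' x * ?num x / a"
    unfolding u'' G_eq using a_nonzero by (simp add: field_simps)
  finally have "((\<lambda>x. ?num x / (1 - u x)) has_real_derivative
      ((- u' x * ?num x / a) * (1 - u x) - ?num x * (0 - u' x)) / ((1 - u x) * (1 - u x))) (at x)"
    using a_nonzero unfolding a_def by (intro DERIV_divide DERIV_diff DERIV_const u_solution(1))
  moreover have "((- u' x * ?num x / a) * (1 - u x) - ?num x * (0 - u' x)) / ((1 - u x) * (1 - u x)) = 0"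
    unfolding a_def[symmetric] using a_nonzero by simp
  ultimately show "((\<lambda>x. G (u x) (u' x)) has_real_derivative 0) (at x)"
    unfolding G_def by (simp only:)
qed

lemma TW_first_integral_zero:
  assumes u_solution: "\<And>x. (u has_real_derivative u' x) (at x)" "\<And>x. (u' has_real_derivative u'' x) (at x)"
      "\<And>x. u x < 1"
    and u'': "\<And>x. u'' x = m * u x - N 1 (u x) / 2 - ((u' x)^2 - (m * (u x)^2 - N 0 (u x))) / (2 * (1 - u x))"
    and u_L2_deriv: "L2fun u" "L2fun u'"
  shows "(u' x)^2 = m * (u x)^2 - N 0 (u x)"
proof -
  define G where "G = (\<lambda>e e1. (e1^2 - (m * e^2 - N 0 e)) / (1 - e))"
  obtain X where X_tendsto: "(\<lambda>n. u (X n)) \<longlonglongrightarrow> 0" "(\<lambda>n. u' (X n)) \<longlonglongrightarrow> 0"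
    by (rule L2fun_pair_vanishing_sequence[OF u_L2_deriv])
  have "isCont (N 0) 0" using DERIV_isCont[OF N_DERIV[of 0 0]] by simp
  from isCont_tendsto_compose[OF this X_tendsto(1)]
  have "(\<lambda>n. G (u (X n)) (u' (X n))) \<longlonglongrightarrow> (0^2 - (m * 0^2 - N 0 0)) / (1 - 0)"
    unfolding G_def by (intro tendsto_intros X_tendsto) simp_all
  moreover have "(\<lambda>n. G (u (X n)) (u' (X n))) = (\<lambda>_. G (u x) (u' x))"
    unfolding G_def by (rule ext, rule TW_first_integral_constant[OF u_solution]) (simp add: u'')
  ultimately have "G (u x) (u' x) = 0" by (simp add: LIMSEQ_const_iff N_at_0)
  then show ?thesis using u_solution(3)[of x] by (simp add: G_def)
qed

end

lemma (in small_amplitude) N_1_lipschitz: "K-lipschitz_on {0..\<delta>} (N 1)"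
proof (rule lipschitz_onI[OF _ K_nonneg])
  fix a b assume a_b_mem: "a \<in> {0..\<delta>}" "b \<in> {0..\<delta>}"
  have "norm (N 1 a - N 1 b) \<le> K * norm (a - b)"
  proof (rule field_differentiable_bound[where S = "{0..\<delta>}"])
    fix t assume t_mem: "t \<in> {0..\<delta>}"
    show "(N 1 has_real_derivative N 2 t) (at t within {0..\<delta>})"
      using N_DERIV[of t 1] t_mem \<delta>_less_1 by (auto simp: numeral_2_eq_2 intro: has_field_derivative_at_within)
    show "norm (N 2 t) \<le> K"
    proof (cases "t = 0")
      case False
      then have "\<bar>N 2 t\<bar> \<le> K * t" using N_bound[of t 2] t_mem by simp
      also have "\<dots> \<le> K * 1" using K_nonneg t_mem \<delta>_less_1 by (intro mult_left_mono) auto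
      finally show ?thesis by simp
    qed (use N_at_0[of 2] K_nonneg in simp)
  qed (use a_b_mem in auto)
  then show "dist (N 1 a) (N 1 b) \<le> K * dist a b" by (simp add: dist_norm)
qed

locale localized_wave = solitary_waves +
  fixes c :: real and u u' :: "real \<Rightarrow> real"
  assumes speed: "c \<in> speeds"
    and u_DERIV: "(u has_real_derivative u' x) (at x)"
    and u'_DERIV: "(u' has_real_derivative \<mu> c * u x - N 1 (u x) / 2) (at x)"
    and u'_sq: "(u' x)^2 = \<mu> c * (u x)^2 - N 0 (u x)"
    and u_less_1: "u x < 1"
    and u_L2: "L2fun u"
    and u_nonzero: "\<exists>x. u x \<noteq> 0"
begin

lemma critical_point_above:
  assumes s_sign: "s = 1 \<or> s = -1" and s_u_pos: "0 < s * u x" and \<epsilon>_pos: "0 < \<epsilon>"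
  obtains a z where "s * u x \<le> s * u z" "u' z = 0" "a < z" "\<bar>u a\<bar> < \<epsilon>"
proof -
  have min: "0 < min (s * u x) \<epsilon>" using s_u_pos \<epsilon>_pos by simp
  obtain a b where a_b_small: "a < x" "x < b" "\<bar>u a\<bar> < min (s * u x) \<epsilon>" "\<bar>u b\<bar> < min (s * u x) \<epsilon>"
    using L2fun_ex_abs_less[OF u_L2 min, of x] by blast
  have "((\<lambda>x. s * u x) has_real_derivative s * u' x) (at x)" for x
    by (rule DERIV_cmult[OF u_DERIV])
  moreover have "s * u a < s * u x" "s * u b < s * u x" using a_b_small s_sign by auto
  ultimately obtain z where "a < z" "s * u x \<le> s * u z" "s * u' z = 0"
    using ex_interior_critical_point[of "\<lambda>x. s * u x" "\<lambda>x. s * u' x" a x b] a_b_small by blast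
  then show ?thesis using a_b_small s_sign by (intro that[of z a]) auto
qed

lemma u_nonneg: "0 \<le> u x"
proof (rule ccontr)
  assume "\<not> 0 \<le> u x"
  then obtain z where z_trough: "u z \<le> u x" "u x < 0" "u' z = 0"
    using critical_point_above[of "-1" x 1] by auto
  have "\<mu> c * (u z)^2 = N 0 (u z)" using u'_sq[of z] z_trough(3) by simp
  also have "\<dots> \<le> cs^2 * (u z)^3" by (rule N_le[OF u_less_1])
  also have "\<dots> < 0" using z_trough cs_pos by (simp add: mult_less_0_iff power_less_zero_eq)
  finally show False using \<mu>_pos[OF speed] by (simp add: mult_less_0_iff not_le[symmetric])
qed

lemma h_\<mu>: "0 < h (\<mu> c)" "h (\<mu> c) < \<delta>" "\<omega> (h (\<mu> c)) = \<mu> c"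
  using h_mem[OF \<mu>_mem[OF speed]] \<omega>_h[OF \<mu>_mem[OF speed]] by auto

lemma u_omits:
  assumes e_between: "h (\<mu> c) < e" "e \<le> \<delta>"
  shows "u x \<noteq> e"
proof
  assume "u x = e"
  have "\<mu> c < \<omega> e" using \<omega>_less[of "h (\<mu> c)" e] h_\<mu> e_between by simp
  then have "\<mu> c * e^2 < N 0 e" using e_between h_\<mu> by (simp add: \<omega>_def less_divide_eq)
  then show False using u'_sq[of x] zero_le_power2[of "u' x"] \<open>u x = e\<close> by simp
qed

lemma ex_crest:
  assumes "0 < u x"
  shows "\<exists>z. u z = h (\<mu> c) \<and> u' z = 0 \<and> u x \<le> h (\<mu> c)"
proof -
  have "0 < 1 * u x" "0 < h (\<mu> c)" using assms h_\<mu> by auto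
  then obtain a z where z_crest: "1 * u x \<le> 1 * u z" "u' z = 0" "a < z" "\<bar>u a\<bar> < h (\<mu> c)"
    by (rule critical_point_above[OF disjI1[OF refl]])
  have u_z: "0 < u z" using z_crest assms by simp
  have "u z < \<delta>"
  proof (rule ccontr)
    assume "\<not> u z < \<delta>"
    moreover have "continuous_on {a..z} u"
      using u_DERIV DERIV_isCont by (blast intro: continuous_at_imp_continuous_on)
    ultimately have "\<exists>t\<ge>a. t \<le> z \<and> u t = \<delta>"
      using z_crest h_\<mu> by (intro IVT') auto
    then show False using u_omits[of \<delta>] h_\<mu> by blast
  qed
  moreover have "\<omega> (u z) = \<mu> c" using u'_sq[of z] z_crest(2) u_z by (simp add: \<omega>_def field_simps)
  ultimately have "u z = h (\<mu> c)" using h_\<omega>[of "u z"] u_z by simp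
  with z_crest show ?thesis by auto
qed

lemma translate_of_eta: "\<exists>a. \<forall>x. u x = eta c (x + a)"
proof -
  obtain x0 where "0 < u x0" using u_nonzero u_nonneg by (metis order_le_less)
  then obtain z where z_crest: "u z = h (\<mu> c)" "u' z = 0" using ex_crest by blast
  have u_mem: "u x \<in> {0..\<delta>}" for x
    using ex_crest[of x] u_nonneg[of x] h_\<mu> by (cases "0 < u x") auto
  have shift: "((\<lambda>x. v (x + z)) has_real_derivative v' (x + z)) (at x)"
    if "\<And>x. (v has_real_derivative v' x) (at x)" for v v' x
    using that[of "x + z"] by (simp add: DERIV_shift)
  have lipschitz: "(\<bar>\<mu> c\<bar> * 1 + \<bar>1 / 2\<bar> * K)-lipschitz_on {0..\<delta>} (\<lambda>e. \<mu> c * e - 1 / 2 * N 1 e)"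
    by (intro lipschitz_intros N_1_lipschitz)
  have "u (x + z) = eta c x" for x
  proof (rule second_order_ODE_unique[OF shift[OF u_DERIV] _ eta_DERIV_x[OF speed] _ _ _ lipschitz])
    show "((\<lambda>x. u' (x + z)) has_real_derivative \<mu> c * u (x + z) - 1 / 2 * N 1 (u (x + z))) (at x)" for x
      using shift[OF u'_DERIV] by simp
    show "(eta_dx 1 c has_real_derivative \<mu> c * eta c x - 1 / 2 * N 1 (eta c x)) (at x)" for x
      using eta_dx_1_DERIV_x[OF speed] by (simp add: eta_dx_2)
    show "eta c x \<in> {0..\<delta>}" for x using eta_mem[OF speed, of x] by auto
    show "u' (0 + z) = eta_dx 1 c 0" by (simp only: eta_dx_1_at_0[OF speed] z_crest add_0)
  qed (use z_crest u_mem in \<open>auto simp: eta_0[OF speed]\<close>)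
  from this[of "x - z" for x] show ?thesis by (intro exI[of _ "- z"]) simp
qed

end

context solitary_waves
begin

lemma localized_wave_if_TW:
  assumes c_mem: "c \<in> speeds" and NX: "in_NX 2 u v" and TW: "TW_hy f c u v" and nonzero: "\<exists>x. u x \<noteq> 0"
  shows "localized_wave f f1 f2 f3 cs \<delta> K c0 c u (deriv u)"
proof -
  define u' where "u' = deriv u"
  define u'' where "u'' = deriv u'"
  have u_derivs: "(u has_real_derivative u' x) (at x)" "(u' has_real_derivative u'' x) (at x)"
    and first: "c / 2 * u x = v x * (1 - u x)"
    and second: "c * v x = f (1 - u x) - (v x)^2 - u'' x / (2 * (1 - u x)) - (u' x)^2 / (4 * (1 - u x)^2)" for x
    using TW unfolding TW_hy_def u'_def u''_def by auto
  have cont: "continuous_on UNIV u" "continuous_on UNIV u'"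
    using u_derivs DERIV_isCont by (blast intro: continuous_at_imp_continuous_on)+
  have u_H: "in_H 3 u" and sup: "Sup (range u) < 1"
    using NX by (auto simp: in_NX_def in_X_def)
  note u_weak = is_weak_deriv_0[OF cont(1)]
  have u_L2_deriv: "L2fun u" "L2fun u'"
    using in_H_continuous_deriv_L2fun[OF u_H _ u_weak cont(1)]
      in_H_continuous_deriv_L2fun[OF u_H _ is_weak_deriv_Suc[OF u_weak u_derivs(1) cont(2)] cont(2)] by simp_all
  have less_1: "u x < 1" for x
    using cSUP_upper[of x UNIV u] bdd_above_if_L2fun_deriv[OF u_derivs(1) cont(2) u_L2_deriv] sup
    by (meson UNIV_I le_less_trans)
  have u''_eq: "u'' x = \<mu> c * u x - N 1 (u x) / 2
      - ((u' x)^2 - (\<mu> c * (u x)^2 - N 0 (u x))) / (2 * (1 - u x))" for x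
    using TW_second_equation_iff[OF less_1 first, of x] second[of x] unfolding \<mu>_def by blast
  have energy: "(u' x)^2 = \<mu> c * (u x)^2 - N 0 (u x)" for x
    by (rule TW_first_integral_zero[OF u_derivs less_1 u''_eq u_L2_deriv])
  have "(u' has_real_derivative \<mu> c * u x - N 1 (u x) / 2) (at x)" for x
    using u_derivs(2)[of x] by (simp add: u''_eq energy)
  with c_mem u_derivs(1) energy less_1 u_L2_deriv(1) nonzero show ?thesis
    unfolding u'_def by unfold_locales auto
qed

lemma TW_unique:
  assumes c_mem: "c \<in> speeds" and NX: "in_NX 2 u v" and TW: "TW_hy f c u v"
    and not_constant: "\<nexists>a b. \<forall>x. u x = a \<and> v x = b"
  shows "\<exists>a. \<forall>x. u x = eta c (x + a) \<and> v x = vel_dx 0 c (x + a)"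
proof -
  have first: "c / 2 * u x = v x * (1 - u x)" for x
    using TW by (simp add: TW_hy_def)
  have "\<exists>x. u x \<noteq> 0"
  proof (rule ccontr)
    assume "\<not> (\<exists>x. u x \<noteq> 0)"
    then have "u x = 0 \<and> v x = 0" for x using first[of x] by auto
    then show False using not_constant by blast
  qed
  then interpret localized_wave f f1 f2 f3 cs \<delta> K c0 c u "deriv u"
    by (rule localized_wave_if_TW[OF c_mem NX TW])
  obtain a where u_eq: "\<And>x. u x = eta c (x + a)" using translate_of_eta by blast
  have "v x = c / 2 * (u x / (1 - u x))" for x
    using first[of x] u_less_1[of x] by (simp add: field_simps)
  then show ?thesis using u_eq by (intro exI[of _ a]) (simp add: vel_dx_def)
qed

lemma C2_NX_eta_vel: "C2_NX 2 speeds eta (vel_dx 0)"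
  and has_pds_eta: "has_pds eta speeds 2 3" and has_pds_vel: "has_pds (vel_dx 0) speeds 2 2"
proof -
  have eta: "Cp_exp_decaying_family speeds 2 3 (\<lambda>k j. param_deriv j (eta_dx k))"
    and vel: "Cp_exp_decaying_family speeds 2 2 (\<lambda>k j. param_deriv j (vel_dx k))"
    by (auto intro!: Cp_exp_decaying_family_param_deriv S_eta_dx eta_dx_DERIV_x S_vel_dx vel_dx_DERIV_x)
  show "C2_NX 2 speeds eta (vel_dx 0)"
    using C2_NX_if_C2_exp_decaying[where E = "\<lambda>k j. param_deriv j (eta_dx k)", OF _ vel] eta Sup_eta_less_1
    by (simp add: eta_dx_0)
  show "has_pds eta speeds 2 3" "has_pds (vel_dx 0) speeds 2 2"
    using Cp_exp_decaying_family.has_pds_D[OF eta] Cp_exp_decaying_family.has_pds_D[OF vel]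
    by (simp_all add: eta_dx_0)
qed

end

theorem mainTheorem1:
  fixes f f1 f2 f3 :: "real \<Rightarrow> real" and cs :: real
  assumes f_d1: "\<forall>x\<ge>0. (f has_real_derivative f1 x) (at x within {0..})"
      and f_d2: "\<forall>x\<ge>0. (f1 has_real_derivative f2 x) (at x within {0..})"
      and f_d3: "\<forall>x\<ge>0. (f2 has_real_derivative f3 x) (at x within {0..})"
      and f_C3: "continuous_on {0..} f3"
      and f1_zero: "f 1 = 0"
      and f1_neg: "f1 1 < 0"
      and cs_def: "cs = sqrt (- 2 * f1 1)"
      and H1: "\<forall>\<rho>\<ge>0. cs^2 / 4 * (1 - \<rho>)^2 \<le> Fpot f \<rho>"
      and H2: "\<exists>M q. M \<ge> 0 \<and> q \<ge> 2 \<and> (\<forall>\<rho>\<ge>2. Fpot f \<rho> \<le> M * \<bar>1 - \<rho>\<bar> powr q)"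
      and H3: "f2 1 + 3 * f1 1 \<noteq> 0"
  shows "\<exists>c0 \<in> {0<..<cs}. \<exists>\<eta> v :: real \<Rightarrow> real \<Rightarrow> real.
     (\<forall>c\<in>{c0<..<cs}.
        in_NX 2 (\<eta> c) (v c) \<and> TW_hy f c (\<eta> c) (v c) \<and>
        \<not> (\<exists>a b. \<forall>x. \<eta> c x = a \<and> v c x = b) \<and>
        (\<forall>x. \<eta> c (- x) = \<eta> c x \<and> v c (- x) = v c x) \<and>
        (\<forall>\<eta>' v'. in_NX 2 \<eta>' v' \<and> TW_hy f c \<eta>' v' \<and> \<not> (\<exists>a b. \<forall>x. \<eta>' x = a \<and> v' x = b)
            \<longrightarrow> (\<exists>a. \<forall>x. \<eta>' x = \<eta> c (x + a) \<and> v' x = v c (x + a)))) \<and>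
     C2_NX 2 {c0<..<cs} \<eta> v \<and>
     (\<forall>c\<in>{c0<..<cs}. \<exists>D. ((\<lambda>c'. momentum (\<eta> c') (v c')) has_real_derivative D) (at c) \<and> D < 0) \<and>
     has_pds \<eta> {c0<..<cs} 2 3 \<and> has_pds v {c0<..<cs} 2 2 \<and>
     (\<exists>ad Kd. ad > 0 \<and> Kd > 0 \<and>
        (\<forall>c\<in>{c0<..<cs}. \<forall>x.
           (\<Sum>k1\<le>3. \<Sum>k2\<le>2. \<Sum>j\<le>2::nat.
              (cs^2 - c^2) powi (int j - 1) *
              (\<bar>pd \<eta> j k1 c x\<bar> + c ^ (1 + 2*j + 2*k2) * \<bar>pd v j k2 c x\<bar>))
           \<le> Kd * exp (- ad * sqrt (cs^2 - c^2) * \<bar>x\<bar>)))"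
proof -
  interpret pressure_law f f1 f2 f3 cs
    by unfold_locales (rule f_d1 f_d2 f_d3 f_C3 f1_zero f1_neg cs_def H1)+
  obtain \<delta> K c0 where "solitary_waves f f1 f2 f3 cs \<delta> K c0"
    using ex_solitary_waves by blast
  then interpret solitary_waves f f1 f2 f3 cs \<delta> K c0 .
  have even: "eta c (- x) = eta c x \<and> vel_dx 0 c (- x) = vel_dx 0 c x" if "c \<in> speeds" for c x
    using eta_minus[OF that] by (simp add: vel_dx_def)
  have in_NX: "in_NX 2 (eta c) (vel_dx 0 c)" if "c \<in> speeds" for c
    using C2_NX_eta_vel that unfolding C2_NX_def by blast
  show ?thesis
  proof (rule bexI[of _ c0], rule exI[of _ eta], rule exI[of _ "vel_dx 0"],
      intro conjI ballI allI impI, fold speeds_def)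
    show "c0 \<in> {0<..<cs}" using c0_pos c0_less by simp
    fix c assume c_mem: "c \<in> speeds"
    show "\<nexists>a b. \<forall>x. eta c x = a \<and> vel_dx 0 c x = b" using eta_not_constant[OF c_mem] by metis
    show "\<exists>a. \<forall>x. u x = eta c (x + a) \<and> v x = vel_dx 0 c (x + a)"
      if "in_NX 2 u v \<and> TW_hy f c u v \<and> (\<nexists>a b. \<forall>x. u x = a \<and> v x = b)" for u v
      using TW_unique[OF c_mem] that by blast
  qed (rule even[THEN conjunct1] even[THEN conjunct2] in_NX TW_hy_eta C2_NX_eta_vel momentum_decreasing
      has_pds_eta has_pds_vel eta_vel_decay; assumption?)+
qed

end
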